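(* For every integer $s\geq 1$, the Euler characteristic of the moduli space $\bar X_s=\mathcal{MRG}_{1,s}$ of holocolored one-loop graphs with remembered edges and $s$ legs is $$\chi(\bar X_s)=(s!)^2\sum_{k=1}^{s}\frac{(-1)^{k-1}(1+\delta_{1,k})}{2k}\sum_{\substack{1\leq i_1\leq\cdots\leq i_k\\ i_1+\cdots+i_k=s}}\frac{g(i_1,\ldots,i_k)}{\prod_{n=1}^{k}i_n!\,(i_n-1)!},$$ where $\delta_{1,k}$ is the Kronecker delta and $$g(i_1,\ldots,i_k)=\frac{k!}{\prod_{n\in\{i_1,\ldots,i_k\}}\bigl|\{l\in\{1,\ldots,k\}\mid i_l=n\}\bigr|!},$$ the product in the denominator running over the distinct values $n$ occurring among $i_1,\ldots,i_k$.
   Context: Graphs are finite multigraphs (self-loops and multiple edges allowed) with a set $E(G)$ of internal edges and $s$ external legs labeled bijectively by $1,\ldots,s$, each leg attached to a vertex. A one-loop admissible graph with $s$ legs is a cycle with $k$ vertices and $k$ internal edges, $1\leq k\leq s$ ($k=1$: one vertex with a self-loop; $k=2$: two vertices joined by a double edge), each vertex carrying at least one leg. The set of colors is $C=\{1,\ldots,s\}$; a holocoloring is an injective map $c:E(G)\to C$. In $\bar X_s$ the color of an edge is remembered when the edge is shrunk to length zero. Concretely: a weighted graph is a triple $(G,c,w)$ with $G$ one-loop admissible with $s$ legs, $c$ a holocoloring and $w$ assigning to each vertex $v$ a set $w(v)\subset C$ with $|w(v)|=(\text{number of legs at }v)-1$, such that the sets $w(v)$, over all vertices $v$, and $c(E(G))$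 are pairwise disjoint with union $C$ (the set $w(v)$ records the colors of the edges which were collapsed to $v$). Isomorphisms of weighted graphs are graph isomorphisms preserving leg labels, edge colors and vertex weights. Collapsing a non-loop edge $e$ with end vertices $u\neq v$ merges $u$ and $v$ into one vertex with weight $w(u)\cup w(v)\cup\{c(e)\}$. For each isomorphism class of weighted graphs with $k$ edges take the closed simplex of dimension $k-1$ of all metrics $\lambda:E(G)\to\mathbb{R}_{\geq 0}$ with $\sum_e\lambda(e)=1$. $\bar X_s$ is the quotient space of the disjoint union of these simplices obtained by identifying a point whose metric vanishes on $Z\subsetneq E(G)$ with the corresponding point $\lambda|_{E(G)\setminus Z}$ in the simplex of the weighted graph obtained by collapsing all edges in $Z$, and by identifying points $(G,c,w,\lambda)$, $(G',c',w',\lambda')$ related by an isomorphism of weighted graphs carrying $\lambda$ to $\lambda'$. *)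

theory Defs
  imports "HOL-Homology.Homology" "HOL-Library.Extended_Nat"
begin

section \<open>Graphs with legs, and their colorings and weights\<close>

text \<open>
  Vertices and edges are drawn from the universe of natural numbers.  An edge is attached to
  its set of end vertices, which is a singleton for a self-loop.  The legs are identified with
  their labels \<open>1, \<dots>, s\<close>; \<open>leg i\<close> is the vertex to which leg \<open>i\<close> is attached.
\<close>

record multigraph =
  verts :: "nat set"
  edges :: "nat set"
  ends  :: "nat \<Rightarrow> nat set"
  leg   :: "nat \<Rightarrow> nat"

record weighted_graph = multigraph +
  color  :: "nat \<Rightarrow> nat"
  weight :: "nat \<Rightarrow> nat set"

definition legs_at :: "nat \<Rightarrow> ('a) multigraph_scheme \<Rightarrow> nat \<Rightarrow> nat set" where
  "legs_at s G v = {i \<in> {1..s}. leg G i = v}"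

definition is_multigraph :: "nat \<Rightarrow> ('a) multigraph_scheme \<Rightarrow> bool" where
  "is_multigraph s G \<longleftrightarrow>
     finite (verts G) \<and> finite (edges G) \<and>
     (\<forall>e\<in>edges G. ends G e \<subseteq> verts G \<and> card (ends G e) \<in> {1, 2}) \<and>
     (\<forall>i\<in>{1..s}. leg G i \<in> verts G)"

text \<open>
  For \<open>k = 1\<close> the condition below describes a vertex with a self-loop, for \<open>k = 2\<close> a double edge.
\<close>

definition is_cycle :: "nat \<Rightarrow> ('a) multigraph_scheme \<Rightarrow> bool" where
  "is_cycle k G \<longleftrightarrow>
     (\<exists>x y. bij_betw x {..<k} (verts G) \<and> bij_betw y {..<k} (edges G) \<and>
            (\<forall>j<k. ends G (y j) = {x j, x ((j + 1) mod k)}))"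

definition one_loop_admissible :: "nat \<Rightarrow> ('a) multigraph_scheme \<Rightarrow> bool" where
  "one_loop_admissible s G \<longleftrightarrow>
     is_multigraph s G \<and> (\<exists>k\<in>{1..s}. is_cycle k G) \<and> (\<forall>v\<in>verts G. legs_at s G v \<noteq> {})"

definition holocoloring :: "nat \<Rightarrow> ('a) multigraph_scheme \<Rightarrow> (nat \<Rightarrow> nat) \<Rightarrow> bool" where
  "holocoloring s G c \<longleftrightarrow> inj_on c (edges G) \<and> c ` edges G \<subseteq> {1..s}"

definition is_weighted_graph :: "nat \<Rightarrow> weighted_graph \<Rightarrow> bool" where
  "is_weighted_graph s G \<longleftrightarrow>
     one_loop_admissible s G \<and> holocoloring s G (color G) \<and>
     (\<forall>v\<in>verts G. weight G v \<subseteq> {1..s} \<and> card (weight G v) = card (legs_at s G v) - 1) \<and>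
     disjoint_family_on (weight G) (verts G) \<and>
     (\<forall>v\<in>verts G. weight G v \<inter> color G ` edges G = {}) \<and>
     (\<Union>v\<in>verts G. weight G v) \<union> color G ` edges G = {1..s}"

definition weighted_graph_iso ::
  "nat \<Rightarrow> weighted_graph \<Rightarrow> weighted_graph \<Rightarrow> (nat \<Rightarrow> nat) \<Rightarrow> (nat \<Rightarrow> nat) \<Rightarrow> bool" where
  "weighted_graph_iso s G H f h \<longleftrightarrow>
     bij_betw f (verts G) (verts H) \<and> bij_betw h (edges G) (edges H) \<and>
     (\<forall>e\<in>edges G. ends H (h e) = f ` ends G e) \<and>
     (\<forall>i\<in>{1..s}. leg H i = f (leg G i)) \<and>
     (\<forall>e\<in>edges G. color H (h e) = color G e) \<and>
     (\<forall>v\<in>verts G. weight H (f v) = weight G v)"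


section \<open>Collapsing edges\<close>

text \<open>
  The vertex obtained by merging the two ends of \<open>e\<close> is named by the smaller of them; up to
  isomorphism the choice of name is irrelevant.
\<close>

definition merge_ends :: "weighted_graph \<Rightarrow> nat \<Rightarrow> nat \<Rightarrow> nat" where
  "merge_ends G e v = (if v \<in> ends G e then Min (ends G e) else v)"

definition collapse :: "weighted_graph \<Rightarrow> nat \<Rightarrow> weighted_graph" where
  "collapse G e =
     \<lparr>verts = merge_ends G e ` verts G,
      edges = edges G - {e},
      ends = (\<lambda>d. merge_ends G e ` ends G d),
      leg = (\<lambda>i. merge_ends G e (leg G i)),
      color = color G,
      weight = (\<lambda>v. if v = Min (ends G e)
                     then (\<Union>u\<in>ends G e. weight G u) \<union> {color G e}
                     else weight G v)\<rparr>"

text \<open>\<open>collapses G Z H\<close>: collapsing the edges in \<open>Z\<close> one after the other turns \<open>G\<close> into \<open>H\<close>.\<close>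

inductive collapses :: "weighted_graph \<Rightarrow> nat set \<Rightarrow> weighted_graph \<Rightarrow> bool" where
  none: "collapses G {} G"
| step: "\<lbrakk>e \<in> edges G; card (ends G e) = 2; e \<notin> Z; collapses (collapse G e) Z H\<rbrakk>
           \<Longrightarrow> collapses G (insert e Z) H"


section \<open>Quotient spaces\<close>

definition quotient_space :: "'a topology \<Rightarrow> ('a \<times> 'a) set \<Rightarrow> 'a set topology" where
  "quotient_space X R =
     topology (\<lambda>U. U \<subseteq> topspace X // R \<and> openin X {x \<in> topspace X. R `` {x} \<in> U})"

lemma openin_quotient_space:
  "openin (quotient_space X R) U \<longleftrightarrow>
     U \<subseteq> topspace X // R \<and> openin X {x \<in> topspace X. R `` {x} \<in> U}"
proof -
  have "istopology (\<lambda>U. U \<subseteq> topspace X // R \<and> openin X {x \<in> topspace X. R `` {x} \<in> U})"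
    unfolding istopology_def
  proof (intro conjI allI impI)
    fix S T
    assume S: "S \<subseteq> topspace X // R \<and> openin X {x \<in> topspace X. R `` {x} \<in> S}"
      and T: "T \<subseteq> topspace X // R \<and> openin X {x \<in> topspace X. R `` {x} \<in> T}"
    show "S \<inter> T \<subseteq> topspace X // R" using S by blast
    have "{x \<in> topspace X. R `` {x} \<in> S \<inter> T} =
            {x \<in> topspace X. R `` {x} \<in> S} \<inter> {x \<in> topspace X. R `` {x} \<in> T}"
      by blast
    then show "openin X {x \<in> topspace X. R `` {x} \<in> S \<inter> T}"
      using S T by (simp add: openin_Int)
  next
    fix \<K>
    assume K: "\<forall>K\<in>\<K>. K \<subseteq> topspace X // R \<and> openin X {x \<in> topspace X. R `` {x} \<in> K}"
    show "\<Union>\<K> \<subseteq> topspace X // R" using K by blast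
    have "{x \<in> topspace X. R `` {x} \<in> \<Union>\<K>} = (\<Union>K\<in>\<K>. {x \<in> topspace X. R `` {x} \<in> K})"
      by blast
    then show "openin X {x \<in> topspace X. R `` {x} \<in> \<Union>\<K>}"
      using K by auto
  qed
  then show ?thesis
    by (simp add: quotient_space_def)
qed

lemma topspace_quotient_space: "topspace (quotient_space X R) = topspace X // R"
proof -
  have "{x \<in> topspace X. R `` {x} \<in> topspace X // R} = topspace X"
    by (auto intro: quotientI)
  then have "openin (quotient_space X R) (topspace X // R)"
    by (simp add: openin_quotient_space)
  then show ?thesis
    by (metis openin_quotient_space openin_subset openin_topspace subset_antisym)
qed

lemma quotient_map_quotient_space:
  "quotient_map X (quotient_space X R) (\<lambda>x. R `` {x})"
  unfolding quotient_map_def topspace_quotient_space openin_quotient_space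
  by (auto simp: quotient_def)


section \<open>The moduli space\<close>

definition metric_simplex :: "weighted_graph \<Rightarrow> (nat \<Rightarrow> real) topology" where
  "metric_simplex G =
     subtopology (powertop_real (edges G))
       {l. (\<forall>e\<in>edges G. 0 \<le> l e) \<and> (\<Sum>e\<in>edges G. l e) = 1}"

text \<open>
  There is one simplex for every weighted graph in the universe, not just one for every
  isomorphism class: isomorphic weighted graphs are identified by \<open>iso_identified\<close> below.
\<close>

definition simplex_union :: "nat \<Rightarrow> (weighted_graph \<times> (nat \<Rightarrow> real)) topology" where
  "simplex_union s = sum_topology metric_simplex {G. is_weighted_graph s G}"

definition face_identified ::
  "weighted_graph \<times> (nat \<Rightarrow> real) \<Rightarrow> weighted_graph \<times> (nat \<Rightarrow> real) \<Rightarrow> bool" where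
  "face_identified p q \<longleftrightarrow>
     (\<exists>G l Z H. p = (G, l) \<and> Z \<subset> edges G \<and> (\<forall>e\<in>Z. l e = 0) \<and>
                collapses G Z H \<and> q = (H, restrict l (edges G - Z)))"

definition iso_identified ::
  "nat \<Rightarrow> weighted_graph \<times> (nat \<Rightarrow> real) \<Rightarrow> weighted_graph \<times> (nat \<Rightarrow> real) \<Rightarrow> bool" where
  "iso_identified s p q \<longleftrightarrow>
     (\<exists>G l H m f h. p = (G, l) \<and> q = (H, m) \<and> weighted_graph_iso s G H f h \<and>
                    (\<forall>e\<in>edges G. m (h e) = l e))"

definition identification ::
  "nat \<Rightarrow> ((weighted_graph \<times> (nat \<Rightarrow> real)) \<times> (weighted_graph \<times> (nat \<Rightarrow> real))) set" where
  "identification s =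
     {(p, q). p \<in> topspace (simplex_union s) \<and>
        equivclp (\<lambda>p q. p \<in> topspace (simplex_union s) \<and> q \<in> topspace (simplex_union s) \<and>
                         (face_identified p q \<or> iso_identified s p q)) p q}"

definition MRG1 :: "nat \<Rightarrow> (weighted_graph \<times> (nat \<Rightarrow> real)) set topology" where
  "MRG1 s = quotient_space (simplex_union s) (identification s)"


section \<open>Euler characteristic of a topological space\<close>

text \<open>
  The rank of an abelian group is the largest number of elements that are linearly independent
  over the integers.
\<close>

definition int_independent :: "('a, 'b) monoid_scheme \<Rightarrow> 'a set \<Rightarrow> bool" where
  "int_independent G B \<longleftrightarrow>
     finite B \<and> B \<subseteq> carrier G \<and>
     (\<forall>n :: 'a \<Rightarrow> int.
        finprod G (\<lambda>b. b [^]\<^bsub>G\<^esub> n b) B = \<one>\<^bsub>G\<^esub> \<longrightarrow> (\<forall>b\<in>B. n b = 0))"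

definition abelian_rank :: "('a, 'b) monoid_scheme \<Rightarrow> enat" where
  "abelian_rank G = (SUP B\<in>{B. int_independent G B}. enat (card B))"

definition betti_number :: "nat \<Rightarrow> 'a topology \<Rightarrow> enat" where
  "betti_number p X = abelian_rank (homology_group (int p) X)"

text \<open>\<open>euler_characteristic X\<close> is meaningful only if \<open>has_finite_betti_numbers X\<close> holds.\<close>

definition has_finite_betti_numbers :: "'a topology \<Rightarrow> bool" where
  "has_finite_betti_numbers X \<longleftrightarrow>
     (\<forall>p. betti_number p X \<noteq> \<infinity>) \<and> finite {p. betti_number p X \<noteq> 0}"

definition euler_characteristic :: "'a topology \<Rightarrow> int" where
  "euler_characteristic X =
     (\<Sum>p | betti_number p X \<noteq> 0. (- 1) ^ p * int (the_enat (betti_number p X)))"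


section \<open>The index set and the combinatorial factor of the formula\<close>

definition increasing_compositions :: "nat \<Rightarrow> nat \<Rightarrow> nat list set" where
  "increasing_compositions k s =
     {I. length I = k \<and> sorted I \<and> (\<forall>i\<in>set I. 1 \<le> i) \<and> sum_list I = s}"

lemma finite_increasing_compositions: "finite (increasing_compositions k s)"
proof (rule finite_subset)
  show "increasing_compositions k s \<subseteq> {I. set I \<subseteq> {..s} \<and> length I = k}"
    by (auto simp: increasing_compositions_def dest: member_le_sum_list)
  show "finite {I. set I \<subseteq> {..s} \<and> length I = k}"
    by (rule finite_lists_length_eq) simp
qed

definition g_coeff :: "nat list \<Rightarrow> real" where
  "g_coeff I =
     fact (length I) / (\<Prod>n\<in>set I. fact (card {l. l < length I \<and> I ! l = n}))"

end

theory Submission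
  imports Defs "HOL-Combinatorics.Multiset_Permutations"
begin

text \<open>
  The colors of the edges embed every closed simplex into the moduli space, and the faces of a
  simplex correspond to sets of surviving colors, so the space is a finite regular cell complex
  with one cell of dimension \<open>k - 1\<close> for each isomorphism class of weighted graphs with \<open>k\<close> edges.
  Attaching a cell changes the Euler characteristic by \<open>1\<close> minus that of the boundary: remove the
  barycenter, deform radially, and compare the long exact sequences of the two punctured pairs,
  whose relative groups agree by excision.

  Points of the space are recognised by an invariant: leg \<open>i\<close> and color \<open>c\<close> (or two legs) are
  connected after deleting a set \<open>B\<close> of edges. This relation is unaffected by collapsing edges outside
  \<open>B\<close>, and knowing it for all \<open>B\<close> determines the graph up to isomorphism.

  Finally, the dihedral group of order \<open>2k\<close> (trivial for \<open>k = 1\<close>) acts freely on the labelled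
  configurations of legs, weights and edge colors on a fixed cycle, and these are counted by
  multinomial coefficients.
\<close>

section \<open>Rank-nullity for homomorphisms of abelian groups\<close>

section \<open>The rank of an abelian group\<close>

text \<open>An isomorphism preserves colors and a holocoloring is injective, so an automorphism of a
  weighted graph fixes every edge. Hence no simplex is folded onto itself, and the length of a color
  is a continuous function on the whole space: one map, \<open>lengths\<close>, is the chart of
  every cell at once.

  The obstacle is that the identification is the equivalence closure of two generating relations,
  which leaves open which points it keeps apart. A complete invariant settles this. It exists
  because a collapsed edge stays present as a color in a vertex weight: what the edge held together
  is still held together by that color.

  Codes built from the invariant stand for isomorphism classes, since the free choice of vertex and
  edge names gives infinitely many graphs in a class. The size of the homology groups is not known
  beforehand, so ranks take values in the extended natural numbers, and finiteness is carried
  through the induction over cells together with the alternating sum.\<close>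

definition rank_in :: "('a, 'b) monoid_scheme \<Rightarrow> 'a set \<Rightarrow> enat" where
  "rank_in G S = (SUP B\<in>{B. int_independent G B \<and> B \<subseteq> S}. enat (card B))"

lemma abelian_rank_eq_rank_in: "abelian_rank G = rank_in G (carrier G)"
proof -
  have "{B. int_independent G B} = {B. int_independent G B \<and> B \<subseteq> carrier G}"
    by (auto simp: int_independent_def)
  then show ?thesis by (simp add: abelian_rank_def rank_in_def)
qed

text \<open>A rank may be infinite, so it is handled through the finite numbers below it. For a
  positive number the strict bound \<open>enat m\<close> under a supremum is witnessed by a member;
  for \<open>0\<close> the empty set serves.\<close>

lemma enat_le_rank_in_iff:
  assumes "group G"
  shows "enat n \<le> rank_in G S \<longleftrightarrow> (\<exists>B. int_independent G B \<and> B \<subseteq> S \<and> n \<le> card B)"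
proof (cases n)
  case 0
  then show ?thesis
    by (auto simp: int_independent_def zero_enat_def[symmetric] intro!: exI[of _ "{}"])
next
  case (Suc m)
  then show ?thesis
    by (auto simp: Suc_ile_eq rank_in_def less_SUP_iff Suc_le_eq)
qed

lemma enat_le_add_iff:
  "enat n \<le> x + y \<longleftrightarrow> (\<exists>i j. i + j = n \<and> enat i \<le> x \<and> enat j \<le> y)"
proof
  assume *: "enat n \<le> x + y"
  show "\<exists>i j. i + j = n \<and> enat i \<le> x \<and> enat j \<le> y"
  proof (cases x)
    case (enat a)
    show ?thesis
    proof (cases "n \<le> a")
      case True
      then show ?thesis using enat by (intro exI[of _ n] exI[of _ 0]) (auto simp: zero_enat_def[symmetric])
    next
      case False
      then show ?thesis using enat *
        by (intro exI[of _ a] exI[of _ "n - a"], cases y) auto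
    qed
  next
    case infinity
    then show ?thesis by (intro exI[of _ n] exI[of _ 0]) (auto simp: zero_enat_def[symmetric])
  qed
next
  show "\<exists>i j. i + j = n \<and> enat i \<le> x \<and> enat j \<le> y \<Longrightarrow> enat n \<le> x + y"
    using add_mono by (metis plus_enat_simps(1))
qed

lemma enat_eqI: "(\<And>n. enat n \<le> x \<longleftrightarrow> enat n \<le> y) \<Longrightarrow> x = y"
proof (rule antisym)
  have *: "x \<le> y" if "\<And>n. enat n \<le> x \<Longrightarrow> enat n \<le> y" for x y
  proof (cases x)
    case infinity
    show ?thesis
    proof (cases y)
      case (enat m)
      then show ?thesis using that[of "Suc m"] infinity by simp
    qed auto
  qed (use that in auto)
  assume eq: "\<And>n. enat n \<le> x \<longleftrightarrow> enat n \<le> y"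
  show "x \<le> y" "y \<le> x" by (rule *; simp add: eq)+
qed

text \<open>Coefficients are attached to indices, so relations among images \<open>f b\<close> or
  combinations \<open>k a\<close> can be studied before it is known that these values are
  distinct.\<close>

definition int_independent_family ::
  "('a, 'b) monoid_scheme \<Rightarrow> ('i \<Rightarrow> 'a) \<Rightarrow> 'i set \<Rightarrow> bool" where
  "int_independent_family G v A \<longleftrightarrow>
     finite A \<and> v ` A \<subseteq> carrier G \<and>
     (\<forall>n :: 'i \<Rightarrow> int. finprod G (\<lambda>a. v a [^]\<^bsub>G\<^esub> n a) A = \<one>\<^bsub>G\<^esub> \<longrightarrow> (\<forall>a\<in>A. n a = 0))"

lemma int_independentD:
  fixes n :: "'a \<Rightarrow> int"
  assumes "int_independent G B" "finprod G (\<lambda>b. b [^]\<^bsub>G\<^esub> n b) B = \<one>\<^bsub>G\<^esub>" "b \<in> B"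
  shows "n b = 0"
  using assms by (simp add: int_independent_def)

text \<open>Coefficients 1 and -1 at two indices with equal values would form a nontrivial
  relation.\<close>

lemma (in comm_group) int_independent_family_inj:
  assumes "int_independent_family G v A"
  shows "inj_on v A"
proof (rule inj_onI, rule ccontr)
  fix a b assume ab: "a \<in> A" "b \<in> A" "v a = v b" "a \<noteq> b"
  have fin: "finite A" and v: "\<And>a. a \<in> A \<Longrightarrow> v a \<in> carrier G"
    using assms by (auto simp: int_independent_family_def)
  define n :: "'c \<Rightarrow> int" where "n = (\<lambda>x. if x = a then 1 else if x = b then -1 else 0)"
  have "finprod G (\<lambda>x. v x [^] n x) A = finprod G (\<lambda>x. v x [^] n x) {a,b}"
    using fin ab v by (intro finprod_mono_neutral_cong_left[symmetric]) (auto simp: n_def)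
  also have "\<dots> = \<one>"
    using ab v by (simp add: n_def int_pow_neg)
  finally have "n a = 0"
    using assms ab(1) unfolding int_independent_family_def by blast
  then show False by (simp add: n_def)
qed

lemma (in comm_group) int_independent_family_image:
  assumes "int_independent_family G v A"
  shows "int_independent G (v ` A)" "card (v ` A) = card A"
proof -
  have inj: "inj_on v A" using int_independent_family_inj[OF assms] .
  show "card (v ` A) = card A" using inj by (rule card_image)
  have fin: "finite A" and v: "v ` A \<subseteq> carrier G"
    using assms by (auto simp: int_independent_family_def)
  show "int_independent G (v ` A)"
    unfolding int_independent_def
  proof (intro conjI allI impI)
    fix n :: "'a \<Rightarrow> int"
    assume "finprod G (\<lambda>b. b [^] n b) (v ` A) = \<one>"
    then have "finprod G (\<lambda>a. v a [^] (n \<circ> v) a) A = \<one>"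
      using v inj by (subst (asm) finprod_reindex) auto
    then show "\<forall>b\<in>v ` A. n b = 0"
      using assms by (fastforce simp: int_independent_family_def)
  qed (use fin v in auto)
qed

lemma (in comm_group) int_independent_family_rank:
  assumes "int_independent_family G v A" "v ` A \<subseteq> S"
  shows "enat (card A) \<le> rank_in G S"
  using int_independent_family_image[OF assms(1)] assms(2)
  by (subst enat_le_rank_in_iff) (auto intro!: exI[of _ "v ` A"])

lemma hom_finprod_int_pow:
  assumes "comm_group G" "comm_group H" "f \<in> hom G H" "v \<in> A \<rightarrow> carrier G"
  shows "f (finprod G (\<lambda>a. v a [^]\<^bsub>G\<^esub> (n a :: int)) A) = finprod H (\<lambda>a. f (v a) [^]\<^bsub>H\<^esub> n a) A"
proof -
  interpret G: comm_group G by fact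
  interpret H: comm_group H by fact
  interpret f: group_hom G H f
    by (simp add: group_hom_def group_hom_axioms_def assms G.is_group H.is_group)
  have "f (finprod G (\<lambda>a. v a [^]\<^bsub>G\<^esub> (n a :: int)) A) = finprod H (\<lambda>a. f (v a [^]\<^bsub>G\<^esub> n a)) A"
    using assms(4)
  proof (induction A rule: infinite_finite_induct)
    case (insert x F)
    then show ?case by (simp add: Pi_def)
  qed auto
  also have "\<dots> = finprod H (\<lambda>a. f (v a) [^]\<^bsub>H\<^esub> n a) A"
    using assms(4) by (intro H.finprod_cong) (auto simp: f.hom_int_pow Pi_def)
  finally show ?thesis .
qed

lemma (in comm_group) finprod_int_pow_distrib:
  assumes "finite A" "v \<in> A \<rightarrow> carrier G"
  shows "finprod G (\<lambda>a. v a [^] (n a :: int)) A [^] (m :: int) = finprod G (\<lambda>a. v a [^] (m * n a)) A"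
  using assms
proof (induction A rule: finite_induct)
  case (insert x F)
  then show ?case by (simp add: Pi_def int_pow_mult_distrib m_comm int_pow_pow mult.commute)
qed auto

text \<open>For \<open>\<le>\<close>, take inside an independent set \<open>A\<close> a largest
  \<open>B\<close> whose images stay independent; every \<open>a\<close> in \<open>A - B\<close>
  then yields a kernel element \<open>k a\<close>, and these are independent. For
  \<open>\<ge>\<close>, an independent set in the kernel together with lifts of one in the image is
  independent. Over the integers a coefficient can in general only be made nonzero, not 1, and
  independence asks for no more.\<close>

theorem abelian_rank_kernel_image:
  assumes G: "comm_group G" and H: "comm_group H" and f: "f \<in> hom G H"
  shows "abelian_rank G = rank_in G (kernel G H f) + rank_in H (f ` carrier G)"
proof (rule enat_eqI)
  interpret G: comm_group G by fact
  interpret H: comm_group H by fact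
  interpret f: group_hom G H f
    by (simp add: group_hom_def group_hom_axioms_def assms G.is_group H.is_group)
  fix n
  show "enat n \<le> abelian_rank G \<longleftrightarrow> enat n \<le> rank_in G (kernel G H f) + rank_in H (f ` carrier G)"
  proof
    assume "enat n \<le> abelian_rank G"
    then obtain A where A: "int_independent G A" "n \<le> card A"
      by (auto simp: abelian_rank_eq_rank_in enat_le_rank_in_iff)
    have finA: "finite A" and cA: "A \<subseteq> carrier G"
      using A by (auto simp: int_independent_def)
    define P where "P = (\<lambda>B. B \<subseteq> A \<and> int_independent_family H f B)"
    have "P {}" by (auto simp: P_def int_independent_family_def)
    moreover have "\<forall>B. P B \<longrightarrow> card B < Suc (card A)"
      using finA by (auto simp: P_def less_Suc_eq_le card_mono)
    ultimately obtain B where B: "P B" and max: "\<And>C. P C \<Longrightarrow> card C \<le> card B"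
      using ex_has_greatest_nat[of P "{}" card] by blast
    have BA: "B \<subseteq> A" and indB: "int_independent_family H f B" using B by (auto simp: P_def)
    have finB: "finite B" using BA finA finite_subset by blast
    have fB: "f ` B \<subseteq> f ` carrier G" using BA cA by auto
    have r2: "enat (card B) \<le> rank_in H (f ` carrier G)"
      by (rule H.int_independent_family_rank[OF indB fB])
    \<comment> \<open>Enlarging \<open>B\<close> by \<open>a\<close> destroys independence. The
      coefficient of \<open>a\<close> in the resulting relation is nonzero, since otherwise the
      relation would live on \<open>B\<close>.\<close>
    have "\<exists>m :: 'a \<Rightarrow> int. m a \<noteq> 0 \<and> finprod H (\<lambda>x. f x [^]\<^bsub>H\<^esub> m x) (insert a B) = \<one>\<^bsub>H\<^esub>"
      if a: "a \<in> A - B" for a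
    proof -
      have "\<not> P (insert a B)" using max[of "insert a B"] a finB by auto
      then have "\<not> int_independent_family H f (insert a B)"
        using a BA by (auto simp: P_def)
      then obtain m :: "'a \<Rightarrow> int" where m: "finprod H (\<lambda>x. f x [^]\<^bsub>H\<^esub> m x) (insert a B) = \<one>\<^bsub>H\<^esub>"
        and nz: "\<exists>x\<in>insert a B. m x \<noteq> 0"
      proof -
        have "finite (insert a B)" "f ` insert a B \<subseteq> carrier H"
          using a BA cA finB by auto
        then show ?thesis
          using \<open>\<not> int_independent_family H f (insert a B)\<close> that
          unfolding int_independent_family_def by blast
      qed
      have "m a \<noteq> 0"
      proof
        assume "m a = 0"
        moreover have "finprod H (\<lambda>x. f x [^]\<^bsub>H\<^esub> m x) B \<in> carrier H"
          using BA cA by (intro H.finprod_closed) auto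
        moreover have "finprod H (\<lambda>x. f x [^]\<^bsub>H\<^esub> m x) (insert a B)
            = f a [^]\<^bsub>H\<^esub> m a \<otimes>\<^bsub>H\<^esub> finprod H (\<lambda>x. f x [^]\<^bsub>H\<^esub> m x) B"
          using a BA cA finB by (intro H.finprod_insert) auto
        ultimately have "finprod H (\<lambda>x. f x [^]\<^bsub>H\<^esub> m x) B = \<one>\<^bsub>H\<^esub>"
          using m by simp
        then show False using indB nz \<open>m a = 0\<close> by (auto simp: int_independent_family_def)
      qed
      with m show ?thesis by blast
    qed
    then obtain m :: "'a \<Rightarrow> 'a \<Rightarrow> int" where m0: "\<And>a. a \<in> A - B \<Longrightarrow> m a a \<noteq> 0"
      and m: "\<And>a. a \<in> A - B \<Longrightarrow> finprod H (\<lambda>x. f x [^]\<^bsub>H\<^esub> m a x) (insert a B) = \<one>\<^bsub>H\<^esub>"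
      by metis
    \<comment> \<open>The relation holds after applying \<open>f\<close>, so the corresponding
      combination in \<open>G\<close> lies in the kernel.\<close>
    define k where "k a = finprod G (\<lambda>x. x [^]\<^bsub>G\<^esub> m a x) (insert a B)" for a
    have kc: "k a \<in> carrier G" if "a \<in> A - B" for a
      unfolding k_def using that BA cA by (intro G.finprod_closed) auto
    have kker: "k a \<in> kernel G H f" if "a \<in> A - B" for a
      unfolding kernel_def mem_Collect_eq
    proof (intro conjI)
      show "f (k a) = \<one>\<^bsub>H\<^esub>"
        unfolding k_def using that BA cA
        by (subst hom_finprod_int_pow[OF G H f]) (auto simp: m)
    qed (rule kc[OF that])
    have indk: "int_independent_family G k (A - B)"
      unfolding int_independent_family_def
    proof (intro conjI allI impI ballI)
      fix c :: "'a \<Rightarrow> int" and a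
      assume c: "finprod G (\<lambda>a. k a [^]\<^bsub>G\<^esub> c a) (A - B) = \<one>\<^bsub>G\<^esub>" and a: "a \<in> A - B"
      \<comment> \<open>Coefficients of a combination of the \<open>k a\<close> expanded over
        \<open>A\<close>: off \<open>B\<close> only the diagonal entry \<open>m x x\<close> occurs,
        so independence of \<open>A\<close> gives \<open>c a * m a a = 0\<close>.\<close>
      define d where "d x = (if x \<in> B then (\<Sum>a\<in>A - B. c a * m a x) else c x * m x x)" for x
      have step: "k a [^]\<^bsub>G\<^esub> c a
          = a [^]\<^bsub>G\<^esub> (c a * m a a) \<otimes>\<^bsub>G\<^esub> finprod G (\<lambda>x. x [^]\<^bsub>G\<^esub> (c a * m a x)) B"
        if "a \<in> A - B" for a
        unfolding k_def using that BA cA finB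
        by (subst G.finprod_int_pow_distrib) (auto intro!: G.finprod_insert)
      have swap: "finprod G (\<lambda>a. finprod G (\<lambda>x. x [^]\<^bsub>G\<^esub> (c a * m a x)) B) S
          = finprod G (\<lambda>x. x [^]\<^bsub>G\<^esub> (\<Sum>a\<in>S. c a * m a x)) B" if "finite S" "S \<subseteq> A - B" for S
        using that
      proof (induction S rule: finite_induct)
        case empty
        then show ?case by (simp add: G.finprod_one_eqI)
      next
        case (insert y S)
        have Bc: "\<And>x. x \<in> B \<Longrightarrow> x \<in> carrier G" using BA cA by auto
        have "finprod G (\<lambda>a. finprod G (\<lambda>x. x [^]\<^bsub>G\<^esub> (c a * m a x)) B) (insert y S)
          = finprod G (\<lambda>x. x [^]\<^bsub>G\<^esub> (c y * m y x)) B \<otimes>\<^bsub>G\<^esub> finprod G (\<lambda>x. x [^]\<^bsub>G\<^esub> (\<Sum>a\<in>S. c a * m a x)) B"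
          using insert Bc by (subst G.finprod_insert) (auto intro!: G.finprod_closed)
        also have "\<dots> = finprod G (\<lambda>x. x [^]\<^bsub>G\<^esub> (c y * m y x) \<otimes>\<^bsub>G\<^esub> x [^]\<^bsub>G\<^esub> (\<Sum>a\<in>S. c a * m a x)) B"
          using Bc by (intro G.finprod_multf[symmetric]) auto
        also have "\<dots> = finprod G (\<lambda>x. x [^]\<^bsub>G\<^esub> (\<Sum>a\<in>insert y S. c a * m a x)) B"
          using Bc insert by (intro G.finprod_cong) (auto simp: G.int_pow_mult)
        finally show ?case .
      qed
      have "\<one>\<^bsub>G\<^esub> = finprod G (\<lambda>a. a [^]\<^bsub>G\<^esub> (c a * m a a) \<otimes>\<^bsub>G\<^esub> finprod G (\<lambda>x. x [^]\<^bsub>G\<^esub> (c a * m a x)) B) (A - B)"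
        unfolding c[symmetric] using step BA cA
        by (intro G.finprod_cong) (auto intro!: G.finprod_closed G.m_closed G.int_pow_closed kc)
      also have "\<dots> = finprod G (\<lambda>a. a [^]\<^bsub>G\<^esub> (c a * m a a)) (A - B)
          \<otimes>\<^bsub>G\<^esub> finprod G (\<lambda>a. finprod G (\<lambda>x. x [^]\<^bsub>G\<^esub> (c a * m a x)) B) (A - B)"
        using BA cA by (intro G.finprod_multf) (auto intro!: G.finprod_closed)
      also have "finprod G (\<lambda>a. finprod G (\<lambda>x. x [^]\<^bsub>G\<^esub> (c a * m a x)) B) (A - B)
          = finprod G (\<lambda>x. x [^]\<^bsub>G\<^esub> d x) B"
        using finA BA cA by (subst swap) (auto simp: d_def intro!: G.finprod_cong)
      also have "finprod G (\<lambda>a. a [^]\<^bsub>G\<^esub> (c a * m a a)) (A - B) = finprod G (\<lambda>x. x [^]\<^bsub>G\<^esub> d x) (A - B)"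
        using BA cA by (intro G.finprod_cong) (auto simp: d_def)
      also have "finprod G (\<lambda>x. x [^]\<^bsub>G\<^esub> d x) (A - B) \<otimes>\<^bsub>G\<^esub> finprod G (\<lambda>x. x [^]\<^bsub>G\<^esub> d x) B
          = finprod G (\<lambda>x. x [^]\<^bsub>G\<^esub> d x) ((A - B) \<union> B)"
        using BA cA finA finB by (intro G.finprod_Un_disjoint[symmetric]) auto
      also have "(A - B) \<union> B = A" using BA by auto
      finally have "\<forall>x\<in>A. d x = 0" using A by (auto simp: int_independent_def)
      then have "c a * m a a = 0" using a by (auto simp: d_def)
      then show "c a = 0" using m0[OF a] by simp
    qed (use finA kc in auto)
    have r1: "enat (card (A - B)) \<le> rank_in G (kernel G H f)"
      using kker by (intro G.int_independent_family_rank[OF indk]) auto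
    have "n \<le> card (A - B) + card B"
      using A(2) BA finA finB by (simp add: card_Diff_subset card_mono)
    then have "enat n \<le> enat (card (A - B)) + enat (card B)" by simp
    also have "\<dots> \<le> rank_in G (kernel G H f) + rank_in H (f ` carrier G)"
      by (intro add_mono r1 r2)
    finally show "enat n \<le> rank_in G (kernel G H f) + rank_in H (f ` carrier G)" .
  next
    assume "enat n \<le> rank_in G (kernel G H f) + rank_in H (f ` carrier G)"
    then obtain i j where ij: "i + j = n" "enat i \<le> rank_in G (kernel G H f)"
      "enat j \<le> rank_in H (f ` carrier G)" by (auto simp: enat_le_add_iff)
    then obtain B D where B: "int_independent G B" "B \<subseteq> kernel G H f" "i \<le> card B"
      and D: "int_independent H D" "D \<subseteq> f ` carrier G" "j \<le> card D"
      by (auto simp: enat_le_rank_in_iff)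
    obtain D' where D': "D' \<subseteq> carrier G" "inj_on f D'" "f ` D' = D"
      using D(2) by (auto simp: subset_image_inj)
    have fin: "finite B" "finite D'" "B \<subseteq> carrier G"
      using B D D' by (auto simp: int_independent_def dest: finite_imageD)
    have fB: "f b = \<one>\<^bsub>H\<^esub>" if "b \<in> B" for b using B that by (auto simp: kernel_def)
    \<comment> \<open>An independent set never contains the neutral element: coefficient 1 there and
      0 elsewhere is a relation. Hence the lifts in \<open>D'\<close> avoid the kernel part
      \<open>B\<close>.\<close>
    have one: "\<one>\<^bsub>H\<^esub> \<notin> D"
    proof
      assume one: "\<one>\<^bsub>H\<^esub> \<in> D"
      have "finprod H (\<lambda>b. b [^]\<^bsub>H\<^esub> (of_bool (b = \<one>\<^bsub>H\<^esub>) :: int)) D = \<one>\<^bsub>H\<^esub>"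
        using D(1) by (intro H.finprod_one_eqI) (auto simp: int_independent_def)
      then have "\<forall>b\<in>D. (of_bool (b = \<one>\<^bsub>H\<^esub>) :: int) = 0"
        using int_independentD[OF D(1), of "\<lambda>b. of_bool (b = \<one>\<^bsub>H\<^esub>)"] by blast
      then show False using one by auto
    qed
    then have disj: "B \<inter> D' = {}" using fB D' by force
    have "int_independent G (B \<union> D')"
      unfolding int_independent_def
    proof (intro conjI allI impI)
      fix c :: "'a \<Rightarrow> int"
      assume "finprod G (\<lambda>b. b [^]\<^bsub>G\<^esub> c b) (B \<union> D') = \<one>\<^bsub>G\<^esub>"
      then have eq: "finprod G (\<lambda>b. b [^]\<^bsub>G\<^esub> c b) B \<otimes>\<^bsub>G\<^esub> finprod G (\<lambda>b. b [^]\<^bsub>G\<^esub> c b) D' = \<one>\<^bsub>G\<^esub>"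
        using fin disj D' by (subst (asm) G.finprod_Un_disjoint) auto
      have cB: "finprod G (\<lambda>b. b [^]\<^bsub>G\<^esub> c b) B \<in> carrier G"
        and cD: "finprod G (\<lambda>b. b [^]\<^bsub>G\<^esub> c b) D' \<in> carrier G"
        using fin D' by (auto intro!: G.finprod_closed)
      have fB1: "f (finprod G (\<lambda>b. b [^]\<^bsub>G\<^esub> c b) B) = \<one>\<^bsub>H\<^esub>"
        using fin by (subst hom_finprod_int_pow[OF G H f]) (auto intro!: H.finprod_one_eqI simp: fB)
      have "f (finprod G (\<lambda>b. b [^]\<^bsub>G\<^esub> c b) D') = \<one>\<^bsub>H\<^esub>"
        using arg_cong[OF eq, of f] cB cD fB1 by simp
      then have "finprod H (\<lambda>b. f b [^]\<^bsub>H\<^esub> c b) D' = \<one>\<^bsub>H\<^esub>"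
        using D' by (subst (asm) hom_finprod_int_pow[OF G H f]) auto
      also have "finprod H (\<lambda>b. f b [^]\<^bsub>H\<^esub> c b) D' = finprod H (\<lambda>b. b [^]\<^bsub>H\<^esub> c (inv_into D' f b)) D"
        unfolding D'(3)[symmetric] using D' by (subst H.finprod_reindex) (auto intro!: H.finprod_cong)
      finally have "\<forall>b\<in>D. c (inv_into D' f b) = 0"
        using int_independentD[OF D(1), of "\<lambda>b. c (inv_into D' f b)"] by blast
      then have D0: "c b = 0" if "b \<in> D'" for b
        using D' that by (metis imageI inv_into_f_f)
      then have "finprod G (\<lambda>b. b [^]\<^bsub>G\<^esub> c b) D' = \<one>\<^bsub>G\<^esub>"
        by (intro G.finprod_one_eqI) auto
      then have "finprod G (\<lambda>b. b [^]\<^bsub>G\<^esub> c b) B = \<one>\<^bsub>G\<^esub>" using eq cB by simp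
      then have "\<forall>b\<in>B. c b = 0" using int_independentD[OF B(1)] by blast
      with D0 show "\<forall>b\<in>B \<union> D'. c b = 0" by auto
    qed (use fin D' in auto)
    moreover have "n \<le> card (B \<union> D')"
      using ij B(3) D(3) D' fin disj by (subst card_Un_disjoint) (auto simp: card_image)
    ultimately show "enat n \<le> abelian_rank G"
      using fin D' by (auto simp: abelian_rank_eq_rank_in enat_le_rank_in_iff)
  qed
qed


text \<open>The neutral element alone satisfies a relation with coefficient 1, so among these
  subsets only the empty one is independent.\<close>

lemma rank_in_trivial:
  assumes "comm_group G" "S \<subseteq> {\<one>\<^bsub>G\<^esub>}"
  shows "rank_in G S = 0"
proof -
  interpret G: comm_group G by fact
  have "card B = 0" if B: "int_independent G B" "B \<subseteq> S" for B
  proof (cases "B = {}")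
    case False
    then have "B = {\<one>\<^bsub>G\<^esub>}" using that assms by auto
    then have "finprod G (\<lambda>b. b [^]\<^bsub>G\<^esub> (1 :: int)) B = \<one>\<^bsub>G\<^esub>"
      by simp
    with B(1) \<open>B = {\<one>\<^bsub>G\<^esub>}\<close> show ?thesis
      using int_independentD[OF B(1), of "\<lambda>b. 1"] by simp
  qed simp
  then have "rank_in G S \<le> 0"
    unfolding rank_in_def by (intro SUP_least) (auto simp: zero_enat_def)
  then show ?thesis by simp
qed

lemma abelian_rank_iso:
  assumes "comm_group G" "comm_group H" "f \<in> iso G H"
  shows "abelian_rank G = abelian_rank H"
proof -
  interpret G: comm_group G by fact
  interpret H: comm_group H by fact
  have f: "f \<in> hom G H" "f ` carrier G = carrier H" "inj_on f (carrier G)"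
    using assms by (auto simp: iso_def bij_betw_def)
  have "kernel G H f \<subseteq> {\<one>\<^bsub>G\<^esub>}"
  proof
    fix x assume "x \<in> kernel G H f"
    then have "x \<in> carrier G" "f x = f \<one>\<^bsub>G\<^esub>"
      using hom_one[OF f(1)] by (auto simp: kernel_def)
    then show "x \<in> {\<one>\<^bsub>G\<^esub>}" using f(3) by (auto dest: inj_onD)
  qed
  then show ?thesis
    using abelian_rank_kernel_image[OF assms(1,2) f(1)]
    by (simp add: rank_in_trivial[OF assms(1) \<open>kernel G H f \<subseteq> {\<one>\<^bsub>G\<^esub>}\<close>] abelian_rank_eq_rank_in[of H] f(2))
qed

lemma abelian_rank_integer_group: "abelian_rank integer_group = 1"
proof -
  interpret Z: comm_group integer_group by (rule abelian_integer_group)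
  have fp: "finprod integer_group f A = (\<Sum>a\<in>A. f a)" if "finite A" for f :: "'b \<Rightarrow> int" and A
    using that by (induction A rule: finite_induct) (auto simp: Z.finprod_insert)
  have "int_independent integer_group {1}"
    by (auto simp: int_independent_def)
  then have "enat 1 \<le> abelian_rank integer_group"
    by (auto simp: abelian_rank_eq_rank_in enat_le_rank_in_iff intro!: exI[of _ "{1}"])
  moreover have "card B \<le> 1" if B: "int_independent integer_group B" for B
  proof (rule ccontr)
    assume "\<not> card B \<le> 1"
    then obtain a b where ab: "a \<in> B" "b \<in> B" "a \<noteq> b"
      using B by (auto simp: int_independent_def card_le_Suc0_iff_eq)
    \<comment> \<open>The relation \<open>b * a - a * b = 0\<close>; as \<open>a\<close> and
      \<open>b\<close> are distinct, the two coefficients cannot both vanish.\<close>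
    define n where "n = (\<lambda>x. if x = a then b else if x = b then -a else 0)"
    have fin: "finite B" using B by (simp add: int_independent_def)
    have "finprod integer_group (\<lambda>b. b [^]\<^bsub>integer_group\<^esub> n b) B = (\<Sum>x\<in>B. n x * x)"
      using fin by (simp add: fp)
    also have "\<dots> = (\<Sum>x\<in>{a,b}. n x * x)"
      using ab fin by (intro sum.mono_neutral_right) (auto simp: n_def)
    also have "\<dots> = 0" using ab by (simp add: n_def)
    finally have "\<forall>x\<in>B. n x = 0" using int_independentD[OF B, of n] by simp
    then have "n a = 0" "n b = 0" using ab by auto
    then show False using ab by (simp add: n_def)
  qed
  then have "abelian_rank integer_group \<le> 1"
    unfolding abelian_rank_def by (intro SUP_least) (auto simp: one_enat_def)
  ultimately show ?thesis by (simp add: one_enat_def)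
qed

section \<open>Additivity of Euler characteristics along the long exact sequence of a pair\<close>

section \<open>Alternating sums of Betti numbers\<close>

text \<open>Finiteness of every term, vanishing from some degree on and the value of the sum are
  bundled in one relation, so that the induction over cells carries all three at once.\<close>

definition alternating_sum :: "(nat \<Rightarrow> enat) \<Rightarrow> int \<Rightarrow> bool" where
  "alternating_sum b e \<longleftrightarrow>
     (\<exists>f N. (\<forall>p. b p = enat (f p)) \<and> (\<forall>p\<ge>N. f p = 0) \<and> e = (\<Sum>p<N. (-1) ^ p * int (f p)))"

lemma alternating_sumD:
  assumes "alternating_sum b e"
  shows "\<exists>f N. (\<forall>p. b p = enat (f p)) \<and> (\<forall>p\<ge>N. f p = 0) \<and>
           (\<forall>M\<ge>N. e = (\<Sum>p<M. (-1) ^ p * int (f p)))"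
proof -
  from assms obtain f N where f: "\<forall>p. b p = enat (f p)" "\<forall>p\<ge>N. f p = 0"
    "e = (\<Sum>p<N. (-1) ^ p * int (f p))" by (auto simp: alternating_sum_def)
  have "e = (\<Sum>p<M. (-1) ^ p * int (f p))" if "M \<ge> N" for M
    unfolding f(3) using f(2) that by (intro sum.mono_neutral_left) (auto simp: not_less)
  with f show ?thesis by blast
qed

lemma alternating_sum_euler_characteristic:
  assumes "alternating_sum (\<lambda>p. betti_number p X) e"
  shows "has_finite_betti_numbers X" "euler_characteristic X = e"
proof -
  obtain f N where f: "\<And>p. betti_number p X = enat (f p)" "\<And>p. p \<ge> N \<Longrightarrow> f p = 0"
    "e = (\<Sum>p<N. (-1) ^ p * int (f p))" using assms by (auto simp: alternating_sum_def)
  have sub: "{p. betti_number p X \<noteq> 0} \<subseteq> {..<N}"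
  proof
    fix p assume "p \<in> {p. betti_number p X \<noteq> 0}"
    then have "f p \<noteq> 0" by (simp add: f(1) enat_0_iff)
    then show "p \<in> {..<N}" using f(2)[of p] by fastforce
  qed
  then show "has_finite_betti_numbers X"
    using f(1) finite_subset by (auto simp: has_finite_betti_numbers_def)
  show "euler_characteristic X = e"
    unfolding euler_characteristic_def f(3) using sub f(1)
    by (intro sum.mono_neutral_cong_left) (auto simp: enat_0_iff)
qed

text \<open>\<open>d p\<close> enters \<open>r\<close> in degree \<open>p\<close> and
  \<open>a\<close> in degree \<open>p - 1\<close>, hence with opposite signs; the partial sums
  differ only by the boundary term \<open>(-1) ^ M * int (d M)\<close>.\<close>

lemma telescoping_alternating_sum:
  fixes d :: "nat \<Rightarrow> nat"
  assumes "\<And>p. a p = d (Suc p) + i p" "\<And>p. x p = i p + j p" "\<And>p. r p = j p + d p"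
    "d 0 = 0" "d M = 0"
  shows "(\<Sum>p<M. (-1) ^ p * int (x p)) = (\<Sum>p<M. (-1) ^ p * int (a p)) + (\<Sum>p<M. (-1) ^ p * int (r p))"
proof -
  have "(\<Sum>p<M. (-1) ^ p * int (x p))
      = (\<Sum>p<M. (-1) ^ p * int (a p)) + (\<Sum>p<M. (-1) ^ p * int (r p)) + (-1) ^ M * int (d M)"
  proof (induction M)
    case (Suc M)
    then show ?case by (simp add: assms algebra_simps)
  qed (simp add: assms)
  then show ?thesis using assms by simp
qed

context
  fixes a x r d i j :: "nat \<Rightarrow> enat"
  assumes a: "\<And>p. a p = d (Suc p) + i p" and x: "\<And>p. x p = i p + j p"
    and r: "\<And>p. r p = j p + d p" and d0: "d 0 = 0"
begin

text \<open>The decomposition assumed in this context is the rank form of a long exact sequence: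
  \<open>a\<close>, \<open>x\<close>, \<open>r\<close> belong to the subspace, the space and the
  pair, and \<open>i\<close>, \<open>j\<close>, \<open>d\<close> to the images of the three maps.
  These images are bounded by \<open>a\<close> and \<open>r\<close>, hence finite.\<close>

lemma alternating_sum_middle:
  assumes "alternating_sum a \<alpha>" "alternating_sum r \<rho>"
  shows "alternating_sum x (\<alpha> + \<rho>)"
proof -
  obtain fa Na where fa: "\<And>p. a p = enat (fa p)" "\<And>p. p \<ge> Na \<Longrightarrow> fa p = 0"
    "\<And>M. M \<ge> Na \<Longrightarrow> \<alpha> = (\<Sum>p<M. (-1) ^ p * int (fa p))" using alternating_sumD[OF assms(1)] by blast
  obtain fr Nr where fr: "\<And>p. r p = enat (fr p)" "\<And>p. p \<ge> Nr \<Longrightarrow> fr p = 0"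
    "\<And>M. M \<ge> Nr \<Longrightarrow> \<rho> = (\<Sum>p<M. (-1) ^ p * int (fr p))" using alternating_sumD[OF assms(2)] by blast
  have "i p \<noteq> \<infinity> \<and> j p \<noteq> \<infinity> \<and> d p \<noteq> \<infinity>" for p
    using fa(1)[of p] fr(1)[of p] a[of p] r[of p] by (metis enat.distinct(1) plus_eq_infty_iff_enat)
  then obtain fi fj fd where f: "\<And>p. i p = enat (fi p)" "\<And>p. j p = enat (fj p)" "\<And>p. d p = enat (fd p)"
    using that[of "\<lambda>p. the_enat (i p)" "\<lambda>p. the_enat (j p)" "\<lambda>p. the_enat (d p)"]
    by (metis enat.exhaust the_enat.simps)
  have fa': "fa p = fd (Suc p) + fi p" for p using fa(1)[of p] a[of p] f by simp
  have fr': "fr p = fj p + fd p" for p using fr(1)[of p] r[of p] f by simp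
  have d0': "fd 0 = 0" using d0 f(3)[of 0] by (simp add: enat_0_iff)
  have N: "fd (max Na Nr) = 0" using fr(2)[of "max Na Nr"] fr'[of "max Na Nr"] by simp
  show ?thesis
    unfolding alternating_sum_def
  proof (intro exI[of _ "\<lambda>p. fi p + fj p"] exI[of _ "max Na Nr"] conjI allI impI)
    fix p assume "max Na Nr \<le> p"
    then show "fi p + fj p = 0" using fa(2)[of p] fr(2)[of p] fa'[of p] fr'[of p] by simp
  next
    show "\<alpha> + \<rho> = (\<Sum>p<max Na Nr. (-1) ^ p * int (fi p + fj p))"
      using telescoping_alternating_sum[of fa fd fi "\<lambda>p. fi p + fj p" fj fr "max Na Nr"]
        fa' fr' d0' N fa(3)[of "max Na Nr"] fr(3)[of "max Na Nr"] by simp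
  qed (simp add: x f)
qed

text \<open>\<open>i\<close> and \<open>j\<close> are bounded by \<open>x\<close>, and
  \<open>d\<close> by \<open>a\<close> one degree lower, where degree 0 is covered by
  \<open>d 0 = 0\<close>.\<close>

lemma alternating_sum_right:
  assumes "alternating_sum a \<alpha>" "alternating_sum x \<xi>"
  shows "alternating_sum r (\<xi> - \<alpha>)"
proof -
  obtain fa Na where fa: "\<And>p. a p = enat (fa p)" "\<And>p. p \<ge> Na \<Longrightarrow> fa p = 0"
    "\<And>M. M \<ge> Na \<Longrightarrow> \<alpha> = (\<Sum>p<M. (-1) ^ p * int (fa p))" using alternating_sumD[OF assms(1)] by blast
  obtain fx Nx where fx: "\<And>p. x p = enat (fx p)" "\<And>p. p \<ge> Nx \<Longrightarrow> fx p = 0"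
    "\<And>M. M \<ge> Nx \<Longrightarrow> \<xi> = (\<Sum>p<M. (-1) ^ p * int (fx p))" using alternating_sumD[OF assms(2)] by blast
  have ij: "i p \<noteq> \<infinity> \<and> j p \<noteq> \<infinity>" for p
    using fx(1)[of p] x[of p] by (metis enat.distinct(1) plus_eq_infty_iff_enat)
  have "d p \<noteq> \<infinity>" for p
  proof (cases p)
    case (Suc q)
    then show ?thesis using fa(1)[of q] a[of q] by (metis enat.distinct(1) plus_eq_infty_iff_enat)
  qed (simp add: d0)
  with ij have ijd: "\<And>p. i p \<noteq> \<infinity>" "\<And>p. j p \<noteq> \<infinity>" "\<And>p. d p \<noteq> \<infinity>" by auto
  then obtain fi fj fd where f: "\<And>p. i p = enat (fi p)" "\<And>p. j p = enat (fj p)" "\<And>p. d p = enat (fd p)"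
    using that[of "\<lambda>p. the_enat (i p)" "\<lambda>p. the_enat (j p)" "\<lambda>p. the_enat (d p)"]
    by (metis enat.exhaust the_enat.simps)
  have fa': "fa p = fd (Suc p) + fi p" for p using fa(1)[of p] a[of p] f by simp
  have fx': "fx p = fi p + fj p" for p using fx(1)[of p] x[of p] f by simp
  have d0': "fd 0 = 0" using d0 f(3)[of 0] by (simp add: enat_0_iff)
  \<comment> \<open>\<open>d (Suc q)\<close> is bounded by \<open>a q\<close>, so \<open>d\<close>
    is known to vanish only one degree later than \<open>a\<close>.\<close>
  define N where "N = Suc (max Na Nx)"
  have dN: "fd p = 0" if "p \<ge> N" for p
  proof (cases p)
    case (Suc q)
    then show ?thesis using fa(2)[of q] fa'[of q] that by (simp add: N_def)
  qed (use that in \<open>simp add: N_def\<close>)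
  show ?thesis
    unfolding alternating_sum_def
  proof (intro exI[of _ "\<lambda>p. fj p + fd p"] exI[of _ N] conjI allI impI)
    fix p assume "N \<le> p"
    then show "fj p + fd p = 0" using fx(2)[of p] fx'[of p] dN[of p] by (simp add: N_def)
  next
    have "N \<ge> Na" "N \<ge> Nx" by (auto simp: N_def)
    then show "\<xi> - \<alpha> = (\<Sum>p<N. (-1) ^ p * int (fj p + fd p))"
      using telescoping_alternating_sum[of fa fd fi fx fj "\<lambda>p. fj p + fd p" N]
        fa' fx' d0' dN fa(3)[of N] fx(3)[of N] by simp
  qed (simp add: r f)
qed

end

text \<open>The three sequences are the ranks of the images of the maps in the long exact sequence
  of the pair. Exactness turns each kernel into the preceding image, and rank-nullity splits each
  group. \<open>d 0\<close> vanishes because homology in degree -1 is trivial.\<close>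

lemma homology_rank_decomposition:
  obtains d i j :: "nat \<Rightarrow> enat" where
    "\<And>p. betti_number p (subtopology X S) = d (Suc p) + i p"
    "\<And>p. betti_number p X = i p + j p"
    "\<And>p. abelian_rank (relative_homology_group (int p) X S) = j p + d p"
    "d 0 = 0"
proof -
  define d where "d p = rank_in (homology_group (int p - 1) (subtopology X S))
    (hom_boundary (int p) X S ` carrier (relative_homology_group (int p) X S))" for p
  define i where "i p = rank_in (homology_group (int p) X)
    (hom_induced (int p) (subtopology X S) {} X {} id ` carrier (homology_group (int p) (subtopology X S)))" for p
  define j where "j p = rank_in (relative_homology_group (int p) X S)
    (hom_induced (int p) X {} X S id ` carrier (homology_group (int p) X))" for p
  show ?thesis
  proof (rule that[of d i j])
    fix p
    have h: "hom_induced (int p) (subtopology X S) {} X {} id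
        \<in> hom (homology_group (int p) (subtopology X S)) (homology_group (int p) X)"
      by (rule hom_induced_hom)
    have k: "kernel (homology_group (int p) (subtopology X S)) (homology_group (int p) X)
        (hom_induced (int p) (subtopology X S) {} X {} id)
      = hom_boundary (int (Suc p)) X S ` carrier (relative_homology_group (int (Suc p)) X S)"
      using homology_exactness_axiom_2[of "int (Suc p)" X S] by (simp add: group_hom_def)
    show "betti_number p (subtopology X S) = d (Suc p) + i p"
      unfolding betti_number_def
      by (subst abelian_rank_kernel_image[OF _ _ h]) (simp_all add: k d_def i_def)
  next
    fix p
    have h: "hom_induced (int p) X {} X S id
        \<in> hom (homology_group (int p) X) (relative_homology_group (int p) X S)"
      by (rule hom_induced_hom)
    have k: "kernel (homology_group (int p) X) (relative_homology_group (int p) X S)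
        (hom_induced (int p) X {} X S id)
      = hom_induced (int p) (subtopology X S) {} X {} id ` carrier (homology_group (int p) (subtopology X S))"
      using homology_exactness_axiom_3[of "int p" X S] by simp
    show "betti_number p X = i p + j p"
      unfolding betti_number_def
      by (subst abelian_rank_kernel_image[OF _ _ h]) (simp_all add: k i_def j_def)
  next
    fix p
    have h: "hom_boundary (int p) X S
        \<in> hom (relative_homology_group (int p) X S) (homology_group (int p - 1) (subtopology X S))"
      by (rule hom_boundary_hom)
    have k: "kernel (relative_homology_group (int p) X S) (homology_group (int p - 1) (subtopology X S))
        (hom_boundary (int p) X S)
      = hom_induced (int p) X {} X S id ` carrier (homology_group (int p) X)"
      using homology_exactness_axiom_1[of "int p" X S] by simp
    show "abelian_rank (relative_homology_group (int p) X S) = j p + d p"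
      by (subst abelian_rank_kernel_image[OF _ _ h]) (simp_all add: k d_def j_def)
  next
    have "trivial_group (homology_group (-1) (subtopology X S))" by simp
    then show "d 0 = 0"
      unfolding d_def using hom_boundary_carrier[of 0 X S]
      by (intro rank_in_trivial) (auto simp: trivial_group_def)
  qed
qed

section \<open>Radial deformation of a punctured simplex, and the effect of attaching a cell\<close>

section \<open>Attaching a simplex\<close>

text \<open>Points are functions on the whole color type that vanish off \<open>T\<close>, so the
  simplices of all color sets live in one product space and their faces are subsets.\<close>

definition simplex_points :: "'c set \<Rightarrow> ('c \<Rightarrow> real) set" where
  "simplex_points T = {l. (\<forall>c. 0 \<le> l c) \<and> (\<forall>c. c \<notin> T \<longrightarrow> l c = 0) \<and> sum l T = 1}"

definition simplex_top :: "'c set \<Rightarrow> ('c \<Rightarrow> real) topology" where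
  "simplex_top T = subtopology (powertop_real UNIV) (simplex_points T)"

definition barycenter :: "'c set \<Rightarrow> 'c \<Rightarrow> real" where
  "barycenter T c = (if c \<in> T then 1 / real (card T) else 0)"

text \<open>For \<open>t = 1\<close> this is the radial projection from the barycenter to the boundary.\<close>

definition push_to_boundary :: "'c set \<Rightarrow> real \<Rightarrow> ('c \<Rightarrow> real) \<Rightarrow> 'c \<Rightarrow> real" where
  "push_to_boundary T t l c =
     (if c \<in> T then (1 - t) * l c + t * ((l c - Min (l ` T)) / (1 - real (card T) * Min (l ` T))) else 0)"

lemma topspace_simplex_top [simp]: "topspace (simplex_top T) = simplex_points T"
  by (simp add: simplex_top_def)

lemma continuous_map_Min:
  assumes "finite T" "T \<noteq> {}" "\<And>c. c \<in> T \<Longrightarrow> continuous_map Z euclideanreal (\<lambda>z. f z c)"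
  shows "continuous_map Z euclideanreal (\<lambda>z. Min (f z ` T))"
  using assms
proof (induction T rule: finite_ne_induct)
  case (insert x F)
  then have "continuous_map Z euclideanreal (\<lambda>z. min (f z x) (Min (f z ` F)))"
    by (intro continuous_map_real_min) auto
  then show ?case using insert by simp
qed simp

lemma betti_number_homotopy_equivalent:
  assumes "X homotopy_equivalent_space Y"
  shows "betti_number p X = betti_number p Y"
proof -
  obtain f where "f \<in> iso (homology_group (int p) X) (homology_group (int p) Y)"
    using homotopy_equivalent_space_imp_isomorphic_homology_groups[OF assms] by (auto simp: is_iso_def)
  then show ?thesis unfolding betti_number_def by (intro abelian_rank_iso) auto
qed

context
  fixes T :: "'c set"
  assumes fin: "finite T" and ne: "T \<noteq> {}"
begin

lemma barycenter_simplex: "barycenter T \<in> simplex_points T"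
  using fin ne by (auto simp: simplex_points_def barycenter_def)

lemma Min_simplex:
  assumes "l \<in> simplex_points T"
  shows "0 \<le> Min (l ` T)" "c \<in> T \<Longrightarrow> Min (l ` T) \<le> l c" "\<exists>c\<in>T. l c = Min (l ` T)"
proof -
  show "c \<in> T \<Longrightarrow> Min (l ` T) \<le> l c" using fin by simp
  have "Min (l ` T) \<in> l ` T" using fin ne by (intro Min_in) auto
  then show "\<exists>c\<in>T. l c = Min (l ` T)" by auto
  moreover have "\<And>c. 0 \<le> l c" using assms by (simp add: simplex_points_def)
  ultimately show "0 \<le> Min (l ` T)" by metis
qed

text \<open>The differences between the coordinates and their minimum are nonnegative, and their sum
  vanishes only if all coordinates are equal. This keeps the denominator in
  \<open>push_to_boundary\<close> positive.\<close>

lemma card_Min_less_one: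
  assumes l: "l \<in> simplex_points T" and b: "l \<noteq> barycenter T"
  shows "real (card T) * Min (l ` T) < 1"
proof -
  define m where "m = Min (l ` T)"
  have s: "(\<Sum>c\<in>T. l c - m) = 1 - real (card T) * m"
    using l by (simp add: sum_subtractf simplex_points_def)
  have nn: "\<And>c. c \<in> T \<Longrightarrow> 0 \<le> l c - m" using Min_simplex(2)[OF l] by (simp add: m_def)
  have "0 \<le> (\<Sum>c\<in>T. l c - m)" using nn by (rule sum_nonneg)
  moreover have "(\<Sum>c\<in>T. l c - m) \<noteq> 0"
  proof
    assume "(\<Sum>c\<in>T. l c - m) = 0"
    then have "\<forall>c\<in>T. l c = m" and "m = 1 / real (card T)"
      using sum_nonneg_eq_0_iff[OF fin, of "\<lambda>c. l c - m"] nn s fin ne by (auto simp: field_simps)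
    then have "l = barycenter T" using l by (auto simp: barycenter_def simplex_points_def)
    then show False using b by contradiction
  qed
  ultimately show ?thesis using s by (simp add: m_def)
qed

lemma push_to_boundary_simplex:
  assumes l: "l \<in> simplex_points T" and b: "l \<noteq> barycenter T" and t: "0 \<le> t" "t \<le> 1"
  shows "push_to_boundary T t l \<in> simplex_points T - {barycenter T}"
proof -
  define m where "m = Min (l ` T)"
  define k where "k = real (card T)"
  have km: "1 - k * m > 0" using card_Min_less_one[OF l b] by (simp add: k_def m_def)
  have ml: "\<And>c. c \<in> T \<Longrightarrow> m \<le> l c" using Min_simplex(2)[OF l] by (simp add: m_def)
  have kpos: "k > 0" using fin ne by (simp add: k_def card_gt_0_iff)
  have P: "push_to_boundary T t l c = (if c \<in> T then (1 - t) * l c + t * ((l c - m) / (1 - k * m)) else 0)" for c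
    by (simp add: push_to_boundary_def m_def k_def)
  have l0: "\<And>c. 0 \<le> l c" "sum l T = 1" using l by (auto simp: simplex_points_def)
  have "sum (push_to_boundary T t l) T = (\<Sum>c\<in>T. (1 - t) * l c + t * ((l c - m) / (1 - k * m)))"
    by (intro sum.cong) (auto simp: P)
  also have "\<dots> = (1 - t) * sum l T + t * ((sum l T - k * m) / (1 - k * m))"
    by (simp add: sum.distrib sum_distrib_left[symmetric] sum_divide_distrib[symmetric] sum_subtractf k_def)
  also have "\<dots> = 1" using km l0 by simp
  finally have "sum (push_to_boundary T t l) T = 1" .
  moreover have "0 \<le> push_to_boundary T t l c" for c
    unfolding P using l0 ml[of c] km t by (auto intro!: add_nonneg_nonneg mult_nonneg_nonneg divide_nonneg_pos)
  moreover have "push_to_boundary T t l \<noteq> barycenter T"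
  proof
    assume eq: "push_to_boundary T t l = barycenter T"
    \<comment> \<open>For fixed \<open>l\<close> and \<open>t\<close> the push is the map
      \<open>A * l c - B\<close> of each coordinate, with \<open>A > 0\<close>. Equal values come
      from equal coordinates, so only the barycenter could land on the barycenter.\<close>
    define A where "A = (1 - t) + t / (1 - k * m)"
    define B where "B = t * m / (1 - k * m)"
    have "A > 0"
      using t km unfolding A_def by (cases "t = 1") (auto intro!: add_pos_nonneg)
    have AB: "A * l c = 1 / k + B" if "c \<in> T" for c
    proof -
      have "A * l c - B = push_to_boundary T t l c"
        using that by (simp add: P A_def B_def algebra_simps diff_divide_distrib)
      then show ?thesis using that eq by (simp add: barycenter_def k_def)
    qed
    obtain c0 where c0: "c0 \<in> T" "l c0 = m" using Min_simplex(3)[OF l] by (auto simp: m_def)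
    have "l c = m" if "c \<in> T" for c
      using AB[OF that] AB[OF c0(1)] c0 \<open>A > 0\<close> by (metis mult_cancel_left order_less_irrefl)
    then have "sum l T = k * m" by (simp add: k_def)
    then show False using l0 km by simp
  qed
  ultimately show ?thesis by (auto simp: simplex_points_def P)
qed

lemma push_to_boundary_1:
  assumes l: "l \<in> simplex_points T"
  shows "\<exists>c\<in>T. push_to_boundary T 1 l c = 0"
  using Min_simplex(3)[OF l] by (auto simp: push_to_boundary_def)

text \<open>With a vanishing coordinate the minimum is 0 and the radial projection is the identity;
  hence the deformation is stationary on the boundary at all times.\<close>

lemma push_to_boundary_fixed:
  assumes l: "l \<in> simplex_points T" and "c \<in> T" "l c = 0"
  shows "push_to_boundary T t l = l"
proof -
  have "Min (l ` T) = 0" using Min_simplex(1,2)[OF l] assms by force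
  then show ?thesis using l by (auto simp: push_to_boundary_def simplex_points_def algebra_simps)
qed

lemma push_to_boundary_0:
  assumes l: "l \<in> simplex_points T"
  shows "push_to_boundary T 0 l = l"
  using l by (auto simp: push_to_boundary_def simplex_points_def)

text \<open>Time and point both depend on a parameter in \<open>Z\<close>, which is the form that a
  homotopy on a product with an interval requires.\<close>

lemma continuous_map_push_to_boundary:
  assumes t: "continuous_map Z (top_of_set {0..1}) t" and f: "continuous_map Z (simplex_top T) f"
    and b: "\<And>z. z \<in> topspace Z \<Longrightarrow> f z \<noteq> barycenter T"
  shows "continuous_map Z (simplex_top T) (\<lambda>z. push_to_boundary T (t z) (f z))"
proof -
  have fs: "f z \<in> simplex_points T" if "z \<in> topspace Z" for z
    using continuous_map_funspace[OF f] that by auto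
  have ts: "t z \<in> {0..1}" if "z \<in> topspace Z" for z
    using continuous_map_funspace[OF t] that by auto
  have t': "continuous_map Z euclideanreal t"
    using t by (rule continuous_map_into_fulltopology)
  have fc: "continuous_map Z euclideanreal (\<lambda>z. f z c)" for c
    using f unfolding simplex_top_def continuous_map_in_subtopology continuous_map_componentwise_UNIV by auto
  have mc: "continuous_map Z euclideanreal (\<lambda>z. Min (f z ` T))"
    by (intro continuous_map_Min fin ne fc)
  have nz: "1 - real (card T) * Min (f z ` T) \<noteq> 0" if "z \<in> topspace Z" for z
    using card_Min_less_one[OF fs[OF that] b[OF that]] by simp
  have "continuous_map Z euclideanreal (\<lambda>z. push_to_boundary T (t z) (f z) c)" for c
  proof (cases "c \<in> T")
    case True
    then show ?thesis unfolding push_to_boundary_def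
      by simp (intro continuous_map_add continuous_map_real_mult continuous_map_diff
          continuous_map_real_divide t' fc mc nz continuous_map_canonical_const)
  qed (simp add: push_to_boundary_def)
  moreover have "push_to_boundary T (t z) (f z) \<in> simplex_points T" if "z \<in> topspace Z" for z
    using push_to_boundary_simplex[OF fs[OF that] b[OF that]] ts[OF that] by auto
  ultimately show ?thesis
    unfolding simplex_top_def continuous_map_in_subtopology continuous_map_componentwise_UNIV by auto
qed

lemma contractible_simplex_top: "contractible_space (simplex_top T)"
proof -
  let ?b = "barycenter T"
  let ?h = "\<lambda>z c. (1 - fst z) * snd z c + fst z * ?b c"
  have "continuous_map (prod_topology (top_of_set {0..1}) (simplex_top T)) (simplex_top T) ?h"
    (is "continuous_map ?Z _ _")
  proof -
    have 1: "continuous_map ?Z euclideanreal fst"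
      using continuous_map_fst continuous_map_into_fulltopology by blast
    have 2: "continuous_map ?Z euclideanreal (\<lambda>z. snd z c)" for c
    proof -
      have "continuous_map ?Z (simplex_top T) snd" by (rule continuous_map_snd)
      then show ?thesis
        unfolding simplex_top_def continuous_map_in_subtopology continuous_map_componentwise_UNIV by auto
    qed
    have "continuous_map ?Z euclideanreal (\<lambda>z. ?h z c)" for c
      by (intro continuous_map_add continuous_map_real_mult continuous_map_diff 1 2
          continuous_map_canonical_const)
    moreover have "?h z \<in> simplex_points T" if "z \<in> topspace ?Z" for z
    proof -
      obtain t l where z: "z = (t, l)" by (cases z)
      have t: "0 \<le> t" "t \<le> 1" and l: "l \<in> simplex_points T" using that z by auto
      have "(\<Sum>c\<in>T. (1 - t) * l c + t * ?b c) = (1 - t) * sum l T + t * sum ?b T"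
        by (simp add: sum.distrib sum_distrib_left)
      also have "\<dots> = 1" using l barycenter_simplex by (simp add: simplex_points_def)
      finally show ?thesis using t l barycenter_simplex z
        by (auto simp: simplex_points_def)
    qed
    ultimately show ?thesis
      unfolding simplex_top_def continuous_map_in_subtopology continuous_map_componentwise_UNIV by auto
  qed
  then have "homotopic_with (\<lambda>x. True) (simplex_top T) (simplex_top T) id (\<lambda>x. ?b)"
    by (subst homotopic_with) (auto intro!: exI[of _ ?h])
  then show ?thesis unfolding contractible_space_def by blast
qed

lemma betti_simplex_top: "alternating_sum (\<lambda>p. betti_number p (simplex_top T)) 1"
proof -
  have "simplex_top T \<noteq> trivial_topology"
    using barycenter_simplex by (metis empty_iff null_topspace_iff_trivial topspace_simplex_top)
  then obtain a where a: "a \<in> topspace (simplex_top T)"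
    "simplex_top T homotopy_equivalent_space subtopology (simplex_top T) {a}" (is "_ homotopy_equivalent_space ?Y")
    using contractible_simplex_top unfolding contractible_eq_homotopy_equivalent_singleton_subtopology by blast
  have Y: "topspace ?Y = {a}" using a by auto
  have eq: "betti_number p (simplex_top T) = betti_number p ?Y" for p
    by (rule betti_number_homotopy_equivalent[OF a(2)])
  have 0: "betti_number 0 ?Y = 1"
  proof -
    obtain f where "f \<in> iso (homology_group 0 ?Y) integer_group"
      using homology_coefficients[OF Y] by (auto simp: is_iso_def)
    then show ?thesis unfolding betti_number_def abelian_rank_integer_group[symmetric]
      by (intro abelian_rank_iso) (auto simp: abelian_integer_group)
  qed
  have p: "betti_number p ?Y = 0" if "p \<noteq> 0" for p
    using homology_dimension_axiom[OF Y, of "int p"] that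
    unfolding betti_number_def abelian_rank_eq_rank_in
    by (intro rank_in_trivial) (auto simp: trivial_group_def)
  show ?thesis
    unfolding alternating_sum_def
  proof (intro exI[of _ "\<lambda>p. of_bool (p = 0)"] exI[of _ 1] conjI allI impI)
    fix p show "betti_number p (simplex_top T) = enat (of_bool (p = 0))"
      using 0 p[of p] eq[of p] by (cases "p = 0") (auto simp: one_enat_def enat_0)
  qed auto
qed

end

text \<open>The homotopy stands still on \<open>A\<close> and pushes radially on \<open>B\<close>.
  Points of the overlap have a zero coordinate and are fixed, so the two closed pieces paste. The
  statement applies to the whole space and also to the cell alone, with \<open>A \<inter> B\<close>
  in the role of \<open>A\<close>.\<close>

lemma punctured_cell_deformation:
  assumes A: "closedin X A" and B: "closedin X B" and AB: "topspace X = A \<union> B"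
    and T: "finite T" "T \<noteq> {}"
    and hom: "homeomorphic_maps (subtopology X B) (simplex_top T) \<pi> \<phi>"
    and bd: "A \<inter> B = {x \<in> B. \<exists>c\<in>T. \<pi> x c = 0}"
  shows "subtopology X (topspace X - {\<phi> (barycenter T)}) homotopy_equivalent_space subtopology X A"
proof -
  let ?b = "barycenter T"
  define X0 where "X0 = subtopology X (topspace X - {\<phi> ?b})"
  define Z where "Z = prod_topology (top_of_set {0..1::real}) X0"
  define h where "h = (\<lambda>z. if snd z \<in> B then \<phi> (push_to_boundary T (fst z) (\<pi> (snd z))) else snd z)"
  have BX: "B \<subseteq> topspace X" and AX: "A \<subseteq> topspace X" using A B by (auto dest: closedin_subset)
  have c\<pi>: "continuous_map (subtopology X B) (simplex_top T) \<pi>"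
    and c\<phi>: "continuous_map (simplex_top T) (subtopology X B) \<phi>"
    and \<phi>\<pi>: "\<And>x. x \<in> B \<Longrightarrow> \<phi> (\<pi> x) = x"
    and \<pi>\<phi>: "\<And>l. l \<in> simplex_points T \<Longrightarrow> \<pi> (\<phi> l) = l"
    using hom BX by (auto simp: homeomorphic_maps_def)
  have \<pi>B: "\<pi> x \<in> simplex_points T" if "x \<in> B" for x
    using continuous_map_funspace[OF c\<pi>] that BX by auto
  have \<phi>B: "\<phi> l \<in> B" if "l \<in> simplex_points T" for l
    using continuous_map_funspace[OF c\<phi>] that by auto
  have \<pi>b: "\<pi> x \<noteq> ?b" if "x \<in> B" "x \<noteq> \<phi> ?b" for x using that \<phi>\<pi> by metis
  have bA: "\<phi> ?b \<notin> A"
  proof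
    assume "\<phi> ?b \<in> A"
    then have "\<phi> ?b \<in> A \<inter> B" using \<phi>B[OF barycenter_simplex[OF T]] by simp
    then obtain c where "c \<in> T" "\<pi> (\<phi> ?b) c = 0" unfolding bd by auto
    then show False using T by (simp add: \<pi>\<phi>[OF barycenter_simplex[OF T]] barycenter_def)
  qed
  have tZ: "topspace Z = {0..1} \<times> (topspace X - {\<phi> ?b})" by (auto simp: Z_def X0_def)
  \<comment> \<open>The push avoids the barycenter at all times, so the homotopy stays inside the
    punctured space.\<close>
  have push: "push_to_boundary T t (\<pi> x) \<in> simplex_points T - {?b}"
    if "x \<in> B" "x \<noteq> \<phi> ?b" "0 \<le> t" "t \<le> 1" for x t
    by (rule push_to_boundary_simplex[OF T \<pi>B[OF that(1)] \<pi>b[OF that(1,2)] that(3,4)])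
  have push\<phi>: "\<phi> (push_to_boundary T t (\<pi> x)) \<noteq> \<phi> ?b"
    if "x \<in> B" "x \<noteq> \<phi> ?b" "0 \<le> t" "t \<le> 1" for x t
    using push[OF that] \<pi>\<phi> barycenter_simplex[OF T] by (metis Diff_iff singletonI)
  have sndX: "continuous_map Z X snd"
    unfolding Z_def X0_def using continuous_map_snd continuous_map_into_fulltopology by blast
  \<comment> \<open>The two closed pieces are indexed by a boolean: true for the cell
    \<open>B\<close>, false for \<open>A\<close>.\<close>
  have ch: "continuous_map Z X h"
  proof (rule pasting_lemma_closed[where I = "UNIV :: bool set"
        and T = "\<lambda>i. {z \<in> topspace Z. snd z \<in> (if i then B else A)}"
        and f = "\<lambda>i z. if i then \<phi> (push_to_boundary T (fst z) (\<pi> (snd z))) else snd z"])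
    fix i :: bool
    show "closedin Z {z \<in> topspace Z. snd z \<in> (if i then B else A)}"
      by (rule closedin_continuous_map_preimage[OF sndX]) (use A B in simp)
  next
    fix i :: bool
    let ?S = "{z \<in> topspace Z. snd z \<in> (if i then B else A)}"
    show "continuous_map (subtopology Z ?S) X
        (\<lambda>z. if i then \<phi> (push_to_boundary T (fst z) (\<pi> (snd z))) else snd z)"
    proof (cases i)
      case True
      have s: "continuous_map (subtopology Z ?S) (subtopology X B) snd"
        using sndX True by (auto simp: continuous_map_in_subtopology continuous_map_from_subtopology)
      have "continuous_map (subtopology Z ?S) (simplex_top T) (\<lambda>z. push_to_boundary T (fst z) (\<pi> (snd z)))"
      proof (rule continuous_map_push_to_boundary[OF T])
        show "continuous_map (subtopology Z ?S) (top_of_set {0..1}) fst"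
          unfolding Z_def by (intro continuous_map_from_subtopology continuous_map_fst)
        show "continuous_map (subtopology Z ?S) (simplex_top T) (\<lambda>z. \<pi> (snd z))"
          using continuous_map_compose[OF s c\<pi>] by (simp add: comp_def)
        show "\<pi> (snd z) \<noteq> ?b" if "z \<in> topspace (subtopology Z ?S)" for z
        proof (rule \<pi>b)
          have "z \<in> topspace Z" "snd z \<in> B" using that True by auto
          then show "snd z \<in> B" "snd z \<noteq> \<phi> ?b" unfolding tZ by auto
        qed
      qed
      from continuous_map_compose[OF this c\<phi>]
      have "continuous_map (subtopology Z ?S) (subtopology X B) (\<lambda>z. \<phi> (push_to_boundary T (fst z) (\<pi> (snd z))))"
        by (simp add: comp_def)
      then show ?thesis using True continuous_map_into_fulltopology by auto
    next
      case False
      then show ?thesis using sndX by (simp add: continuous_map_from_subtopology)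
    qed
  next
    fix i j z
    assume z: "z \<in> topspace Z \<inter> {z \<in> topspace Z. snd z \<in> (if i then B else A)} \<inter> {z \<in> topspace Z. snd z \<in> (if j then B else A)}"
    have "\<phi> (push_to_boundary T (fst z) (\<pi> (snd z))) = snd z" if "snd z \<in> A" "snd z \<in> B"
    proof -
      have "snd z \<in> {x \<in> B. \<exists>c\<in>T. \<pi> x c = 0}" unfolding bd[symmetric] using that by simp
      then obtain c where c: "c \<in> T" "\<pi> (snd z) c = 0" by blast
      show ?thesis unfolding push_to_boundary_fixed[OF T \<pi>B[OF that(2)] c] by (rule \<phi>\<pi>[OF that(2)])
    qed
    then show "(if i then \<phi> (push_to_boundary T (fst z) (\<pi> (snd z))) else snd z) =
        (if j then \<phi> (push_to_boundary T (fst z) (\<pi> (snd z))) else snd z)"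
      using z by (cases i; cases j) auto
  next
    fix z assume "z \<in> topspace Z"
    then show "\<exists>j. j \<in> UNIV \<and> z \<in> {z \<in> topspace Z. snd z \<in> (if j then B else A)} \<and>
        h z = (if j then \<phi> (push_to_boundary T (fst z) (\<pi> (snd z))) else snd z)"
      using AB tZ by (intro exI[of _ "snd z \<in> B"]) (auto simp: h_def)
  qed simp
  have hX0: "h z \<in> topspace X0" if "z \<in> topspace Z" for z
    using that push push\<phi> \<phi>B BX unfolding tZ h_def X0_def
    by (auto simp: subset_iff)
  have ch0: "continuous_map Z X0 h"
    using ch hX0 unfolding X0_def by (auto simp: continuous_map_in_subtopology)
  define r where "r = (\<lambda>x. h (1, x))"
  have "homotopic_with (\<lambda>x. True) X0 X0 id r"
  proof (subst homotopic_with, simp, intro exI[of _ h] conjI ballI)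
    show "continuous_map (prod_topology (top_of_set {0..1}) X0) X0 h" using ch0 by (simp add: Z_def)
    show "h (0, x) = id x" for x
      using push_to_boundary_0[OF T \<pi>B] \<phi>\<pi> by (auto simp: h_def)
  qed (auto simp: r_def)
  then have hom_r: "homotopic_with (\<lambda>x. True) X0 X0 (id \<circ> r) id"
    using homotopic_with_symD by fastforce
  have rA: "r x \<in> A" if "x \<in> topspace X0" for x
  proof (cases "x \<in> B")
    case True
    then have p: "push_to_boundary T 1 (\<pi> x) \<in> simplex_points T"
      using push[of x 1] that by (auto simp: X0_def)
    have "\<phi> (push_to_boundary T 1 (\<pi> x)) \<in> A \<inter> B"
      unfolding bd using push_to_boundary_1[OF T \<pi>B[OF True]] \<phi>B[OF p] \<pi>\<phi>[OF p] by auto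
    then show ?thesis using True by (simp add: r_def h_def)
  next
    case False
    then show ?thesis using that AB by (auto simp: r_def h_def X0_def)
  qed
  have "continuous_map X0 Z (\<lambda>x. (1, x))"
    unfolding Z_def by (intro continuous_map_pairedI) (auto intro!: continuous_map_id[unfolded id_def])
  then have "continuous_map X0 X0 r"
    using continuous_map_compose[OF _ ch0] unfolding r_def comp_def by blast
  then have cr: "continuous_map X0 (subtopology X A) r"
    using rA unfolding X0_def by (auto simp: continuous_map_in_subtopology)
  have "retraction_maps X0 (subtopology X A) r id"
    unfolding retraction_maps_def
  proof (intro conjI ballI cr)
    show "continuous_map (subtopology X A) X0 id"
      unfolding X0_def using AX bA by (auto simp: continuous_map_in_subtopology)
    fix x assume x: "x \<in> topspace (subtopology X A)"
    show "r (id x) = x"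
    proof (cases "x \<in> B")
      case True
      then obtain c where c: "c \<in> T" "\<pi> x c = 0" using x bd by auto
      show ?thesis
        using True by (simp add: r_def h_def push_to_boundary_fixed[OF T \<pi>B[OF True] c] \<phi>\<pi>)
    qed (auto simp: r_def h_def)
  qed
  then show ?thesis
    unfolding X0_def[symmetric] using hom_r by (intro deformation_retraction_imp_homotopy_equivalent_space)
qed

text \<open>The increment \<open>1 - \<delta>\<close> is the Euler characteristic of the pair formed
  by the cell and the punctured cell: the cell is contractible and the punctured cell retracts to
  its boundary.\<close>

theorem alternating_sum_attach_cell:
  assumes A: "closedin X A" and B: "closedin X B" and AB: "topspace X = A \<union> B"
    and T: "finite T" "T \<noteq> {}"
    and hom: "homeomorphic_maps (subtopology X B) (simplex_top T) \<pi> \<phi>"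
    and bd: "A \<inter> B = {x \<in> B. \<exists>c\<in>T. \<pi> x c = 0}"
    and \<alpha>: "alternating_sum (\<lambda>p. betti_number p (subtopology X A)) \<alpha>"
    and \<delta>: "alternating_sum (\<lambda>p. betti_number p (subtopology X (A \<inter> B))) \<delta>"
  shows "alternating_sum (\<lambda>p. betti_number p X) (\<alpha> + (1 - \<delta>))"
proof -
  define b where "b = \<phi> (barycenter T)"
  define Y where "Y = subtopology X B"
  have BX: "B \<subseteq> topspace X" and AX: "A \<subseteq> topspace X" using A B by (auto dest: closedin_subset)
  have tY: "topspace Y = B" using BX by (auto simp: Y_def)
  have homX: "subtopology X (topspace X - {b}) homotopy_equivalent_space subtopology X A"
    unfolding b_def by (rule punctured_cell_deformation[OF A B AB T hom bd])
  have homY: "subtopology Y (topspace Y - {b}) homotopy_equivalent_space subtopology Y (A \<inter> B)"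
    unfolding b_def
  proof (rule punctured_cell_deformation[OF _ _ _ T, of _ _ B \<pi>])
    show "closedin Y (A \<inter> B)" "closedin Y B"
      using A B BX by (auto simp: Y_def closedin_subtopology)
    show "homeomorphic_maps (subtopology Y B) (simplex_top T) \<pi> \<phi>"
      using hom by (simp add: Y_def subtopology_subtopology)
  qed (use bd tY in auto)
  have "Y homotopy_equivalent_space simplex_top T"
    using hom unfolding Y_def
    by (intro homeomorphic_imp_homotopy_equivalent_space) (auto simp: homeomorphic_space_def)
  then have Ysum: "alternating_sum (\<lambda>p. betti_number p Y) 1"
    using betti_simplex_top[OF T] by (simp add: betti_number_homotopy_equivalent)
  have sYA: "subtopology Y (A \<inter> B) = subtopology X (A \<inter> B)"
    by (simp add: Y_def subtopology_subtopology Int_left_commute Int_commute)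
  have Y0sum: "alternating_sum (\<lambda>p. betti_number p (subtopology Y (topspace Y - {b}))) \<delta>"
    using \<delta> betti_number_homotopy_equivalent[OF homY] by (simp add: sYA)
  have X0sum: "alternating_sum (\<lambda>p. betti_number p (subtopology X (topspace X - {b}))) \<alpha>"
    using \<alpha> betti_number_homotopy_equivalent[OF homX] by simp
  have relY: "alternating_sum (\<lambda>p. abelian_rank (relative_homology_group (int p) Y (topspace Y - {b}))) (1 - \<delta>)"
  proof (rule homology_rank_decomposition[of Y "topspace Y - {b}"])
    fix d i j :: "nat \<Rightarrow> enat"
    assume *: "\<And>p. betti_number p (subtopology Y (topspace Y - {b})) = d (Suc p) + i p"
      "\<And>p. betti_number p Y = i p + j p"
      "\<And>p. abelian_rank (relative_homology_group (int p) Y (topspace Y - {b})) = j p + d p" "d 0 = 0"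
    show ?thesis by (rule alternating_sum_right[of _ d i _ j, OF * Y0sum Ysum])
  qed
  have bB: "b \<in> B" and b\<pi>: "\<pi> b = barycenter T"
    using hom barycenter_simplex[OF T] BX unfolding b_def homeomorphic_maps_def
    by (auto dest!: continuous_map_funspace)
  have bA: "b \<notin> A"
  proof
    assume "b \<in> A"
    then obtain c where "c \<in> T" "\<pi> b c = 0" using bB bd by auto
    then show False using T by (simp add: b\<pi> barycenter_def)
  qed
  \<comment> \<open>The chart makes the cell a Hausdorff space, so the point is closed in the cell;
    closedness of \<open>B\<close> carries this over to \<open>X\<close>.\<close>
  have clb: "closedin X {b}"
  proof -
    have "Hausdorff_space (simplex_top T)"
      unfolding simplex_top_def by (intro Hausdorff_space_subtopology) (simp add: Hausdorff_space_product_topology)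
    then have "Hausdorff_space Y"
      using hom unfolding Y_def homeomorphic_space_def[symmetric]
      by (metis homeomorphic_Hausdorff_space homeomorphic_space_def)
    then have "closedin Y {b}" using bB tY by (simp add: closedin_Hausdorff_sing_eq)
    then show ?thesis using B closedin_closed_subtopology unfolding Y_def by blast
  qed
  \<comment> \<open>The excised set is \<open>A - B\<close>: its closure stays in the closed set
    \<open>A\<close>, which misses \<open>b\<close>, and what remains of \<open>X\<close> is exactly
    the cell.\<close>
  have "hom_induced (int p) (subtopology X (topspace X - (A - B))) ((topspace X - {b}) - (A - B))
        (subtopology X (topspace X)) (topspace X - {b}) id
      \<in> iso (relative_homology_group (int p) (subtopology X (topspace X - (A - B))) ((topspace X - {b}) - (A - B)))
            (relative_homology_group (int p) (subtopology X (topspace X)) (topspace X - {b}))" for p :: nat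
  proof (rule homology_excision_axiom)
    have "openin X (topspace X - {b})" using clb by (simp add: closedin_def)
    then have "X interior_of (topspace X - {b}) = topspace X - {b}" by (simp add: interior_of_eq)
    moreover have "X closure_of (A - B) \<subseteq> A" using A by (simp add: closure_of_minimal)
    ultimately show "X closure_of (A - B) \<subseteq> X interior_of (topspace X - {b})" using AX bA by auto
  qed auto
  moreover have "topspace X - (A - B) = B" "(topspace X - {b}) - (A - B) = topspace Y - {b}"
    using AB BX bA by (auto simp: tY)
  ultimately have "abelian_rank (relative_homology_group (int p) Y (topspace Y - {b}))
      = abelian_rank (relative_homology_group (int p) X (topspace X - {b}))" for p
    by (intro abelian_rank_iso[of _ _ "hom_induced (int p) Y (topspace Y - {b}) X (topspace X - {b}) id"])
      (auto simp: Y_def)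
  then have relX: "alternating_sum (\<lambda>p. abelian_rank (relative_homology_group (int p) X (topspace X - {b}))) (1 - \<delta>)"
    using relY by simp
  show ?thesis
  proof (rule homology_rank_decomposition[of X "topspace X - {b}"])
    fix d i j :: "nat \<Rightarrow> enat"
    assume *: "\<And>p. betti_number p (subtopology X (topspace X - {b})) = d (Suc p) + i p"
      "\<And>p. betti_number p X = i p + j p"
      "\<And>p. abelian_rank (relative_homology_group (int p) X (topspace X - {b})) = j p + d p" "d 0 = 0"
    show ?thesis by (rule alternating_sum_middle[of _ d i _ j, OF * X0sum relX])
  qed
qed

section \<open>Euler characteristic of a finite complex, by removal of top cells\<close>

section \<open>Regular complexes of simplices\<close>

text \<open>Euler characteristic of a full simplex: inserting one fixed element pairs off all
  subsets with opposite signs, and the empty set is then left out.\<close>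

lemma sum_nonempty_subsets_alternating:
  assumes "finite T" "T \<noteq> {}"
  shows "(\<Sum>P | P \<subseteq> T \<and> P \<noteq> {}. (- 1 :: int) ^ (card P - 1)) = 1"
proof -
  have 0: "(\<Sum>P\<in>Pow T. (- 1 :: int) ^ card P) = 0"
    using assms
  proof (induction T rule: finite_ne_induct)
    case (singleton x)
    have "Pow {x} = {{}, {x}}" by auto
    then show ?case by simp
  next
    case (insert x F)
    have inj: "inj_on (insert x) (Pow F)" using insert by (auto simp: inj_on_def)
    have "(\<Sum>P\<in>Pow (insert x F). (- 1 :: int) ^ card P)
        = (\<Sum>P\<in>Pow F. (- 1) ^ card P) + (\<Sum>P\<in>insert x ` Pow F. (- 1) ^ card P)"
      unfolding Pow_insert using insert by (intro sum.union_disjoint) auto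
    also have "(\<Sum>P\<in>insert x ` Pow F. (- 1 :: int) ^ card P) = (\<Sum>P\<in>Pow F. (- 1) ^ card (insert x P))"
      using inj by (simp add: sum.reindex)
    also have "\<dots> = (\<Sum>P\<in>Pow F. - ((- 1) ^ card P))"
    proof (intro sum.cong refl)
      fix P assume "P \<in> Pow F"
      then have "finite P" "x \<notin> P" using insert finite_subset by auto
      then show "(- 1 :: int) ^ card (insert x P) = - ((- 1) ^ card P)" by simp
    qed
    finally show ?case by (simp add: sum_negf)
  qed
  have "Pow T = insert {} {P. P \<subseteq> T \<and> P \<noteq> {}}" by auto
  then have "(\<Sum>P | P \<subseteq> T \<and> P \<noteq> {}. (- 1 :: int) ^ card P) = -1"
    using 0 assms by simp
  moreover have "(\<Sum>P | P \<subseteq> T \<and> P \<noteq> {}. (- 1 :: int) ^ (card P - 1))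
      = (\<Sum>P | P \<subseteq> T \<and> P \<noteq> {}. - ((- 1) ^ card P))"
  proof (intro sum.cong refl)
    fix P assume "P \<in> {P. P \<subseteq> T \<and> P \<noteq> {}}"
    then have "finite P" "P \<noteq> {}" using assms finite_subset by auto
    then have "card P \<noteq> 0" by simp
    then show "(- 1 :: int) ^ (card P - 1) = - ((- 1) ^ card P)" by (cases "card P") auto
  qed
  ultimately show ?thesis by (simp add: sum_negf)
qed

text \<open>One map \<open>\<pi>\<close> is the chart of all cells. The nonzero coordinates of
  \<open>\<pi> x\<close> already tell apart open cells with different vertex sets, so disjointness
  is demanded only for equal vertex sets.\<close>

locale simplicial_cells =
  fixes X :: "'a topology" and I :: "'i set" and K :: "'i \<Rightarrow> 'a set" and T :: "'i \<Rightarrow> 'c set"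
    and \<pi> :: "'a \<Rightarrow> 'c \<Rightarrow> real"
  assumes finite_cells: "finite I"
    and closed_cell: "\<And>i. i \<in> I \<Longrightarrow> closedin X (K i)"
    and finite_vertices: "\<And>i. i \<in> I \<Longrightarrow> finite (T i)"
    and vertices_nonempty: "\<And>i. i \<in> I \<Longrightarrow> T i \<noteq> {}"
    and cell_homeomorphic: "\<And>i. i \<in> I \<Longrightarrow> homeomorphic_map (subtopology X (K i)) (simplex_top (T i)) \<pi>"
    and cell_face: "\<And>i P. i \<in> I \<Longrightarrow> P \<subseteq> T i \<Longrightarrow> P \<noteq> {} \<Longrightarrow>
          \<exists>j\<in>I. T j = P \<and> K j = {x \<in> K i. \<forall>c. c \<notin> P \<longrightarrow> \<pi> x c = 0}"
    and open_cells_disjoint: "\<And>i j x. i \<in> I \<Longrightarrow> j \<in> I \<Longrightarrow> T i = T j \<Longrightarrow> x \<in> K i \<Longrightarrow> x \<in> K j \<Longrightarrow>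
          \<forall>c\<in>T i. \<pi> x c \<noteq> 0 \<Longrightarrow> i = j"
begin

lemma cell_subset: "i \<in> I \<Longrightarrow> K i \<subseteq> topspace X"
  by (simp add: closed_cell closedin_subset)

lemma proj_image: "i \<in> I \<Longrightarrow> \<pi> ` K i = simplex_points (T i)"
  using homeomorphic_imp_surjective_map[OF cell_homeomorphic, of i] cell_subset[of i]
  by (simp add: Int_absorb1)

lemma proj_in_simplex: "i \<in> I \<Longrightarrow> x \<in> K i \<Longrightarrow> \<pi> x \<in> simplex_points (T i)"
  using proj_image by blast

lemma interior_point:
  assumes "i \<in> I"
  obtains x where "x \<in> K i" "\<And>c. \<pi> x c \<noteq> 0 \<longleftrightarrow> c \<in> T i"
proof -
  have "barycenter (T i) \<in> \<pi> ` K i"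
    using barycenter_simplex[OF finite_vertices vertices_nonempty] proj_image assms by simp
  then obtain x where "x \<in> K i" "\<pi> x = barycenter (T i)" by auto
  then show ?thesis using that finite_vertices[OF assms] vertices_nonempty[OF assms]
    by (auto simp: barycenter_def)
qed

text \<open>One interior point of \<open>K j\<close> decides everything: its nonzero coordinates
  give \<open>T j \<subseteq> T i\<close>, and the face of \<open>K i\<close> over
  \<open>T j\<close> contains it and hence equals \<open>K j\<close>.\<close>

lemma subcell:
  assumes "i \<in> I" "j \<in> I" "K j \<subseteq> K i"
  shows "T j \<subseteq> T i" "K j = {x \<in> K i. \<forall>c. c \<notin> T j \<longrightarrow> \<pi> x c = 0}"
proof -
  obtain x where x: "x \<in> K j" "\<And>c. \<pi> x c \<noteq> 0 \<longleftrightarrow> c \<in> T j" using interior_point[OF assms(2)] by blast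
  have "\<pi> x \<in> simplex_points (T i)" using proj_in_simplex x(1) assms by blast
  then show sub: "T j \<subseteq> T i" using x(2) by (auto simp: simplex_points_def)
  obtain m where m: "m \<in> I" "T m = T j" "K m = {x \<in> K i. \<forall>c. c \<notin> T j \<longrightarrow> \<pi> x c = 0}"
    using cell_face[OF assms(1) sub vertices_nonempty[OF assms(2)]] by blast
  have "x \<in> K m" using x assms m by auto
  then have "m = j" using open_cells_disjoint[OF m(1) assms(2) m(2)] x m(2) by auto
  then show "K j = {x \<in> K i. \<forall>c. c \<notin> T j \<longrightarrow> \<pi> x c = 0}" using m by simp
qed

text \<open>Take the face spanned by the nonzero coordinates; there are some because the coordinates
  sum to 1.\<close>

lemma face_of_boundary_point:
  assumes "i \<in> I" "x \<in> K i" "c \<in> T i" "\<pi> x c = 0"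
  obtains j where "j \<in> I" "K j \<subseteq> K i" "x \<in> K j" "T j \<noteq> T i"
proof -
  define P where "P = {c \<in> T i. \<pi> x c \<noteq> 0}"
  have s: "\<pi> x \<in> simplex_points (T i)" using proj_in_simplex assms by blast
  have "P \<noteq> {}"
  proof
    assume "P = {}"
    then have "sum (\<pi> x) (T i) = 0" by (intro sum.neutral) (auto simp: P_def)
    then show False using s by (simp add: simplex_points_def)
  qed
  then obtain j where "j \<in> I" "T j = P" "K j = {x \<in> K i. \<forall>c. c \<notin> P \<longrightarrow> \<pi> x c = 0}"
    using cell_face[OF assms(1), of P] by (auto simp: P_def)
  then show ?thesis using that[of j] assms s by (auto simp: P_def simplex_points_def)
qed

text \<open>The boundary of a cell must itself be a complex with known alternating sum, so the
  induction, on the number of cells, ranges over all sets of cells that are closed under passing to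
  subcells.\<close>

theorem alternating_sum_subcomplex:
  assumes "S \<subseteq> I" "\<And>i j. i \<in> S \<Longrightarrow> j \<in> I \<Longrightarrow> K j \<subseteq> K i \<Longrightarrow> j \<in> S"
  shows "alternating_sum (\<lambda>p. betti_number p (subtopology X (\<Union>i\<in>S. K i)))
           (\<Sum>i\<in>S. (- 1) ^ (card (T i) - 1))"
  using assms
proof (induction "card S" arbitrary: S rule: less_induct)
  case less
  have finS: "finite S" using less.prems finite_cells finite_subset by blast
  show ?case
  proof (cases "S = {}")
    case True
    have "betti_number p (subtopology X {}) = 0" for p
      using trivial_homology_group_empty[of "subtopology X {}" "int p"]
      unfolding betti_number_def abelian_rank_eq_rank_in
      by (intro rank_in_trivial) (auto simp: trivial_group_def)
    then show ?thesis using True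
      by (auto simp: alternating_sum_def enat_0 intro!: exI[of _ "\<lambda>p. 0"] exI[of _ 0])
  next
    case False
    \<comment> \<open>A cell with the most vertices is contained in no other cell of
      \<open>S\<close>, so removing it leaves a set closed under subcells.\<close>
    obtain i where i: "i \<in> S" "\<And>j. j \<in> S \<Longrightarrow> card (T j) \<le> card (T i)"
    proof -
      have "Max ((\<lambda>i. card (T i)) ` S) \<in> (\<lambda>i. card (T i)) ` S"
        using finS False by (intro Max_in) auto
      then obtain i where i: "i \<in> S" "Max ((\<lambda>i. card (T i)) ` S) = card (T i)" by auto
      show ?thesis
      proof (rule that[OF i(1)])
        fix j assume "j \<in> S"
        then show "card (T j) \<le> card (T i)" unfolding i(2)[symmetric] using finS by simp
      qed
    qed
    have iI: "i \<in> I" using i less.prems by auto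
    have Teq: "T j = T i" if "j \<in> S" "T i \<subseteq> T j" for j
      using i(2)[OF that(1)] that less.prems(1) finite_vertices card_seteq by (metis subsetD)
    define S' where "S' = S - {i}"
    define F where "F = {j \<in> I. K j \<subset> K i}"
    define U where "U = (\<Union>i\<in>S. K i)"
    define A where "A = (\<Union>i\<in>S'. K i)"
    have S'I: "S' \<subseteq> I" using less.prems by (auto simp: S'_def)
    have F_S': "F \<subseteq> S'" using less.prems(2)[OF i(1)] by (auto simp: F_def S'_def)
    have cS': "card S' < card S" using finS i(1) unfolding S'_def by (rule card_Diff1_less)
    have cF: "card F < card S"
      using card_mono[OF _ F_S'] cS' finS by (simp add: S'_def)
    have downS': "m \<in> S'" if "j \<in> S'" "m \<in> I" "K m \<subseteq> K j" for j m
    proof -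
      have jS: "j \<in> S" "j \<in> I" "j \<noteq> i" using that S'I by (auto simp: S'_def)
      have "m \<noteq> i"
      proof
        assume "m = i"
        then have sub: "K i \<subseteq> K j" using that by simp
        have "T i = T j" using subcell(1)[OF jS(2) iI sub] Teq[OF jS(1)] by simp
        obtain x where x: "x \<in> K i" "\<And>c. \<pi> x c \<noteq> 0 \<longleftrightarrow> c \<in> T i" using interior_point[OF iI] by blast
        have "i = j" using open_cells_disjoint[OF iI jS(2) \<open>T i = T j\<close> x(1)] x sub by auto
        then show False using jS by simp
      qed
      then show ?thesis using less.prems(2)[OF jS(1) that(2,3)] by (simp add: S'_def)
    qed
    have IHA: "alternating_sum (\<lambda>p. betti_number p (subtopology X A)) (\<Sum>i\<in>S'. (- 1) ^ (card (T i) - 1))"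
      unfolding A_def by (rule less.hyps[OF cS' S'I]) (rule downS')
    have IHF: "alternating_sum (\<lambda>p. betti_number p (subtopology X (\<Union>i\<in>F. K i))) (\<Sum>i\<in>F. (- 1) ^ (card (T i) - 1))"
      by (rule less.hyps[OF cF]) (auto simp: F_def)
    have strict: "T j \<noteq> T i" if "j \<in> F" for j
    proof
      assume "T j = T i"
      then have "K j = {x \<in> K i. \<forall>c. c \<notin> T i \<longrightarrow> \<pi> x c = 0}"
        using subcell(2)[OF iI, of j] that by (auto simp: F_def)
      also have "\<dots> = K i" using proj_in_simplex[OF iI] by (auto simp: simplex_points_def)
      finally show False using that by (simp add: F_def)
    qed
    define D where "D = {x \<in> K i. \<exists>c\<in>T i. \<pi> x c = 0}"
    have inD: "x \<in> D" if "x \<in> K i" "x \<in> K j" "j \<in> S'" for x j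
    proof (rule ccontr)
      assume "x \<notin> D"
      then have nz: "\<forall>c\<in>T i. \<pi> x c \<noteq> 0" using that by (auto simp: D_def)
      have j: "j \<in> I" "j \<in> S" "j \<noteq> i" using that S'I by (auto simp: S'_def)
      have "\<pi> x \<in> simplex_points (T j)" using proj_in_simplex that j by blast
      then have "T i \<subseteq> T j" using nz by (auto simp: simplex_points_def)
      then have "T i = T j" using Teq[OF j(2)] by simp
      then show False using open_cells_disjoint[OF iI j(1)] that nz j by auto
    qed
    have Dface: "\<exists>j\<in>F. x \<in> K j" if xD: "x \<in> D" for x
    proof -
      obtain c where "x \<in> K i" "c \<in> T i" "\<pi> x c = 0" using xD by (auto simp: D_def)
      then obtain j where j: "j \<in> I" "K j \<subseteq> K i" "x \<in> K j" "T j \<noteq> T i"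
        using face_of_boundary_point[OF iI] by blast
      have "K j \<noteq> K i" using subcell(1)[OF iI j(1)] subcell(1)[OF j(1) iI] j(4) by auto
      then show ?thesis using j by (auto simp: F_def)
    qed
    \<comment> \<open>The rest of the complex meets the cell exactly in its boundary, which is also
      the union of its proper faces.\<close>
    have AD: "A \<inter> K i = D"
      using inD Dface F_S' by (auto simp: A_def D_def) blast
    have FD: "(\<Union>j\<in>F. K j) = D"
    proof (intro subset_antisym subsetI)
      fix x assume "x \<in> (\<Union>j\<in>F. K j)"
      then obtain j where "j \<in> F" "x \<in> K j" by auto
      then show "x \<in> D" using inD[of x j] F_S' by (auto simp: F_def)
    qed (use Dface in auto)
    have bij: "bij_betw T F ({P. P \<subseteq> T i \<and> P \<noteq> {}} - {T i})"
    proof (rule bij_betwI')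
      fix j m assume jm: "j \<in> F" "m \<in> F"
      show "T j = T m \<longleftrightarrow> j = m"
      proof
        assume eq: "T j = T m"
        have j: "j \<in> I" "K j \<subseteq> K i" and m: "m \<in> I" "K m \<subseteq> K i" using jm by (auto simp: F_def)
        have "K j = K m" using subcell(2)[OF iI j] subcell(2)[OF iI m] eq by simp
        moreover obtain x where "x \<in> K j" "\<And>c. \<pi> x c \<noteq> 0 \<longleftrightarrow> c \<in> T j" using interior_point[OF j(1)] by blast
        ultimately show "j = m" using open_cells_disjoint[OF j(1) m(1) eq] by auto
      qed simp
    next
      fix j assume j: "j \<in> F"
      then show "T j \<in> {P. P \<subseteq> T i \<and> P \<noteq> {}} - {T i}"
        using subcell(1)[OF iI] vertices_nonempty strict by (auto simp: F_def)
    next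
      fix P assume P: "P \<in> {P. P \<subseteq> T i \<and> P \<noteq> {}} - {T i}"
      then obtain j where j: "j \<in> I" "T j = P" "K j = {x \<in> K i. \<forall>c. c \<notin> P \<longrightarrow> \<pi> x c = 0}"
        using cell_face[OF iI] by blast
      have "K j \<subseteq> K i" using j by auto
      moreover have "K j \<noteq> K i"
        using subcell(1)[OF iI j(1)] subcell(1)[OF j(1) iI] j(2) P by auto
      ultimately show "\<exists>j\<in>F. P = T j" using j by (auto simp: F_def)
    qed
    \<comment> \<open>The sum over all nonempty subsets of \<open>T i\<close> is 1, and the top one
      is missing. Attaching the cell therefore contributes
      \<open>1 - (1 - (- 1) ^ (card (T i) - 1))\<close>.\<close>
    have "(\<Sum>j\<in>F. (- 1 :: int) ^ (card (T j) - 1)) = (\<Sum>P\<in>{P. P \<subseteq> T i \<and> P \<noteq> {}} - {T i}. (- 1) ^ (card P - 1))"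
      using sum.reindex_bij_betw[OF bij, of "\<lambda>P. (- 1 :: int) ^ (card P - 1)"] by simp
    also have "\<dots> = 1 - (- 1) ^ (card (T i) - 1)"
      using sum_nonempty_subsets_alternating[OF finite_vertices vertices_nonempty, OF iI iI]
        finite_vertices[OF iI] vertices_nonempty[OF iI]
      by (subst sum_diff1) auto
    finally have sumF: "(\<Sum>j\<in>F. (- 1 :: int) ^ (card (T j) - 1)) = 1 - (- 1) ^ (card (T i) - 1)" .
    have UX: "U \<subseteq> topspace X" using cell_subset less.prems by (auto simp: U_def)
    have U: "U = A \<union> K i" using i by (auto simp: U_def A_def S'_def)
    have subs: "subtopology (subtopology X U) A = subtopology X A"
      "subtopology (subtopology X U) (K i) = subtopology X (K i)"
      "subtopology (subtopology X U) (A \<inter> K i) = subtopology X D"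
      unfolding subtopology_subtopology by (simp_all add: U AD[symmetric] Int_absorb1 Int_absorb2 le_infI1)
    have clA: "closedin X A" unfolding A_def
      using S'I finS closed_cell by (intro closedin_Union) (auto simp: S'_def)
    obtain \<phi> where \<phi>: "homeomorphic_maps (subtopology X (K i)) (simplex_top (T i)) \<pi> \<phi>"
      using cell_homeomorphic[OF iI] homeomorphic_map_maps by blast
    have "alternating_sum (\<lambda>p. betti_number p (subtopology X U))
        ((\<Sum>i\<in>S'. (- 1) ^ (card (T i) - 1)) + (1 - (\<Sum>i\<in>F. (- 1) ^ (card (T i) - 1))))"
    proof (rule alternating_sum_attach_cell)
      show "closedin (subtopology X U) A" "closedin (subtopology X U) (K i)"
        using clA closed_cell[OF iI] U by (auto simp: closedin_subtopology)
      show "topspace (subtopology X U) = A \<union> K i" using UX U by auto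
      show "finite (T i)" "T i \<noteq> {}" using finite_vertices vertices_nonempty iI by auto
      show "homeomorphic_maps (subtopology (subtopology X U) (K i)) (simplex_top (T i)) \<pi> \<phi>"
        using \<phi> by (simp add: subs)
      show "A \<inter> K i = {x \<in> K i. \<exists>c\<in>T i. \<pi> x c = 0}" using AD by (simp add: D_def)
      show "alternating_sum (\<lambda>p. betti_number p (subtopology (subtopology X U) A)) (\<Sum>i\<in>S'. (- 1) ^ (card (T i) - 1))"
        using IHA by (simp add: subs)
      show "alternating_sum (\<lambda>p. betti_number p (subtopology (subtopology X U) (A \<inter> K i))) (\<Sum>i\<in>F. (- 1) ^ (card (T i) - 1))"
        using IHF by (simp add: subs FD)
    qed
    moreover have "(\<Sum>i\<in>S. (- 1 :: int) ^ (card (T i) - 1)) = (- 1) ^ (card (T i) - 1) + (\<Sum>i\<in>S'. (- 1) ^ (card (T i) - 1))"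
      unfolding S'_def using finS i(1) by (rule sum.remove)
    ultimately show ?thesis unfolding sumF U_def by (simp add: algebra_simps)
  qed
qed

corollary euler_characteristic_cells:
  assumes "topspace X = (\<Union>i\<in>I. K i)"
  shows "has_finite_betti_numbers X"
    "euler_characteristic X = (\<Sum>i\<in>I. (- 1) ^ (card (T i) - 1))"
proof -
  have "alternating_sum (\<lambda>p. betti_number p X) (\<Sum>i\<in>I. (- 1) ^ (card (T i) - 1))"
    using alternating_sum_subcomplex[of I] assms by (metis order_refl subtopology_topspace)
  then show "has_finite_betti_numbers X"
    "euler_characteristic X = (\<Sum>i\<in>I. (- 1) ^ (card (T i) - 1))"
    by (rule alternating_sum_euler_characteristic)+
qed

end

section \<open>Stability of weighted graphs under collapse\<close>

section \<open>Collapsing edges of weighted graphs\<close>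

text \<open>Rotation of the cycle. The inverse adds \<open>k - m mod k\<close>; reducing
  \<open>m\<close> first keeps the subtraction from being cut off at 0.\<close>

lemma bij_betw_add_mod:
  fixes k m :: nat
  assumes "k > 0"
  shows "bij_betw (\<lambda>j. (j + m) mod k) {..<k} {..<k}"
proof -
  have inv: "m mod k + (k - m mod k) = k" using assms by simp
  have 1: "((j + m) mod k + (k - m mod k)) mod k = j" if "j < k" for j
  proof -
    have "((j + m) mod k + (k - m mod k)) mod k = ((j + m mod k) mod k + (k - m mod k)) mod k"
      by (simp add: mod_add_right_eq)
    also have "\<dots> = (j + (m mod k + (k - m mod k))) mod k"
      by (simp only: mod_add_left_eq add.assoc)
    finally show ?thesis using that by (simp only: inv) simp
  qed
  have 2: "((j + (k - m mod k)) mod k + m) mod k = j" if "j < k" for j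
  proof -
    have "((j + (k - m mod k)) mod k + m) mod k = ((j + (k - m mod k)) mod k + m mod k) mod k"
      by (simp add: mod_add_right_eq)
    also have "\<dots> = (j + (m mod k + (k - m mod k))) mod k"
      by (simp only: mod_add_left_eq add.assoc add.commute[of "k - m mod k"])
    finally show ?thesis using that by (simp only: inv) simp
  qed
  show ?thesis
    by (rule bij_betw_byWitness[where f' = "\<lambda>j. (j + (k - m mod k)) mod k"]) (use 1 2 assms in auto)
qed

text \<open>A chosen edge may be taken to be the last one, so that deleting it leaves an initial
  segment of indices.\<close>

lemma is_cycle_last_edge:
  assumes "is_cycle k G" "e \<in> edges G"
  obtains x y where "bij_betw x {..<k} (verts G)" "bij_betw y {..<k} (edges G)"
    "\<And>j. j < k \<Longrightarrow> ends G (y j) = {x j, x ((j + 1) mod k)}" "k > 0" "y (k - 1) = e"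
proof -
  obtain x y where x: "bij_betw x {..<k} (verts G)" and y: "bij_betw y {..<k} (edges G)"
    and en: "\<And>j. j < k \<Longrightarrow> ends G (y j) = {x j, x ((j + 1) mod k)}"
    using assms(1) by (auto simp: is_cycle_def)
  obtain m where m: "m < k" "y m = e" using y assms(2) unfolding bij_betw_def by (metis imageE lessThan_iff)
  have k: "k > 0" using m by simp
  \<comment> \<open>Shifting by \<open>m + 1\<close> sends the last index \<open>k - 1\<close> to
    \<open>k + m\<close>, that is, to \<open>m\<close>.\<close>
  let ?r = "\<lambda>j. (j + (m + 1)) mod k"
  have r: "bij_betw ?r {..<k} {..<k}" by (rule bij_betw_add_mod[OF k])
  show ?thesis
  proof (rule that[of "x \<circ> ?r" "y \<circ> ?r"])
    show "bij_betw (x \<circ> ?r) {..<k} (verts G)" "bij_betw (y \<circ> ?r) {..<k} (edges G)"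
      using bij_betw_trans[OF r] x y by auto
    show "ends G ((y \<circ> ?r) j) = {(x \<circ> ?r) j, (x \<circ> ?r) ((j + 1) mod k)}" if "j < k" for j
    proof -
      have "(?r j + 1) mod k = ?r ((j + 1) mod k)"
        by (simp only: mod_add_left_eq) (simp add: ac_simps)
      then show ?thesis using en[of "?r j"] k by simp
    qed
    have "k - 1 + (m + 1) = m + k" using k by simp
    then have "(k - 1 + (m + 1)) mod k = m" using m by (simp only: mod_add_self2) simp
    then show "(y \<circ> ?r) (k - 1) = e" using m by simp
  qed fact
qed

context
  fixes s :: nat and G :: weighted_graph
  assumes G: "is_weighted_graph s G"
begin

lemma weighted_graph_finite: "finite (verts G)" "finite (edges G)"
  using G by (auto simp: is_weighted_graph_def one_loop_admissible_def is_multigraph_def)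

lemma weighted_graph_ends: "e \<in> edges G \<Longrightarrow> ends G e \<subseteq> verts G"
    "e \<in> edges G \<Longrightarrow> card (ends G e) \<in> {1, 2}"
  using G by (auto simp: is_weighted_graph_def one_loop_admissible_def is_multigraph_def)

lemma weighted_graph_leg: "i \<in> {1..s} \<Longrightarrow> leg G i \<in> verts G"
  using G by (simp add: is_weighted_graph_def one_loop_admissible_def is_multigraph_def)

lemma weighted_graph_legs_nonempty: "v \<in> verts G \<Longrightarrow> \<exists>i\<in>{1..s}. leg G i = v"
  using G by (force simp: is_weighted_graph_def one_loop_admissible_def legs_at_def)

lemma weighted_graph_cycle: "\<exists>k\<in>{1..s}. is_cycle k G"
  using G by (simp add: is_weighted_graph_def one_loop_admissible_def)

lemma weighted_graph_color: "inj_on (color G) (edges G)" "color G ` edges G \<subseteq> {1..s}"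
  using G by (auto simp: is_weighted_graph_def holocoloring_def)

lemma weighted_graph_weight: "v \<in> verts G \<Longrightarrow> weight G v \<subseteq> {1..s}"
    "v \<in> verts G \<Longrightarrow> card (weight G v) = card (legs_at s G v) - 1"
    "v \<in> verts G \<Longrightarrow> weight G v \<inter> color G ` edges G = {}"
    "(\<Union>v\<in>verts G. weight G v) \<union> color G ` edges G = {1..s}"
    "v \<in> verts G \<Longrightarrow> w \<in> verts G \<Longrightarrow> v \<noteq> w \<Longrightarrow> weight G v \<inter> weight G w = {}"
  using G by (auto simp: is_weighted_graph_def disjoint_family_on_def)

lemma weighted_graph_edges_nonempty: "edges G \<noteq> {}"
proof -
  obtain k where "k \<in> {1..s}" "is_cycle k G" using weighted_graph_cycle by blast
  then obtain y where "bij_betw y {..<k} (edges G)" by (auto simp: is_cycle_def)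
  then show ?thesis using \<open>k \<in> {1..s}\<close> bij_betw_apply[of y "{..<k}" "edges G" 0] by force
qed

text \<open>With a second edge present the cycle has length at least 2, and then the last and the
  first vertex are distinct.\<close>

lemma weighted_graph_nonloop:
  assumes "e \<in> edges G" "edges G \<noteq> {e}"
  shows "card (ends G e) = 2"
proof -
  obtain k where k: "k \<in> {1..s}" "is_cycle k G" using weighted_graph_cycle by blast
  obtain x y where x: "bij_betw x {..<k} (verts G)" and y: "bij_betw y {..<k} (edges G)"
    and en: "\<And>j. j < k \<Longrightarrow> ends G (y j) = {x j, x ((j + 1) mod k)}" and "k > 0" "y (k - 1) = e"
    by (rule is_cycle_last_edge[OF k(2) assms(1)]) blast
  have "k \<noteq> 1"
  proof
    assume "k = 1"
    then have "edges G = {y 0}" using y by (auto simp: bij_betw_def)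
    then show False using assms by auto
  qed
  then have "x (k - 1) \<noteq> x 0"
    using inj_onD[OF bij_betw_imp_inj_on[OF x], of "k - 1" 0] \<open>k > 0\<close> by auto
  then show ?thesis using en[of "k - 1"] \<open>k > 0\<close> \<open>y (k - 1) = e\<close> by simp
qed

context
  fixes e
  assumes e: "e \<in> edges G" and ce: "card (ends G e) = 2"
begin

lemma Min_ends: "Min (ends G e) \<in> ends G e"
  using ce by (intro Min_in) (auto intro: card_ge_0_finite)

lemma merge_ends_simps: "v \<in> ends G e \<Longrightarrow> merge_ends G e v = Min (ends G e)"
    "v \<notin> ends G e \<Longrightarrow> merge_ends G e v = v"
  by (auto simp: merge_ends_def)

lemma merge_ends_eq: "merge_ends G e u = merge_ends G e v \<longleftrightarrow> u = v \<or> u \<in> ends G e \<and> v \<in> ends G e"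
  using Min_ends by (auto simp: merge_ends_def)

lemma verts_collapse: "verts (collapse G e) = insert (Min (ends G e)) (verts G - ends G e)"
  using Min_ends weighted_graph_ends(1)[OF e] by (force simp: collapse_def merge_ends_def image_iff)

lemma legs_at_collapse:
  "legs_at s (collapse G e) v =
     (if v = Min (ends G e) then \<Union>u\<in>ends G e. legs_at s G u
      else if v \<in> ends G e then {} else legs_at s G v)"
  using Min_ends by (auto simp: legs_at_def collapse_def merge_ends_def)

text \<open>The weight condition survives because every vertex has a leg: vertices with
  \<open>a\<close> and \<open>b\<close> legs merge to one with \<open>a + b\<close> legs and weight
  of size \<open>(a - 1) + (b - 1) + 1 = (a + b) - 1\<close>, the extra element being the color of
  \<open>e\<close>.\<close>

lemma weighted_graph_collapse: "is_weighted_graph s (collapse G e)"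
proof -
  let ?H = "collapse G e" and ?m = "merge_ends G e" and ?E = "ends G e" and ?w = "Min (ends G e)"
  obtain u v where E: "?E = {u, v}" "u \<noteq> v" using ce by (auto simp: card_2_iff)
  have uv: "u \<in> verts G" "v \<in> verts G" using weighted_graph_ends(1)[OF e] E by auto
  have H: "edges ?H = edges G - {e}" "color ?H = color G" "leg ?H = (\<lambda>i. ?m (leg G i))"
    "ends ?H = (\<lambda>d. ?m ` ends G d)" "verts ?H = ?m ` verts G"
    by (auto simp: collapse_def)
  have wt: "weight ?H x = (if x = ?w then weight G u \<union> weight G v \<union> {color G e} else weight G x)" for x
    using E by (auto simp: collapse_def)
  have w: "?w = u \<or> ?w = v" using Min_ends E by auto
  have V: "x \<in> verts ?H \<longleftrightarrow> x = ?w \<or> x \<in> verts G \<and> x \<noteq> u \<and> x \<noteq> v" for x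
    using E by (auto simp: verts_collapse)
  have ce: "color G e \<notin> weight G x" if "x \<in> verts G" for x
    using weighted_graph_weight(3)[OF that] e by auto
  have mg: "is_multigraph s ?H"
    unfolding is_multigraph_def
  proof (intro conjI ballI)
    fix d assume d: "d \<in> edges ?H"
    then have dG: "ends G d \<subseteq> verts G" "card (ends G d) \<in> {1, 2}" using weighted_graph_ends H by auto
    then show "ends ?H d \<subseteq> verts ?H" unfolding H by auto
    have "finite (ends G d)" "ends G d \<noteq> {}" using dG by (auto intro: card_ge_0_finite)
    then have "card (ends ?H d) \<le> card (ends G d)" "card (ends ?H d) \<noteq> 0"
      by (simp_all add: H card_image_le)
    then have "card (ends ?H d) \<le> 2" "card (ends ?H d) \<noteq> 0" using dG(2) by auto
    then show "card (ends ?H d) \<in> {1, 2}" by auto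
  qed (use weighted_graph_finite weighted_graph_leg in \<open>auto simp: H\<close>)
  have "\<exists>k\<in>{1..s}. is_cycle k ?H"
  proof -
    obtain k where k: "k \<in> {1..s}" "is_cycle k G" using weighted_graph_cycle by blast
    obtain x y where x: "bij_betw x {..<k} (verts G)" and y: "bij_betw y {..<k} (edges G)"
      and en: "\<And>j. j < k \<Longrightarrow> ends G (y j) = {x j, x ((j + 1) mod k)}" and k0: "k > 0" and ye: "y (k - 1) = e"
      by (rule is_cycle_last_edge[OF k(2) e]) blast
    have Ek: "?E = {x (k - 1), x 0}" using en[of "k - 1"] ye k0 by simp
    have "k \<noteq> 1" using Ek E by auto
    then obtain n where n: "k = Suc n" "n > 0" using k0 by (cases k) auto
    have injx: "\<And>i j. i < k \<Longrightarrow> j < k \<Longrightarrow> x i = x j \<longleftrightarrow> i = j"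
      and imx: "x ` {..<k} = verts G"
      using x by (auto simp: bij_betw_def inj_on_def)
    have injy: "\<And>i j. i < k \<Longrightarrow> j < k \<Longrightarrow> y i = y j \<longleftrightarrow> i = j"
      and imy: "y ` {..<k} = edges G"
      using y by (auto simp: bij_betw_def inj_on_def)
    have kk: "{..<k} = insert n {..<n}" using n by auto
    \<comment> \<open>\<open>x n\<close> and \<open>x 0\<close> are the ends of the collapsed edge;
      once they are merged, the remaining path closes up to a cycle of length
      \<open>n\<close>.\<close>
    have mx: "?m (x n) = ?m (x 0)" using Ek n by (simp add: merge_ends_eq)
    have "is_cycle n ?H"
      unfolding is_cycle_def
    proof (intro exI conjI allI impI)
      show "bij_betw (?m \<circ> x) {..<n} (verts ?H)"
        unfolding bij_betw_def
      proof
        show "inj_on (?m \<circ> x) {..<n}"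
        proof (rule inj_onI)
          fix i j assume ij: "i \<in> {..<n}" "j \<in> {..<n}" "(?m \<circ> x) i = (?m \<circ> x) j"
          then show "i = j" unfolding comp_def merge_ends_eq Ek using injx n by auto
        qed
        have "verts ?H = insert (?m (x n)) (?m ` x ` {..<n})"
          unfolding H imx[symmetric] kk by simp
        also have "\<dots> = ?m ` x ` {..<n}" using n mx by auto
        finally show "(?m \<circ> x) ` {..<n} = verts ?H" by (simp add: image_comp)
      qed
      show "bij_betw y {..<n} (edges ?H)"
        unfolding bij_betw_def
      proof
        show "inj_on y {..<n}" using injy n by (auto simp: inj_on_def)
        have "edges ?H = insert (y n) (y ` {..<n}) - {y n}"
          unfolding H imy[symmetric] kk using ye n by simp
        also have "\<dots> = y ` {..<n}" using injy n by auto
        finally show "y ` {..<n} = edges ?H" by simp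
      qed
      fix j assume j: "j < n"
      have "ends ?H (y j) = {?m (x j), ?m (x (j + 1))}"
        using en[of j] j n by (simp add: H)
      also have "?m (x (j + 1)) = ?m (x ((j + 1) mod n))"
      proof (cases "j + 1 = n")
        case False
        then show ?thesis using j by simp
      qed (simp add: mx)
      finally show "ends ?H (y j) = {(?m \<circ> x) j, (?m \<circ> x) ((j + 1) mod n)}" by simp
    qed
    then show ?thesis using k n by (intro bexI[of _ n]) auto
  qed
  moreover have "legs_at s ?H x \<noteq> {}" if "x \<in> verts ?H" for x
    using that weighted_graph_legs_nonempty[OF uv(1)] weighted_graph_legs_nonempty[of x] E
    by (auto simp: legs_at_collapse V) (auto simp: legs_at_def)
  ultimately have "one_loop_admissible s ?H" using mg by (auto simp: one_loop_admissible_def)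
  moreover have "holocoloring s ?H (color ?H)"
    using weighted_graph_color by (auto simp: holocoloring_def H inj_on_def)
  moreover have "weight ?H x \<subseteq> {1..s}" if "x \<in> verts ?H" for x
    using that weighted_graph_weight(1) uv weighted_graph_color(2) e by (auto simp: wt V)
  moreover have "card (weight ?H x) = card (legs_at s ?H x) - 1" if "x \<in> verts ?H" for x
  proof (cases "x = ?w")
    case True
    have fin: "finite (weight G y)" if "y \<in> verts G" for y
      using weighted_graph_weight(1)[OF that] finite_subset by blast
    have L: "card (legs_at s G y) > 0" "finite (legs_at s G y)" if "y \<in> verts G" for y
    proof -
      show f: "finite (legs_at s G y)" by (simp add: legs_at_def)
      show "card (legs_at s G y) > 0"
        using weighted_graph_legs_nonempty[OF that] f by (auto simp: card_gt_0_iff legs_at_def)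
    qed
    have "weight ?H x = insert (color G e) (weight G u \<union> weight G v)" using True by (auto simp: wt)
    also have "card \<dots> = Suc (card (weight G u \<union> weight G v))"
      using ce uv fin by simp
    also have "card (weight G u \<union> weight G v) = card (weight G u) + card (weight G v)"
      using weighted_graph_weight(5)[OF uv E(2)] fin uv by (intro card_Un_disjoint) auto
    finally have "card (weight ?H x) = Suc ((card (legs_at s G u) - 1) + (card (legs_at s G v) - 1))"
      using weighted_graph_weight(2) uv by simp
    moreover have "card (legs_at s ?H x) = card (legs_at s G u) + card (legs_at s G v)"
    proof -
      have "legs_at s ?H x = legs_at s G u \<union> legs_at s G v" using True E by (simp add: legs_at_collapse)
      then show ?thesis using L uv E by (simp add: card_Un_disjoint) (auto simp: legs_at_def intro!: card_Un_disjoint)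
    qed
    ultimately show ?thesis using L[OF uv(1)] L[OF uv(2)] by simp
  next
    case False
    then have "x \<in> verts G" "x \<notin> ?E" using that V E by auto
    then show ?thesis using False weighted_graph_weight(2)[of x] by (simp add: wt legs_at_collapse)
  qed
  moreover have "disjoint_family_on (weight ?H) (verts ?H)"
    unfolding disjoint_family_on_def
  proof (intro ballI impI)
    have *: "(weight G u \<union> weight G v \<union> {color G e}) \<inter> weight G x = {}" if "x \<in> verts G" "x \<noteq> u" "x \<noteq> v" for x
      using weighted_graph_weight(5)[OF uv(1) that(1)] weighted_graph_weight(5)[OF uv(2) that(1)] that ce[OF that(1)]
      by auto
    fix x y assume "x \<in> verts ?H" "y \<in> verts ?H" "x \<noteq> y"
    then show "weight ?H x \<inter> weight ?H y = {}"
      using *[of x] *[of y] weighted_graph_weight(5)[of x y]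
      by (cases "x = ?w"; cases "y = ?w") (simp_all add: V wt Int_commute)
  qed
  moreover have "weight ?H x \<inter> color ?H ` edges ?H = {}" if "x \<in> verts ?H" for x
  proof -
    have "color G e \<notin> color G ` (edges G - {e})" using weighted_graph_color(1) e by (auto simp: inj_on_def)
    moreover have "weight G y \<inter> color G ` (edges G - {e}) = {}" if "y \<in> verts G" for y
      using weighted_graph_weight(3)[OF that] by auto
    moreover have "x = ?w \<or> x \<in> verts G" using that V by auto
    ultimately show ?thesis using uv unfolding wt H(1,2) by auto
  qed
  moreover have "(\<Union>x\<in>verts ?H. weight ?H x) \<union> color ?H ` edges ?H = {1..s}"
  proof -
    have "(\<Union>x\<in>verts ?H. weight ?H x) = (\<Union>x\<in>verts G. weight G x) \<union> {color G e}"
      unfolding verts_collapse E using uv w E by (auto simp: wt split: if_splits)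
    then show ?thesis unfolding weighted_graph_weight(4)[symmetric] H using e by auto
  qed
  ultimately show ?thesis unfolding is_weighted_graph_def by auto
qed

end

end

section \<open>Connectivity after deletion of edges as a complete isomorphism invariant\<close>

section \<open>Separation of the legs and colors by sets of edges\<close>

definition items :: "nat \<Rightarrow> (nat + nat) set" where
  "items s = Inl ` {1..s} \<union> Inr ` {1..s}"

text \<open>An edge color sits at the ends of its edge, a remembered color at one vertex. One
  formula for both lets an item survive the collapse of its edge.\<close>

fun locus :: "weighted_graph \<Rightarrow> nat + nat \<Rightarrow> nat set" where
  "locus G (Inl i) = {leg G i}"
| "locus G (Inr c) = {v \<in> verts G. c \<in> weight G v} \<union> \<Union>{ends G e |e. e \<in> edges G \<and> color G e = c}"

text \<open>Connectivity is expressed through labels instead of vertices and edges, whose names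
  change under collapse and isomorphism.\<close>

definition adjacent :: "nat \<Rightarrow> weighted_graph \<Rightarrow> nat set \<Rightarrow> ((nat + nat) \<times> (nat + nat)) set" where
  "adjacent s G B =
     {(x, y). x \<in> items s - Inr ` B \<and> y \<in> items s - Inr ` B \<and> locus G x \<inter> locus G y \<noteq> {}}"

text \<open>Keeping \<open>B\<close> in the triples makes passage to a smaller \<open>P\<close> a
  filter on the first component (\<open>conns_restrict\<close>); this is how the data of a face is
  read off from that of a cell.\<close>

definition conns :: "nat \<Rightarrow> weighted_graph \<Rightarrow> nat set \<Rightarrow> (nat set \<times> (nat + nat) \<times> (nat + nat)) set" where
  "conns s G P = {(B, x, y). B \<subseteq> P \<and> (x, y) \<in> (adjacent s G B)\<^sup>+}"

text \<open>Here the remembered color matters: after the collapse the color of \<open>e\<close> sits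
  in the weight of the merged vertex, which is the image of the ends of \<open>e\<close>.\<close>

lemma locus_collapse:
  assumes G: "is_weighted_graph s G" and e: "e \<in> edges G" and ce: "card (ends G e) = 2"
  shows "locus (collapse G e) x = merge_ends G e ` locus G x"
proof (cases x)
  case (Inl i)
  then show ?thesis by (simp add: collapse_def)
next
  case (Inr c)
  note Min = Min_ends[OF G e ce] and m = merge_ends_simps[OF G e ce]
  have E: "ends G e \<subseteq> verts G" by (rule weighted_graph_ends(1)[OF G e])
  have "locus (collapse G e) x \<subseteq> merge_ends G e ` locus G x"
  proof
    fix v assume "v \<in> locus (collapse G e) x"
    then consider "v \<in> verts (collapse G e)" "c \<in> weight (collapse G e) v"
      | d where "d \<in> edges G" "color G d = c" "v \<in> merge_ends G e ` ends G d"
      unfolding Inr by (auto simp: collapse_def)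
    then show "v \<in> merge_ends G e ` locus G x"
    proof cases
      case 1
      show ?thesis
      proof (cases "v = Min (ends G e)")
        case True
        then have "(\<exists>u\<in>ends G e. c \<in> weight G u) \<or> c = color G e"
          using 1 by (auto simp: collapse_def)
        then obtain u where "u \<in> ends G e" "u \<in> locus G x"
          using E e Min unfolding Inr by auto
        then show ?thesis using True m(1) by (metis image_eqI)
      next
        case False
        then have "v \<in> verts G" "v \<notin> ends G e"
          using 1(1) unfolding verts_collapse[OF G e ce] by auto
        moreover have "c \<in> weight G v" using 1(2) False by (simp add: collapse_def)
        ultimately have "v \<in> verts G" "v \<notin> ends G e" "c \<in> weight G v" by auto
        then show ?thesis using m(2) unfolding Inr by force
      qed
    next
      case 2
      then show ?thesis unfolding Inr by auto
    qed
  qed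
  moreover have "merge_ends G e u \<in> locus (collapse G e) x" if "u \<in> locus G x" for u
  proof -
    from that consider "u \<in> verts G" "c \<in> weight G u"
      | d where "d \<in> edges G" "color G d = c" "u \<in> ends G d"
      unfolding Inr by auto
    then show ?thesis
    proof cases
      case 1
      then have "c \<in> weight (collapse G e) (merge_ends G e u)"
        using Min by (auto simp: collapse_def merge_ends_def)
      then show ?thesis using 1 unfolding Inr by (auto simp: collapse_def)
    next
      case 2
      show ?thesis
      proof (cases "d = e")
        case True
        then have "merge_ends G e u \<in> verts (collapse G e)"
          using 2 m(1) unfolding verts_collapse[OF G e ce] by auto
        moreover have "c \<in> weight (collapse G e) (merge_ends G e u)"
          using 2 True m(1) by (simp add: collapse_def)
        ultimately have "merge_ends G e u \<in> verts (collapse G e)"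
          "c \<in> weight (collapse G e) (merge_ends G e u)" by auto
        then show ?thesis unfolding Inr by auto
      next
        case False
        then have "d \<in> edges (collapse G e)" "color (collapse G e) d = c"
          "merge_ends G e u \<in> ends (collapse G e) d"
          using 2 by (auto simp: collapse_def)
        then show ?thesis unfolding Inr by auto
      qed
    qed
  qed
  ultimately show ?thesis by auto
qed

text \<open>A new adjacency arises when two items touch different ends of \<open>e\<close>. The
  color of \<open>e\<close>, not deleted because it lies outside \<open>B\<close>, already links
  them in \<open>G\<close>.\<close>

lemma trancl_adjacent_collapse:
  assumes G: "is_weighted_graph s G" and e: "e \<in> edges G" and ce: "card (ends G e) = 2"
    and B: "color G e \<notin> B"
  shows "(adjacent s (collapse G e) B)\<^sup>+ = (adjacent s G B)\<^sup>+"
proof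
  have ends_locus: "ends G e \<subseteq> locus G (Inr (color G e))" using e by auto
  have item: "Inr (color G e) \<in> items s - Inr ` B"
    using weighted_graph_color(2)[OF G] e B by (auto simp: items_def)
  have "adjacent s (collapse G e) B \<subseteq> (adjacent s G B)\<^sup>+"
  proof (rule subrelI)
    fix x y assume "(x, y) \<in> adjacent s (collapse G e) B"
    then have xy: "x \<in> items s - Inr ` B" "y \<in> items s - Inr ` B"
      and "merge_ends G e ` locus G x \<inter> merge_ends G e ` locus G y \<noteq> {}"
      by (auto simp: adjacent_def locus_collapse[OF G e ce])
    then obtain z where "z \<in> merge_ends G e ` locus G x" "z \<in> merge_ends G e ` locus G y" by blast
    then obtain u v where uv: "u \<in> locus G x" "v \<in> locus G y" "merge_ends G e u = merge_ends G e v"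
      by (elim imageE) simp
    from uv(3) consider "u = v" | "u \<in> ends G e" "v \<in> ends G e"
      using merge_ends_eq[OF G e ce] by blast
    then show "(x, y) \<in> (adjacent s G B)\<^sup>+"
    proof cases
      case 1
      then have "(x, y) \<in> adjacent s G B" using xy uv by (auto simp: adjacent_def)
      then show ?thesis by auto
    next
      case 2
      then have "(x, Inr (color G e)) \<in> adjacent s G B" "(Inr (color G e), y) \<in> adjacent s G B"
        using xy uv item ends_locus unfolding adjacent_def by blast+
      then show ?thesis by (meson r_into_trancl trancl_into_trancl)
    qed
  qed
  then have sub: "(x, y) \<in> (adjacent s G B)\<^sup>+" if "(x, y) \<in> adjacent s (collapse G e) B" for x y
    using that by blast
  show "(adjacent s (collapse G e) B)\<^sup>+ \<subseteq> (adjacent s G B)\<^sup>+"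
  proof (rule subrelI)
    fix x y assume "(x, y) \<in> (adjacent s (collapse G e) B)\<^sup>+"
    then show "(x, y) \<in> (adjacent s G B)\<^sup>+"
      by (induction rule: trancl_induct) (auto dest: sub intro: trancl_trans)
  qed
  have "adjacent s G B \<subseteq> adjacent s (collapse G e) B"
    unfolding adjacent_def locus_collapse[OF G e ce] by blast
  then show "(adjacent s G B)\<^sup>+ \<subseteq> (adjacent s (collapse G e) B)\<^sup>+"
    by (rule trancl_mono_subset)
qed

lemma collapses_properties:
  assumes "collapses G Z H" "is_weighted_graph s G"
  shows "is_weighted_graph s H \<and> Z \<subseteq> edges G \<and> edges H = edges G - Z \<and> color H = color G \<and>
    (\<forall>B. B \<inter> color G ` Z = {} \<longrightarrow> (adjacent s H B)\<^sup>+ = (adjacent s G B)\<^sup>+)"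
  using assms
proof (induction rule: collapses.induct)
  case (step e G Z H)
  have IH: "is_weighted_graph s H" "Z \<subseteq> edges (collapse G e)" "edges H = edges (collapse G e) - Z"
    "color H = color (collapse G e)"
    "\<And>B. B \<inter> color (collapse G e) ` Z = {} \<Longrightarrow> (adjacent s H B)\<^sup>+ = (adjacent s (collapse G e) B)\<^sup>+"
    using step.IH weighted_graph_collapse[OF step.prems step.hyps(1,2)] by auto
  have "edges (collapse G e) = edges G - {e}" "color (collapse G e) = color G" by (auto simp: collapse_def)
  then show ?case using IH step.hyps trancl_adjacent_collapse[OF step.prems step.hyps(1,2)] by auto
qed auto

text \<open>\<open>Z\<close> is a proper subset, so at every stage another edge is present and the
  edge to be collapsed is not a loop.\<close>

lemma collapses_exists:
  assumes "finite Z" "is_weighted_graph s G" "Z \<subset> edges G"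
  shows "\<exists>H. collapses G Z H"
  using assms
proof (induction Z arbitrary: G rule: finite_induct)
  case empty
  then show ?case using collapses.none by blast
next
  case (insert e Z)
  have e: "e \<in> edges G" "edges G \<noteq> {e}" using insert by auto
  have ce: "card (ends G e) = 2" by (rule weighted_graph_nonloop[OF insert.prems(1) e])
  have "edges (collapse G e) = edges G - {e}" by (auto simp: collapse_def)
  then have "Z \<subset> edges (collapse G e)" using insert by auto
  then obtain H where "collapses (collapse G e) Z H"
    using insert.IH weighted_graph_collapse[OF insert.prems(1) e(1) ce] by blast
  then show ?case using collapses.step[OF e(1) ce insert.hyps(2)] by blast
qed


context
  fixes s :: nat and G :: weighted_graph
  assumes G: "is_weighted_graph s G"
begin

lemma locus_subset_verts: "x \<in> items s \<Longrightarrow> locus G x \<subseteq> verts G"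
  using weighted_graph_leg[OF G] weighted_graph_ends(1)[OF G] by (force simp: items_def)

lemma locus_edge: "e \<in> edges G \<Longrightarrow> locus G (Inr (color G e)) = ends G e"
proof -
  assume e: "e \<in> edges G"
  have "color G e \<notin> weight G v" if "v \<in> verts G" for v
    using weighted_graph_weight(3)[OF G that] e by auto
  moreover have "{d \<in> edges G. color G d = color G e} = {e}"
    using weighted_graph_color(1)[OF G] e by (auto simp: inj_on_def)
  then have "{ends G d |d. d \<in> edges G \<and> color G d = color G e} = {ends G e}" by auto
  ultimately show ?thesis by auto
qed

lemma locus_weight: "v \<in> verts G \<Longrightarrow> c \<in> weight G v \<Longrightarrow> locus G (Inr c) = {v}"
proof -
  assume v: "v \<in> verts G" "c \<in> weight G v"
  then have "{e \<in> edges G. color G e = c} = {}" using weighted_graph_weight(3)[OF G v(1)] by auto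
  then have "{ends G e |e. e \<in> edges G \<and> color G e = c} = {}" by auto
  moreover have "w = v" if "w \<in> verts G" "c \<in> weight G w" for w
    using weighted_graph_weight(5)[OF G v(1) that(1)] v(2) that(2) by auto
  then have "{v \<in> verts G. c \<in> weight G v} = {v}" using v by blast
  ultimately show ?thesis unfolding locus.simps by (simp only: Union_empty Un_empty_right)
qed

lemma weight_iff_locus:
  assumes "v \<in> verts G"
  shows "c \<in> weight G v \<longleftrightarrow> c \<in> {1..s} - color G ` edges G \<and> v \<in> locus G (Inr c)"
proof
  assume "c \<in> weight G v"
  then show "c \<in> {1..s} - color G ` edges G \<and> v \<in> locus G (Inr c)"
    using weighted_graph_weight(1,3)[OF G assms] assms unfolding locus.simps by blast
next
  assume c: "c \<in> {1..s} - color G ` edges G \<and> v \<in> locus G (Inr c)"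
  then have "{e \<in> edges G. color G e = c} = {}" by auto
  then show "c \<in> weight G v" using c by auto
qed

text \<open>Deleting all edges at the vertex \<open>u\<close> of leg \<open>i\<close> isolates
  \<open>u\<close>: the surviving items that touch \<open>u\<close> lie at \<open>u\<close> alone.
  Incidence of a leg with an item can thus be read off from connectivity for varying
  \<open>B\<close>.\<close>

lemma in_locus_iff_adjacent:
  assumes i: "i \<in> {1..s}" and y: "y \<in> items s"
  shows "leg G i \<in> locus G y \<longleftrightarrow>
    (\<forall>B. B \<subseteq> color G ` edges G \<longrightarrow> y \<notin> Inr ` B \<longrightarrow> (Inl i, y) \<in> (adjacent s G B)\<^sup>+)"
proof
  assume "leg G i \<in> locus G y"
  then show "\<forall>B. B \<subseteq> color G ` edges G \<longrightarrow> y \<notin> Inr ` B \<longrightarrow> (Inl i, y) \<in> (adjacent s G B)\<^sup>+"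
    using i y by (auto simp: adjacent_def items_def)
next
  assume *: "\<forall>B. B \<subseteq> color G ` edges G \<longrightarrow> y \<notin> Inr ` B \<longrightarrow> (Inl i, y) \<in> (adjacent s G B)\<^sup>+"
  show "leg G i \<in> locus G y"
  proof (rule ccontr)
    assume contr: "leg G i \<notin> locus G y"
    define u where "u = leg G i"
    have uV: "u \<in> verts G" using weighted_graph_leg[OF G i] by (simp add: u_def)
    define B where "B = {color G e |e. e \<in> edges G \<and> u \<in> ends G e}"
    have single: "locus G w = {u}" if "w \<in> items s - Inr ` B" "u \<in> locus G w" for w
    proof (cases w)
      case (Inr c)
      show ?thesis
      proof (cases "\<exists>e\<in>edges G. color G e = c")
        case True
        then obtain e where e: "e \<in> edges G" "color G e = c" by auto
        then have "u \<in> ends G e" using that(2) Inr locus_edge[OF e(1)] by (simp del: locus.simps)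
        then show ?thesis using e that Inr by (auto simp: B_def)
      next
        case False
        then have "c \<in> weight G u" using that Inr by auto
        then show ?thesis using locus_weight[OF uV] Inr by (simp del: locus.simps)
      qed
    qed (use that in auto)
    have "y \<notin> Inr ` B"
    proof
      assume "y \<in> Inr ` B"
      then obtain e where "y = Inr (color G e)" "e \<in> edges G" "u \<in> ends G e" by (auto simp: B_def)
      then show False using contr by (simp add: u_def locus_edge del: locus.simps)
    qed
    moreover have "B \<subseteq> color G ` edges G" by (auto simp: B_def)
    ultimately have "(Inl i, y) \<in> (adjacent s G B)\<^sup>+" using * by blast
    then have "locus G y = {u}"
    proof (induction rule: trancl_induct)
      case (base z)
      then show ?case using single by (auto simp: adjacent_def u_def simp del: locus.simps(2))
    next
      case (step z w)
      then show ?case using single by (auto simp: adjacent_def simp del: locus.simps)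
    qed
    then show False using contr by (simp add: u_def)
  qed
qed

end

lemma conns_restrict: "A \<subseteq> P \<Longrightarrow> {t \<in> conns s G P. fst t \<subseteq> A} = conns s G A"
  by (auto simp: conns_def)

text \<open>Every vertex carries a leg, so vertices are classes of legs, and the incidence of legs
  with items determines ends and weights. Vertices are matched through legs, edges through
  colors.\<close>

theorem weighted_graph_iso_exists:
  assumes G: "is_weighted_graph s G" and H: "is_weighted_graph s H"
    and col: "color G ` edges G = color H ` edges H"
    and conns: "conns s G (color G ` edges G) = conns s H (color G ` edges G)"
  shows "\<exists>f h. weighted_graph_iso s G H f h"
proof -
  let ?P = "color G ` edges G"
  have adj: "(x, y) \<in> (adjacent s G B)\<^sup>+ \<longleftrightarrow> (x, y) \<in> (adjacent s H B)\<^sup>+" if "B \<subseteq> ?P" for x y B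
  proof -
    have "(B, x, y) \<in> conns s G ?P \<longleftrightarrow> (B, x, y) \<in> conns s H ?P" by (simp only: conns)
    then show ?thesis using that by (simp add: conns_def)
  qed
  have L: "leg G i \<in> locus G y \<longleftrightarrow> leg H i \<in> locus H y" if "i \<in> {1..s}" "y \<in> items s" for i y
    unfolding in_locus_iff_adjacent[OF G that] in_locus_iff_adjacent[OF H that] col[symmetric]
    using adj by blast
  have leq: "leg G i = leg G j \<longleftrightarrow> leg H i = leg H j" if "i \<in> {1..s}" "j \<in> {1..s}" for i j
    using L[of i "Inl j"] that by (auto simp: items_def)
  \<comment> \<open>The choice of the leg is immaterial: by \<open>leq\<close>, legs sharing a
    vertex in \<open>G\<close> share one in \<open>H\<close>.\<close>
  define f where "f v = leg H (SOME i. i \<in> {1..s} \<and> leg G i = v)" for v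
  have f: "f (leg G i) = leg H i" if "i \<in> {1..s}" for i
  proof -
    have "(SOME j. j \<in> {1..s} \<and> leg G j = leg G i) \<in> {1..s} \<and>
        leg G (SOME j. j \<in> {1..s} \<and> leg G j = leg G i) = leg G i"
      by (rule someI[where x = i]) (use that in auto)
    then show ?thesis unfolding f_def using leq that by blast
  qed
  have GV: "\<exists>i\<in>{1..s}. leg G i = v" if "v \<in> verts G" for v using weighted_graph_legs_nonempty[OF G that] .
  have HV: "\<exists>i\<in>{1..s}. leg H i = v" if "v \<in> verts H" for v using weighted_graph_legs_nonempty[OF H that] .
  have bijf: "bij_betw f (verts G) (verts H)"
    unfolding bij_betw_def
  proof
    show "inj_on f (verts G)"
    proof (rule inj_onI)
      fix u v assume "u \<in> verts G" "v \<in> verts G" "f u = f v"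
      then show "u = v" using GV[of u] GV[of v] f leq by force
    qed
    show "f ` verts G = verts H"
    proof
      show "f ` verts G \<subseteq> verts H"
      proof
        fix v assume "v \<in> f ` verts G"
        then obtain u where "u \<in> verts G" "v = f u" by auto
        then show "v \<in> verts H" using GV[of u] f weighted_graph_leg[OF H] by force
      qed
      show "verts H \<subseteq> f ` verts G"
      proof
        fix v assume "v \<in> verts H"
        then obtain i where "i \<in> {1..s}" "leg H i = v" using HV by blast
        then show "v \<in> f ` verts G" using f[of i] weighted_graph_leg[OF G, of i] by force
      qed
    qed
  qed
  have floc: "f ` locus G y = locus H y" if y: "y \<in> items s" for y
  proof
    show "f ` locus G y \<subseteq> locus H y"
    proof
      fix v assume "v \<in> f ` locus G y"
      then obtain u where u: "u \<in> locus G y" "v = f u" by auto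
      then obtain i where "i \<in> {1..s}" "leg G i = u" using locus_subset_verts[OF G y] GV by blast
      then show "v \<in> locus H y" using L[of i y] f[of i] u y by auto
    qed
    show "locus H y \<subseteq> f ` locus G y"
    proof
      fix v assume v: "v \<in> locus H y"
      then obtain i where "i \<in> {1..s}" "leg H i = v" using locus_subset_verts[OF H y] HV by blast
      then show "v \<in> f ` locus G y" using L[of i y] f[of i] v y by force
    qed
  qed
  define h where "h = inv_into (edges H) (color H) \<circ> color G"
  have colh: "color H (h e) = color G e" if "e \<in> edges G" for e
    unfolding h_def comp_def using that col by (intro f_inv_into_f) auto
  have bijh: "bij_betw h (edges G) (edges H)"
    unfolding h_def
  proof (rule bij_betw_trans)
    show "bij_betw (color G) (edges G) (color H ` edges H)"
      using weighted_graph_color(1)[OF G] col by (auto simp: bij_betw_def)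
    show "bij_betw (inv_into (edges H) (color H)) (color H ` edges H) (edges H)"
      by (rule bij_betw_inv_into) (use weighted_graph_color(1)[OF H] in \<open>auto simp: bij_betw_def\<close>)
  qed
  have "weighted_graph_iso s G H f h"
    unfolding weighted_graph_iso_def
  proof (intro conjI ballI bijf bijh)
    fix e assume e: "e \<in> edges G"
    then have he: "h e \<in> edges H" using bijh by (auto simp: bij_betw_def)
    have it: "Inr (color G e) \<in> items s" using weighted_graph_color(2)[OF G] e by (auto simp: items_def)
    show "ends H (h e) = f ` ends G e"
      using floc[OF it] locus_edge[OF G e] locus_edge[OF H he] colh[OF e] by simp
  next
    fix v assume v: "v \<in> verts G"
    have fv: "f v \<in> verts H" using bijf v by (auto simp: bij_betw_def)
    show "weight H (f v) = weight G v"
    proof (intro subset_antisym subsetI)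
      fix c
      have eq: "f v \<in> locus H (Inr c) \<longleftrightarrow> v \<in> locus G (Inr c)" if "c \<in> {1..s}"
      proof -
        have it: "Inr c \<in> items s" using that by (auto simp: items_def)
        show ?thesis
          unfolding floc[OF it, symmetric]
          by (rule inj_on_image_mem_iff[OF bij_betw_imp_inj_on[OF bijf] v locus_subset_verts[OF G it]])
      qed
      show "c \<in> weight G v" if "c \<in> weight H (f v)"
        using that eq unfolding weight_iff_locus[OF G v] weight_iff_locus[OF H fv] col by blast
      show "c \<in> weight H (f v)" if "c \<in> weight G v"
        using that eq unfolding weight_iff_locus[OF G v] weight_iff_locus[OF H fv] col by blast
    qed
  qed (use f colh in auto)
  then show ?thesis by blast
qed

text \<open>An isomorphism maps loci to loci injectively, so the adjacency relations of the two
  graphs coincide for every \<open>B\<close>.\<close>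

lemma weighted_graph_iso_invariants:
  assumes G: "is_weighted_graph s G" and iso: "weighted_graph_iso s G H f h"
  shows "color H ` edges H = color G ` edges G" "conns s H P = conns s G P"
proof -
  have f: "bij_betw f (verts G) (verts H)" and h: "bij_betw h (edges G) (edges H)"
    and en: "\<And>e. e \<in> edges G \<Longrightarrow> ends H (h e) = f ` ends G e"
    and leg: "\<And>i. i \<in> {1..s} \<Longrightarrow> leg H i = f (leg G i)"
    and col: "\<And>e. e \<in> edges G \<Longrightarrow> color H (h e) = color G e"
    and wt: "\<And>v. v \<in> verts G \<Longrightarrow> weight H (f v) = weight G v"
    using iso by (auto simp: weighted_graph_iso_def)
  have EH: "edges H = h ` edges G" and VH: "verts H = f ` verts G" using f h by (auto simp: bij_betw_def)
  show "color H ` edges H = color G ` edges G" unfolding EH using col by (force simp: image_iff)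
  have loc: "locus H x = f ` locus G x" if x: "x \<in> items s" for x
  proof (cases x)
    case (Inl i)
    then show ?thesis using leg x by (auto simp: items_def)
  next
    case (Inr c)
    have 1: "{v \<in> verts H. c \<in> weight H v} = f ` {v \<in> verts G. c \<in> weight G v}"
      unfolding VH using wt by auto
    have "{e \<in> edges H. color H e = c} = h ` {e \<in> edges G. color G e = c}"
      unfolding EH using col by auto
    then have "(\<Union>e\<in>{e \<in> edges H. color H e = c}. ends H e) = (\<Union>e\<in>h ` {e \<in> edges G. color G e = c}. ends H e)"
      by (rule arg_cong)
    also have "\<dots> = (\<Union>e\<in>{e \<in> edges G. color G e = c}. ends H (h e))"
      by (rule image_image[THEN arg_cong])
    also have "\<dots> = (\<Union>e\<in>{e \<in> edges G. color G e = c}. f ` ends G e)"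
      by (rule SUP_cong) (auto simp: en)
    finally have "(\<Union>e\<in>{e \<in> edges H. color H e = c}. ends H e) = (\<Union>e\<in>{e \<in> edges G. color G e = c}. f ` ends G e)" .
    moreover have "\<Union>{ends H e |e. e \<in> edges H \<and> color H e = c} = (\<Union>e\<in>{e \<in> edges H. color H e = c}. ends H e)"
      "\<Union>{ends G e |e. e \<in> edges G \<and> color G e = c} = (\<Union>e\<in>{e \<in> edges G. color G e = c}. ends G e)"
      by blast+
    ultimately have 2: "\<Union>{ends H e |e. e \<in> edges H \<and> color H e = c} = f ` \<Union>{ends G e |e. e \<in> edges G \<and> color G e = c}"
      by (simp only: image_UN)
    show ?thesis unfolding Inr using 1 2 by (simp add: image_Un)
  qed
  have "adjacent s H B = adjacent s G B" for B
  proof -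
    have "locus H x \<inter> locus H y \<noteq> {} \<longleftrightarrow> locus G x \<inter> locus G y \<noteq> {}" if "x \<in> items s" "y \<in> items s" for x y
    proof -
      have "f ` locus G x \<inter> f ` locus G y = f ` (locus G x \<inter> locus G y)"
        by (rule inj_on_image_Int[OF bij_betw_imp_inj_on[OF f], symmetric])
          (use locus_subset_verts[OF G] that in auto)
      then show ?thesis using loc that by simp
    qed
    then show ?thesis unfolding adjacent_def by blast
  qed
  then show "conns s H P = conns s G P" by (simp add: conns_def)
qed

section \<open>Classification of the points of the quotient\<close>

section \<open>An invariant of the points of the moduli space\<close>

text \<open>For an injective coloring there is at most one summand; writing a sum gives 0 to a color
  carried by no edge.\<close>

definition color_length :: "weighted_graph \<times> (nat \<Rightarrow> real) \<Rightarrow> nat \<Rightarrow> real" where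
  "color_length p c = (\<Sum>e | e \<in> edges (fst p) \<and> color (fst p) e = c. snd p e)"

definition support :: "weighted_graph \<times> (nat \<Rightarrow> real) \<Rightarrow> nat set" where
  "support p = {c. color_length p c \<noteq> 0}"

text \<open>Separation is recorded for sets of colors of nonzero length, because an edge of length
  zero may be collapsed, after which it can no longer be cut.\<close>

definition invariant ::
  "nat \<Rightarrow> weighted_graph \<times> (nat \<Rightarrow> real) \<Rightarrow> (nat \<Rightarrow> real) \<times> (nat set \<times> (nat + nat) \<times> (nat + nat)) set" where
  "invariant s p = (color_length p, conns s (fst p) (support p))"

lemma in_metric_simplex:
  "l \<in> topspace (metric_simplex G) \<longleftrightarrow>
     l \<in> extensional (edges G) \<and> (\<forall>e\<in>edges G. 0 \<le> l e) \<and> (\<Sum>e\<in>edges G. l e) = 1"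
  by (auto simp: metric_simplex_def PiE_def)

lemma in_simplex_union:
  "(G, l) \<in> topspace (simplex_union s) \<longleftrightarrow> is_weighted_graph s G \<and> l \<in> topspace (metric_simplex G)"
  by (auto simp: simplex_union_def)

context
  fixes s G
  assumes G: "is_weighted_graph s G"
begin

lemma color_length_edge:
  assumes "e \<in> edges G"
  shows "color_length (G, l) (color G e) = l e"
proof -
  have "{d. d \<in> edges G \<and> color G d = color G e} = {e}"
    using weighted_graph_color(1)[OF G] assms by (auto simp: inj_on_def)
  then show ?thesis by (simp add: color_length_def)
qed

lemma color_length_outside: "c \<notin> color G ` edges G \<Longrightarrow> color_length (G, l) c = 0"
  unfolding color_length_def by (intro sum.neutral) auto

lemma support_subset: "support (G, l) \<subseteq> color G ` edges G"
  using color_length_outside by (auto simp: support_def)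

lemma sum_color_length: "(\<Sum>c\<in>color G ` edges G. color_length (G, l) c) = (\<Sum>e\<in>edges G. l e)"
  using weighted_graph_color(1)[OF G] by (simp add: sum.reindex color_length_edge)

lemma color_length_simplex:
  assumes "l \<in> topspace (metric_simplex G)"
  shows "color_length (G, l) \<in> simplex_points (color G ` edges G)"
proof -
  have "0 \<le> color_length (G, l) c" for c
    unfolding color_length_def using assms by (intro sum_nonneg) (auto simp: in_metric_simplex)
  then show ?thesis
    using sum_color_length[of l] color_length_outside assms
    by (auto simp: simplex_points_def in_metric_simplex)
qed

end

lemma color_length_simplex_support:
  assumes p: "(H, m) \<in> topspace (simplex_union s)" and P: "support (H, m) \<subseteq> P" "finite P"
  shows "color_length (H, m) \<in> simplex_points P"
proof -
  have H: "is_weighted_graph s H" "m \<in> topspace (metric_simplex H)"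
    using p by (auto simp: in_simplex_union)
  let ?Q = "color H ` edges H"
  have m: "color_length (H, m) \<in> simplex_points ?Q" by (rule color_length_simplex[OF H])
  have zero: "color_length (H, m) c = 0" if "c \<notin> P" for c
    using P that by (auto simp: support_def)
  have finQ: "finite ?Q" using weighted_graph_finite(2)[OF H(1)] by simp
  have "sum (color_length (H, m)) P = sum (color_length (H, m)) (P \<union> ?Q)"
    using P finQ zero by (intro sum.mono_neutral_left) auto
  also have "\<dots> = sum (color_length (H, m)) ?Q"
    using P finQ m by (intro sum.mono_neutral_right) (auto simp: simplex_points_def)
  finally show ?thesis using m zero by (simp add: simplex_points_def)
qed

text \<open>Collapsed edges have length zero, so their colors lie outside the support and none of
  the recorded sets \<open>B\<close> meets them.\<close>

lemma face_identified_invariant: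
  assumes p: "p \<in> topspace (simplex_union s)" and pq: "face_identified p q"
  shows "invariant s p = invariant s q"
proof -
  obtain G l Z H where pG: "p = (G, l)" and Z: "Z \<subset> edges G" "\<And>e. e \<in> Z \<Longrightarrow> l e = 0"
    and GH: "collapses G Z H" and q: "q = (H, restrict l (edges G - Z))"
    using pq unfolding face_identified_def by blast
  have G: "is_weighted_graph s G" using p pG by (simp add: in_simplex_union)
  have H: "edges H = edges G - Z" "color H = color G"
    "\<And>B. B \<inter> color G ` Z = {} \<Longrightarrow> (adjacent s H B)\<^sup>+ = (adjacent s G B)\<^sup>+"
    using collapses_properties[OF GH G] by auto
  have cl: "color_length q = color_length p"
  proof
    fix c
    have "color_length q c = (\<Sum>e | e \<in> edges G - Z \<and> color G e = c. l e)"
      unfolding color_length_def q by (intro sum.cong) (auto simp: H)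
    also have "\<dots> = (\<Sum>e | e \<in> edges G \<and> color G e = c. l e)"
      using weighted_graph_finite(2)[OF G] Z by (intro sum.mono_neutral_left) auto
    finally show "color_length q c = color_length p c" by (simp add: color_length_def pG)
  qed
  then have sup: "support q = support p" by (simp add: support_def)
  have "support p \<inter> color G ` Z = {}"
  proof -
    have "color_length p (color G e) = 0" if "e \<in> Z" for e
      using color_length_edge[OF G, of e l] Z that by (auto simp: pG)
    then show ?thesis by (auto simp: support_def)
  qed
  then have "(adjacent s H B)\<^sup>+ = (adjacent s G B)\<^sup>+" if "B \<subseteq> support p" for B
    using that by (intro H(3)) blast
  then have "conns s H (support p) = conns s G (support p)"
    by (auto simp: conns_def)
  then show ?thesis using cl sup by (simp add: invariant_def pG q)
qed

lemma iso_identified_invariant: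
  assumes p: "p \<in> topspace (simplex_union s)" and pq: "iso_identified s p q"
  shows "invariant s p = invariant s q"
proof -
  obtain G l H m f h where pG: "p = (G, l)" and q: "q = (H, m)" and iso: "weighted_graph_iso s G H f h"
    and m: "\<And>e. e \<in> edges G \<Longrightarrow> m (h e) = l e"
    using pq unfolding iso_identified_def by blast
  have G: "is_weighted_graph s G" using p pG by (simp add: in_simplex_union)
  have h: "inj_on h (edges G)" "edges H = h ` edges G"
    and col: "\<And>e. e \<in> edges G \<Longrightarrow> color H (h e) = color G e"
    using iso by (auto simp: weighted_graph_iso_def bij_betw_def)
  have cl: "color_length q = color_length p"
  proof
    fix c
    have "{e. e \<in> edges H \<and> color H e = c} = h ` {e. e \<in> edges G \<and> color G e = c}"
      unfolding h(2) using col by auto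
    then have "color_length q c = (\<Sum>e\<in>h ` {e. e \<in> edges G \<and> color G e = c}. m e)"
      by (simp add: color_length_def q)
    also have "\<dots> = (\<Sum>e | e \<in> edges G \<and> color G e = c. m (h e))"
      by (subst sum.reindex) (auto intro: inj_on_subset[OF h(1)])
    also have "\<dots> = color_length p c"
      unfolding color_length_def pG by (intro sum.cong) (auto simp: m)
    finally show "color_length q c = color_length p c" .
  qed
  then have "support q = support p" by (simp add: support_def)
  then show ?thesis using cl weighted_graph_iso_invariants(2)[OF G iso] by (simp add: invariant_def pG q)
qed

text \<open>Normal form of a point: collapse all edges of length zero. They do not exhaust the edges
  because the lengths sum to 1.\<close>

lemma reduce_to_positive:
  assumes "(G, l) \<in> topspace (simplex_union s)"
  obtains H m where "(H, m) \<in> topspace (simplex_union s)" "face_identified (G, l) (H, m)"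
    "\<And>e. e \<in> edges H \<Longrightarrow> m e \<noteq> 0"
proof -
  have G: "is_weighted_graph s G" and l: "l \<in> topspace (metric_simplex G)"
    using assms by (auto simp: in_simplex_union)
  define Z where "Z = {e \<in> edges G. l e = 0}"
  have "Z \<noteq> edges G"
  proof
    assume "Z = edges G"
    then have "(\<Sum>e\<in>edges G. l e) = 0" by (intro sum.neutral) (auto simp: Z_def)
    then show False using l by (simp add: in_metric_simplex)
  qed
  then have Z: "Z \<subset> edges G" by (auto simp: Z_def)
  have fin: "finite (edges G)" by (rule weighted_graph_finite(2)[OF G])
  obtain H where GH: "collapses G Z H"
    using collapses_exists[OF _ G Z] fin by (auto simp: Z_def)
  have H: "is_weighted_graph s H" "edges H = edges G - Z" using collapses_properties[OF GH G] by auto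
  let ?m = "restrict l (edges G - Z)"
  have "sum ?m (edges H) = sum l (edges G - Z)" unfolding H by (intro sum.cong) auto
  also have "\<dots> = sum l (edges G)"
    using fin by (intro sum.mono_neutral_left) (auto simp: Z_def)
  finally have "?m \<in> topspace (metric_simplex H)" using l by (auto simp: in_metric_simplex H(2))
  then show ?thesis using that[of H ?m] H GH Z
    by (auto simp: in_simplex_union face_identified_def Z_def)
qed

text \<open>When all lengths are nonzero the support is the full set of edge colors, and the
  invariant contains everything that \<open>weighted_graph_iso_exists\<close> asks for.\<close>

lemma positive_same_invariant_iso:
  assumes p: "(G, l) \<in> topspace (simplex_union s)" "\<And>e. e \<in> edges G \<Longrightarrow> l e \<noteq> 0"
    and q: "(H, m) \<in> topspace (simplex_union s)" "\<And>e. e \<in> edges H \<Longrightarrow> m e \<noteq> 0"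
    and eq: "invariant s (G, l) = invariant s (H, m)"
  shows "iso_identified s (G, l) (H, m)"
proof -
  have G: "is_weighted_graph s G" and H: "is_weighted_graph s H"
    using p q by (auto simp: in_simplex_union)
  have cl: "color_length (G, l) = color_length (H, m)" using eq by (simp add: invariant_def)
  have sG: "support (G, l) = color G ` edges G"
    using support_subset[OF G] color_length_edge[OF G] p(2) by (auto simp: support_def)
  have sH: "support (H, m) = color H ` edges H"
    using support_subset[OF H] color_length_edge[OF H] q(2) by (auto simp: support_def)
  have col: "color G ` edges G = color H ` edges H"
    unfolding sG[symmetric] sH[symmetric] support_def cl ..
  have "conns s G (color G ` edges G) = conns s H (color G ` edges G)"
    using eq by (simp add: invariant_def sG sH col)
  then obtain f h where iso: "weighted_graph_iso s G H f h"
    using weighted_graph_iso_exists[OF G H col] by blast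
  have "m (h e) = l e" if "e \<in> edges G" for e
  proof -
    have "h e \<in> edges H" "color H (h e) = color G e"
      using iso that by (auto simp: weighted_graph_iso_def bij_betw_def)
    then show ?thesis
      using color_length_edge[OF G that, of l] color_length_edge[OF H, of "h e" m] cl by simp
  qed
  then show ?thesis using iso by (auto simp: iso_identified_def)
qed

text \<open>Both generating relations preserve the invariant. Conversely, three steps join points
  with the same invariant: a reduction to positive lengths on either side, and an isomorphism
  between the reduced points.\<close>

theorem identification_iff_invariant:
  assumes p: "p \<in> topspace (simplex_union s)"
  shows "(p, q) \<in> identification s \<longleftrightarrow> q \<in> topspace (simplex_union s) \<and> invariant s p = invariant s q"
proof -
  let ?r = "\<lambda>p q. p \<in> topspace (simplex_union s) \<and> q \<in> topspace (simplex_union s) \<and>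
                  (face_identified p q \<or> iso_identified s p q)"
  have r: "invariant s p = invariant s q" if "?r p q" for p q
    using that face_identified_invariant iso_identified_invariant by blast
  show ?thesis
  proof
    assume "(p, q) \<in> identification s"
    then have "equivclp ?r p q" by (simp add: identification_def)
    then show "q \<in> topspace (simplex_union s) \<and> invariant s p = invariant s q"
    proof (induction rule: equivclp_induct)
      case base
      then show ?case using p by simp
    next
      case (step y z)
      then show ?case using r[of y z] r[of z y] by auto
    qed
  next
    assume q: "q \<in> topspace (simplex_union s) \<and> invariant s p = invariant s q"
    obtain G l where pG: "p = (G, l)" by (cases p)
    obtain H m where qH: "q = (H, m)" by (cases q)
    obtain G' l' where G': "(G', l') \<in> topspace (simplex_union s)" "face_identified (G, l) (G', l')"
      "\<And>e. e \<in> edges G' \<Longrightarrow> l' e \<noteq> 0" using reduce_to_positive p pG by blast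
    obtain H' m' where H': "(H', m') \<in> topspace (simplex_union s)" "face_identified (H, m) (H', m')"
      "\<And>e. e \<in> edges H' \<Longrightarrow> m' e \<noteq> 0" using reduce_to_positive q qH by blast
    have "invariant s (G', l') = invariant s (H', m')"
      using face_identified_invariant[OF _ G'(2)] face_identified_invariant[OF _ H'(2)] p q pG qH by metis
    then have iso: "iso_identified s (G', l') (H', m')"
      using positive_same_invariant_iso G' H' by blast
    have "equivclp ?r p (G', l')" using G' p pG by (intro r_into_equivclp) auto
    moreover have "equivclp ?r (G', l') (H', m')" using G' H' iso by (intro r_into_equivclp) auto
    moreover have "equivclp ?r (H', m') q" using H' q qH by (intro converse_r_into_equivclp) auto
    ultimately have "equivclp ?r p q" by (meson equivclp_trans)
    then show "(p, q) \<in> identification s" using p by (simp add: identification_def)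
  qed
qed

section \<open>Verification of the cell structure\<close>

section \<open>The cells of the moduli space\<close>

text \<open>A finite stand-in for the isomorphism class of \<open>G\<close>: codes agree exactly for
  isomorphic graphs (\<open>cell_code_eq_iff_iso\<close>).\<close>

definition cell_code :: "nat \<Rightarrow> weighted_graph \<Rightarrow> nat set \<times> (nat set \<times> (nat + nat) \<times> (nat + nat)) set" where
  "cell_code s G = (color G ` edges G, conns s G (color G ` edges G))"

definition cell_codes :: "nat \<Rightarrow> (nat set \<times> (nat set \<times> (nat + nat) \<times> (nat + nat)) set) set" where
  "cell_codes s = cell_code s ` {G. is_weighted_graph s G}"

text \<open>Membership in a closed cell, phrased through the invariant alone: the colors of nonzero
  length span a face, and the separation data of \<open>p\<close> must be that of this face.\<close>

definition in_cell ::
  "nat \<Rightarrow> nat set \<times> (nat set \<times> (nat + nat) \<times> (nat + nat)) set \<Rightarrow> weighted_graph \<times> (nat \<Rightarrow> real) \<Rightarrow> bool" where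
  "in_cell s i p \<longleftrightarrow> support p \<subseteq> fst i \<and> conns s (fst p) (support p) = {t \<in> snd i. fst t \<subseteq> support p}"

definition point :: "nat \<Rightarrow> weighted_graph \<times> (nat \<Rightarrow> real) \<Rightarrow> (weighted_graph \<times> (nat \<Rightarrow> real)) set" where
  "point s p = identification s `` {p}"

definition closed_cell where
  "closed_cell s i = point s ` {p \<in> topspace (simplex_union s). in_cell s i p}"

text \<open>The representative is arbitrary, since color lengths are constant on equivalence classes
  (\<open>lengths_point\<close>).\<close>

definition lengths :: "(weighted_graph \<times> (nat \<Rightarrow> real)) set \<Rightarrow> nat \<Rightarrow> real" where
  "lengths x = color_length (SOME p. p \<in> x)"

lemma in_cell_invariant: "invariant s p = invariant s q \<Longrightarrow> in_cell s i p \<longleftrightarrow> in_cell s i q"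
proof -
  assume eq: "invariant s p = invariant s q"
  then have "support p = support q" by (simp add: invariant_def support_def)
  moreover from this have "conns s (fst p) (support q) = conns s (fst q) (support q)"
    using eq by (simp add: invariant_def)
  ultimately show ?thesis by (simp add: in_cell_def)
qed

lemma mem_point: "p \<in> topspace (simplex_union s) \<Longrightarrow>
    q \<in> point s p \<longleftrightarrow> q \<in> topspace (simplex_union s) \<and> invariant s p = invariant s q"
  by (simp add: point_def identification_iff_invariant)

lemma point_eq_iff:
  assumes "p \<in> topspace (simplex_union s)" "q \<in> topspace (simplex_union s)"
  shows "point s p = point s q \<longleftrightarrow> invariant s p = invariant s q"
  using assms mem_point by (metis subset_antisym subsetI)

lemma lengths_point:
  assumes "p \<in> topspace (simplex_union s)"
  shows "lengths (point s p) = color_length p"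
proof -
  have "(SOME q. q \<in> point s p) \<in> point s p"
    by (rule someI[where x = p]) (use assms mem_point in auto)
  then have "invariant s p = invariant s (SOME q. q \<in> point s p)" using mem_point[OF assms] by blast
  then show ?thesis by (simp add: lengths_def invariant_def)
qed

lemma point_in_closed_cell_iff:
  assumes "p \<in> topspace (simplex_union s)"
  shows "point s p \<in> closed_cell s i \<longleftrightarrow> in_cell s i p"
proof
  assume "point s p \<in> closed_cell s i"
  then obtain q where "q \<in> topspace (simplex_union s)" "in_cell s i q" "point s p = point s q"
    by (auto simp: closed_cell_def)
  then show "in_cell s i p" using point_eq_iff[OF assms] in_cell_invariant by blast
qed (use assms in \<open>auto simp: closed_cell_def\<close>)

lemma quotient_map_point: "quotient_map (simplex_union s) (MRG1 s) (point s)"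
  using quotient_map_quotient_space[of "simplex_union s" "identification s"]
  by (simp add: MRG1_def point_def[abs_def])

lemma topspace_MRG1: "topspace (MRG1 s) = point s ` topspace (simplex_union s)"
  using quotient_imp_surjective_map[OF quotient_map_point, of s] by simp

lemma finite_cell_codes: "finite (cell_codes s)"
proof (rule finite_subset)
  show "cell_codes s \<subseteq> Pow {1..s} \<times> Pow (Pow {1..s} \<times> items s \<times> items s)"
  proof
    fix i assume "i \<in> cell_codes s"
    then obtain G where G: "is_weighted_graph s G" "i = cell_code s G" by (auto simp: cell_codes_def)
    have "x \<in> items s" "y \<in> items s" if "(x, y) \<in> (adjacent s G B)\<^sup>+" for x y B
      using that by (induction rule: trancl_induct) (auto simp: adjacent_def)
    then show "i \<in> Pow {1..s} \<times> Pow (Pow {1..s} \<times> items s \<times> items s)"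
      using weighted_graph_color(2)[OF G(1)] by (auto simp: G(2) cell_code_def conns_def)
  qed
  show "finite (Pow {1..s} \<times> Pow (Pow {1..s} \<times> items s \<times> items s))"
    by (simp add: items_def)
qed

lemma continuous_map_color_length:
  "continuous_map (metric_simplex G) euclideanreal (\<lambda>l. color_length (G, l) c)"
proof (cases "finite {e \<in> edges G. color G e = c}")
  case True
  have "continuous_map (metric_simplex G) euclideanreal (\<lambda>l. l e)" if "e \<in> edges G" for e
    unfolding metric_simplex_def
    by (intro continuous_map_from_subtopology continuous_map_product_projection that)
  then show ?thesis
    using True unfolding color_length_def by (simp, intro continuous_map_sum) auto
qed (simp add: color_length_def)

lemma continuous_map_lengths: "continuous_map (MRG1 s) (powertop_real UNIV) lengths"
proof (rule continuous_compose_quotient_map[OF quotient_map_point])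
  have "continuous_map (simplex_union s) (powertop_real UNIV) color_length"
    unfolding continuous_map_componentwise_UNIV
  proof
    fix c
    show "continuous_map (simplex_union s) euclideanreal (\<lambda>p. color_length p c)"
      unfolding continuous_map_closedin
    proof (intro conjI allI impI)
      fix C :: "real set" assume "closedin euclideanreal C"
      then have "closedin (metric_simplex G) {l \<in> topspace (metric_simplex G). color_length (G, l) c \<in> C}" for G
        using continuous_map_color_length closedin_continuous_map_preimage by blast
      then show "closedin (simplex_union s) {p \<in> topspace (simplex_union s). color_length p c \<in> C}"
        by (auto simp: simplex_union_def closedin_sum_topology)
    qed auto
  qed
  then show "continuous_map (simplex_union s) (powertop_real UNIV) (lengths \<circ> point s)"
    by (rule continuous_map_eq) (simp add: lengths_point)
qed

text \<open>Closedness in the quotient is tested in every simplex. In the simplex of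
  \<open>G\<close> the preimage is a union of closed faces \<open>S A\<close>, finite in number
  because \<open>A\<close> ranges over subsets of the finite set \<open>P\<close>.\<close>

lemma closed_cell_closedin:
  assumes i: "i \<in> cell_codes s"
  shows "closedin (MRG1 s) (closed_cell s i)"
proof -
  obtain P K where PK: "i = (P, K)" by (cases i)
  have finP: "finite P"
    using i weighted_graph_finite(2) unfolding cell_codes_def cell_code_def PK by auto
  have "closedin (metric_simplex G) {l \<in> topspace (metric_simplex G). in_cell s i (G, l)}"
    if G: "is_weighted_graph s G" for G
  proof -
    define S where "S A = {l \<in> topspace (metric_simplex G). \<forall>e\<in>edges G. color G e \<notin> A \<longrightarrow> l e = 0}" for A
    have S_support: "l \<in> S A \<longleftrightarrow> support (G, l) \<subseteq> A" if "l \<in> topspace (metric_simplex G)" for l A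
    proof
      assume l: "l \<in> S A"
      show "support (G, l) \<subseteq> A"
      proof
        fix c assume c: "c \<in> support (G, l)"
        then obtain e where e: "e \<in> edges G" "c = color G e" using support_subset[OF G, of l] by auto
        then have "l e \<noteq> 0" using c color_length_edge[OF G e(1), of l] by (simp add: support_def)
        then show "c \<in> A" using l e by (auto simp: S_def)
      qed
    next
      assume "support (G, l) \<subseteq> A"
      then show "l \<in> S A"
        using color_length_edge[OF G, of _ l] that by (force simp: S_def support_def)
    qed
    have closed: "closedin (metric_simplex G) (S A)" for A
    proof -
      have cl: "closedin (metric_simplex G) {l \<in> topspace (metric_simplex G). l e \<in> {0}}" if "e \<in> edges G" for e
      proof (rule closedin_continuous_map_preimage)
        show "continuous_map (metric_simplex G) euclideanreal (\<lambda>l. l e)"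
          unfolding metric_simplex_def
          by (intro continuous_map_from_subtopology continuous_map_product_projection that)
      qed simp
      have "S A = \<Inter>(insert (topspace (metric_simplex G))
          ((\<lambda>e. {l \<in> topspace (metric_simplex G). l e \<in> {0}}) ` {e \<in> edges G. color G e \<notin> A}))"
        by (auto simp: S_def)
      moreover have "closedin (metric_simplex G) \<dots>"
        by (rule closedin_Inter) (use cl in auto)
      ultimately show ?thesis by simp
    qed
    \<comment> \<open>The color sets on which the data of \<open>G\<close> agrees with the code.
      Agreement on \<open>A\<close> passes to every smaller support, so the whole closed face is
      included.\<close>
    define \<A> where "\<A> = {A \<in> Pow P. conns s G A = {t \<in> K. fst t \<subseteq> A}}"
    have "{l \<in> topspace (metric_simplex G). in_cell s i (G, l)} = (\<Union>A\<in>\<A>. S A)"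
    proof (intro subset_antisym subsetI)
      fix l assume "l \<in> {l \<in> topspace (metric_simplex G). in_cell s i (G, l)}"
      then have "support (G, l) \<in> \<A>" "l \<in> S (support (G, l))"
        by (auto simp: in_cell_def PK \<A>_def S_support)
      then show "l \<in> (\<Union>A\<in>\<A>. S A)" by blast
    next
      fix l assume "l \<in> (\<Union>A\<in>\<A>. S A)"
      then obtain A where A: "A \<subseteq> P" "conns s G A = {t \<in> K. fst t \<subseteq> A}" "l \<in> S A"
        by (auto simp: \<A>_def)
      have l: "l \<in> topspace (metric_simplex G)" using A(3) by (simp add: S_def)
      have sup: "support (G, l) \<subseteq> A" using A(3) S_support[OF l] by simp
      have "conns s G (support (G, l)) = {t \<in> {t \<in> K. fst t \<subseteq> A}. fst t \<subseteq> support (G, l)}"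
        unfolding A(2)[symmetric] by (rule conns_restrict[OF sup, symmetric])
      also have "\<dots> = {t \<in> K. fst t \<subseteq> support (G, l)}" using sup by auto
      finally show "l \<in> {l \<in> topspace (metric_simplex G). in_cell s i (G, l)}"
        using sup A(1) l by (auto simp: in_cell_def PK)
    qed
    moreover have "closedin (metric_simplex G) (\<Union>A\<in>\<A>. S A)"
      by (rule closedin_Union) (use finP closed in \<open>auto simp: \<A>_def\<close>)
    ultimately show ?thesis by simp
  qed
  then have "closedin (simplex_union s) {p \<in> topspace (simplex_union s). in_cell s i p}"
    by (auto simp: simplex_union_def closedin_sum_topology)
  moreover have "{p \<in> topspace (simplex_union s). in_cell s i p}
      = {p \<in> topspace (simplex_union s). point s p \<in> closed_cell s i}"
    using point_in_closed_cell_iff by blast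
  moreover have "closed_cell s i \<subseteq> topspace (MRG1 s)" by (auto simp: closed_cell_def topspace_MRG1)
  ultimately show ?thesis
    using quotient_map_point[of s] unfolding quotient_map_closedin by simp
qed

text \<open>The inverse of \<open>lengths\<close> gives each edge of \<open>G\<close> the length of
  its color. It is continuous because it factors through the simplex of \<open>G\<close> and the
  quotient map.\<close>

lemma closed_cell_homeomorphic:
  assumes G: "is_weighted_graph s G"
  shows "homeomorphic_map (subtopology (MRG1 s) (closed_cell s (cell_code s G)))
           (simplex_top (color G ` edges G)) lengths"
proof -
  let ?P = "color G ` edges G" and ?i = "cell_code s G"
  define \<phi> where "\<phi> l = restrict (\<lambda>e. l (color G e)) (edges G)" for l :: "nat \<Rightarrow> real"
  have finP: "finite ?P" using weighted_graph_finite(2)[OF G] by simp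
  have \<phi>_simplex: "\<phi> l \<in> topspace (metric_simplex G)" if "l \<in> simplex_points ?P" for l
  proof -
    have "(\<Sum>e\<in>edges G. \<phi> l e) = (\<Sum>e\<in>edges G. l (color G e))" by (intro sum.cong) (auto simp: \<phi>_def)
    also have "\<dots> = sum l ?P" using weighted_graph_color(1)[OF G] by (simp add: sum.reindex)
    finally show ?thesis using that by (auto simp: in_metric_simplex simplex_points_def \<phi>_def)
  qed
  have cl\<phi>: "color_length (G, \<phi> l) = l" if "l \<in> simplex_points ?P" for l
  proof
    fix c show "color_length (G, \<phi> l) c = l c"
    proof (cases "c \<in> ?P")
      case True
      then show ?thesis using color_length_edge[OF G, of _ "\<phi> l"] by (auto simp: \<phi>_def)
    next
      case False
      then show ?thesis using color_length_outside[OF G] that by (simp add: simplex_points_def)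
    qed
  qed
  have \<phi>_top: "(G, \<phi> l) \<in> topspace (simplex_union s)" if "l \<in> simplex_points ?P" for l
    using \<phi>_simplex[OF that] G by (simp add: in_simplex_union)
  have in_cell_G: "in_cell s ?i (G, l)" for l
    using conns_restrict[OF support_subset[OF G]] support_subset[OF G] by (auto simp: in_cell_def cell_code_def)
  have "homeomorphic_maps (subtopology (MRG1 s) (closed_cell s ?i)) (simplex_top ?P) lengths (\<lambda>l. point s (G, \<phi> l))"
    unfolding homeomorphic_maps_def
  proof (intro conjI ballI)
    have "lengths x \<in> simplex_points ?P" if x: "x \<in> closed_cell s ?i" for x
    proof -
      obtain H m where p: "(H, m) \<in> topspace (simplex_union s)" "in_cell s ?i (H, m)" "x = point s (H, m)"
        using x by (auto simp: closed_cell_def)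
      have "color_length (H, m) \<in> simplex_points ?P"
        using p(2) finP by (intro color_length_simplex_support[OF p(1)]) (auto simp: in_cell_def cell_code_def)
      then show ?thesis using p by (simp add: lengths_point)
    qed
    then show "continuous_map (subtopology (MRG1 s) (closed_cell s ?i)) (simplex_top ?P) lengths"
      unfolding simplex_top_def continuous_map_in_subtopology
      using continuous_map_lengths by (auto intro: continuous_map_from_subtopology)
  next
    have "continuous_map (simplex_top ?P) (metric_simplex G) \<phi>"
      unfolding metric_simplex_def continuous_map_in_subtopology
    proof
      show "continuous_map (simplex_top ?P) (powertop_real (edges G)) \<phi>"
        unfolding continuous_map_componentwise
      proof (intro conjI ballI)
        show "\<phi> ` topspace (simplex_top ?P) \<subseteq> extensional (edges G)" by (auto simp: \<phi>_def)
        fix e assume e: "e \<in> edges G"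
        have "continuous_map (simplex_top ?P) euclideanreal (\<lambda>l. l (color G e))"
          unfolding simplex_top_def
          by (intro continuous_map_from_subtopology continuous_map_product_projection) simp
        then show "continuous_map (simplex_top ?P) euclideanreal (\<lambda>l. \<phi> l e)"
          using e by (simp add: \<phi>_def)
      qed
      show "\<phi> \<in> topspace (simplex_top ?P) \<rightarrow> {l. (\<forall>e\<in>edges G. 0 \<le> l e) \<and> (\<Sum>e\<in>edges G. l e) = 1}"
        using \<phi>_simplex by (auto simp: in_metric_simplex)
    qed
    moreover have "continuous_map (metric_simplex G) (simplex_union s) (Pair G)"
      unfolding simplex_union_def by (rule continuous_map_component_injection) (use G in simp)
    moreover have "continuous_map (simplex_union s) (MRG1 s) (point s)"
      by (rule quotient_imp_continuous_map[OF quotient_map_point])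
    ultimately have "continuous_map (simplex_top ?P) (MRG1 s) (point s \<circ> (Pair G \<circ> \<phi>))"
      by (intro continuous_map_compose)
    moreover have "point s (G, \<phi> l) \<in> closed_cell s ?i" if "l \<in> simplex_points ?P" for l
      using point_in_closed_cell_iff[OF \<phi>_top[OF that]] in_cell_G by blast
    ultimately show "continuous_map (simplex_top ?P) (subtopology (MRG1 s) (closed_cell s ?i)) (\<lambda>l. point s (G, \<phi> l))"
      by (auto simp: continuous_map_in_subtopology comp_def)
  next
    fix x assume "x \<in> topspace (subtopology (MRG1 s) (closed_cell s ?i))"
    then obtain H m where p: "(H, m) \<in> topspace (simplex_union s)" "in_cell s ?i (H, m)" "x = point s (H, m)"
      by (auto simp: closed_cell_def)
    define l where "l = lengths x"
    have l: "l = color_length (H, m)" unfolding l_def p(3) by (rule lengths_point[OF p(1)])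
    have ls: "l \<in> simplex_points ?P"
      unfolding l using p(2) finP
      by (intro color_length_simplex_support[OF p(1)]) (auto simp: in_cell_def cell_code_def)
    \<comment> \<open>\<open>x\<close> may come from another graph \<open>H\<close>. The point of
      \<open>G\<close> with the same lengths has the same support and, as \<open>x\<close> lies in
      the cell, the same separation data.\<close>
    have "color_length (G, \<phi> l) = color_length (H, m)" using cl\<phi>[OF ls] l by simp
    moreover from this have "support (G, \<phi> l) = support (H, m)" by (simp add: support_def)
    moreover have "conns s H (support (H, m)) = conns s G (support (H, m))"
      using p(2) conns_restrict[of "support (H, m)" ?P s G] by (simp add: in_cell_def cell_code_def)
    ultimately have "invariant s (G, \<phi> l) = invariant s (H, m)" by (simp add: invariant_def)
    then show "point s (G, \<phi> (lengths x)) = x"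
      using point_eq_iff[OF \<phi>_top[OF ls] p(1)] p(3) by (simp add: l_def)
  next
    fix l assume "l \<in> topspace (simplex_top ?P)"
    then have "l \<in> simplex_points ?P" by simp
    then show "lengths (point s (G, \<phi> l)) = l"
      using lengths_point[OF \<phi>_top] cl\<phi> by simp
  qed
  then show ?thesis using homeomorphic_map_maps by blast
qed

text \<open>Collapse the edges with colors outside \<open>A\<close>. Sets
  \<open>B \<subseteq> A\<close> avoid the collapsed colors, and \<open>A \<noteq> {}\<close> keeps
  at least one edge.\<close>

lemma cell_code_face:
  assumes G: "is_weighted_graph s G" and A: "A \<subseteq> color G ` edges G" "A \<noteq> {}"
  obtains H where "is_weighted_graph s H" "cell_code s H = (A, conns s G A)"
proof -
  define Z where "Z = {e \<in> edges G. color G e \<notin> A}"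
  have "Z \<subset> edges G" using A by (auto simp: Z_def)
  then obtain H where GH: "collapses G Z H"
    using collapses_exists[OF _ G, of Z] weighted_graph_finite(2)[OF G] by (auto simp: Z_def)
  have H: "is_weighted_graph s H" "edges H = edges G - Z" "color H = color G"
    "\<And>B. B \<inter> color G ` Z = {} \<Longrightarrow> (adjacent s H B)\<^sup>+ = (adjacent s G B)\<^sup>+"
    using collapses_properties[OF GH G] by auto
  have "color H ` edges H = A" unfolding H(2,3) using A by (auto simp: Z_def)
  moreover have "(adjacent s H B)\<^sup>+ = (adjacent s G B)\<^sup>+" if "B \<subseteq> A" for B
    using that by (intro H(4)) (auto simp: Z_def)
  then have "conns s H A = conns s G A" by (auto simp: conns_def)
  ultimately have "cell_code s H = (A, conns s G A)" by (simp add: cell_code_def)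
  then show ?thesis using that H(1) by blast
qed

theorem MRG1_simplicial_cells:
  "simplicial_cells (MRG1 s) (cell_codes s) (closed_cell s) fst lengths"
proof
  show "finite (cell_codes s)" by (rule finite_cell_codes)
  show "closedin (MRG1 s) (closed_cell s i)" if "i \<in> cell_codes s" for i
    by (rule closed_cell_closedin[OF that])
  fix i assume i: "i \<in> cell_codes s"
  then obtain G where G: "is_weighted_graph s G" and iG: "i = cell_code s G" by (auto simp: cell_codes_def)
  show "finite (fst i)" "fst i \<noteq> {}"
    using weighted_graph_finite(2)[OF G] weighted_graph_edges_nonempty[OF G] by (auto simp: iG cell_code_def)
  show "homeomorphic_map (subtopology (MRG1 s) (closed_cell s i)) (simplex_top (fst i)) lengths"
    using closed_cell_homeomorphic[OF G] by (simp add: iG cell_code_def)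
  show "\<exists>j\<in>cell_codes s. fst j = A \<and> closed_cell s j = {x \<in> closed_cell s i. \<forall>c. c \<notin> A \<longrightarrow> lengths x c = 0}"
    if A: "A \<subseteq> fst i" "A \<noteq> {}" for A
  proof -
    have AG: "A \<subseteq> color G ` edges G" using A by (simp add: iG cell_code_def)
    obtain H where H: "is_weighted_graph s H" "cell_code s H = (A, conns s G A)"
      using cell_code_face[OF G AG A(2)] by blast
    let ?j = "(A, conns s G A)"
    \<comment> \<open>For a point with support in \<open>A\<close>, the data of the face and that of
      the cell restrict to the same triples.\<close>
    have *: "in_cell s ?j p \<longleftrightarrow> in_cell s i p \<and> support p \<subseteq> A" for p
    proof (cases "support p \<subseteq> A")
      case True
      have "support p \<subseteq> color G ` edges G" using True AG by blast
      moreover have "{t \<in> conns s G A. fst t \<subseteq> support p} = {t \<in> conns s G (color G ` edges G). fst t \<subseteq> support p}"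
        using conns_restrict[OF True, of s G] conns_restrict[OF calculation, of s G] by simp
      ultimately show ?thesis using True by (simp add: in_cell_def iG cell_code_def)
    qed (simp add: in_cell_def)
    have "closed_cell s ?j = {x \<in> closed_cell s i. \<forall>c. c \<notin> A \<longrightarrow> lengths x c = 0}"
    proof -
      have "x \<in> closed_cell s ?j \<longleftrightarrow> x \<in> closed_cell s i \<and> (\<forall>c. c \<notin> A \<longrightarrow> lengths x c = 0)"
        if "x = point s p" "p \<in> topspace (simplex_union s)" for x p
        using that point_in_closed_cell_iff[OF that(2)] lengths_point[OF that(2)] *[of p]
        by (auto simp: support_def)
      then show ?thesis unfolding closed_cell_def by blast
    qed
    then show ?thesis using H by (intro bexI[of _ ?j]) (auto simp: cell_codes_def intro: rev_image_eqI)
  qed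
  fix j x assume j: "j \<in> cell_codes s" "fst i = fst j" "x \<in> closed_cell s i" "x \<in> closed_cell s j"
    "\<forall>c\<in>fst i. lengths x c \<noteq> 0"
  then obtain p where p: "p \<in> topspace (simplex_union s)" "in_cell s i p" "x = point s p"
    by (auto simp: closed_cell_def)
  have pj: "in_cell s j p" using j(4) p point_in_closed_cell_iff by simp
  have sup: "support p = fst i"
    using p(2) j(5) lengths_point[OF p(1)] p(3) by (auto simp: in_cell_def support_def)
  \<comment> \<open>The support of \<open>p\<close> is the full color set, so \<open>in_cell\<close>
    compares the complete second components of the two codes.\<close>
  have full: "{t \<in> snd k. fst t \<subseteq> fst k} = snd k" if "k \<in> cell_codes s" for k
    using that by (auto simp: cell_codes_def cell_code_def conns_def)
  have "snd i = snd j" using p(2) pj full[OF i] full[OF j(1)] sup j(2) by (simp add: in_cell_def)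
  then show "i = j" using j(2) by (simp add: prod_eq_iff)
qed

theorem euler_characteristic_MRG1:
  "has_finite_betti_numbers (MRG1 s)"
  "euler_characteristic (MRG1 s) = (\<Sum>i\<in>cell_codes s. (- 1) ^ (card (fst i) - 1))"
proof -
  interpret simplicial_cells "MRG1 s" "cell_codes s" "closed_cell s" fst lengths
    by (rule MRG1_simplicial_cells)
  have "topspace (MRG1 s) = (\<Union>i\<in>cell_codes s. closed_cell s i)"
  proof
    show "topspace (MRG1 s) \<subseteq> (\<Union>i\<in>cell_codes s. closed_cell s i)"
    proof
      fix x assume "x \<in> topspace (MRG1 s)"
      then obtain G l where p: "(G, l) \<in> topspace (simplex_union s)" "x = point s (G, l)"
        by (auto simp: topspace_MRG1)
      then have G: "is_weighted_graph s G" by (simp add: in_simplex_union)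
      have "in_cell s (cell_code s G) (G, l)"
        using conns_restrict[OF support_subset[OF G]] support_subset[OF G] by (auto simp: in_cell_def cell_code_def)
      then show "x \<in> (\<Union>i\<in>cell_codes s. closed_cell s i)"
        using p G point_in_closed_cell_iff[OF p(1)] by (auto simp: cell_codes_def)
    qed
  qed (use cell_subset in blast)
  then show "has_finite_betti_numbers (MRG1 s)"
    "euler_characteristic (MRG1 s) = (\<Sum>i\<in>cell_codes s. (- 1) ^ (card (fst i) - 1))"
    by (rule euler_characteristic_cells)+
qed

section \<open>Multinomial counting\<close>

section \<open>Compositions and functions with prescribed fibres\<close>

definition functions_with_fibres :: "'a set \<Rightarrow> 'b set \<Rightarrow> ('b \<Rightarrow> nat) \<Rightarrow> ('a \<Rightarrow> 'b) set" where
  "functions_with_fibres A J n = {f \<in> A \<rightarrow>\<^sub>E J. \<forall>j\<in>J. card {a \<in> A. f a = j} = n j}"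

lemma finite_functions_with_fibres: "finite A \<Longrightarrow> finite J \<Longrightarrow> finite (functions_with_fibres A J n)"
  by (rule finite_subset[of _ "A \<rightarrow>\<^sub>E J"]) (auto simp: functions_with_fibres_def finite_PiE)

lemma card_functions_with_fibres_insert:
  assumes "finite A" "finite J" "j \<notin> J"
  shows "card (functions_with_fibres A (insert j J) n)
    = (\<Sum>S | S \<subseteq> A \<and> card S = n j. card (functions_with_fibres (A - S) J n))"
proof -
  let ?D = "SIGMA S : {S. S \<subseteq> A \<and> card S = n j}. functions_with_fibres (A - S) J n"
  let ?to = "\<lambda>f. ({a \<in> A. f a = j}, restrict f (A - {a \<in> A. f a = j}))"
  let ?from = "\<lambda>(S, g). restrict (\<lambda>a. if a \<in> S then j else g a) A"
  have "bij_betw ?to (functions_with_fibres A (insert j J) n) ?D"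
  proof (rule bij_betw_byWitness[where f' = ?from])
    show "\<forall>f\<in>functions_with_fibres A (insert j J) n. ?from (?to f) = f"
      by (auto simp: functions_with_fibres_def PiE_def extensional_def fun_eq_iff)
    show "\<forall>p\<in>?D. ?to (?from p) = p"
    proof
      fix p assume "p \<in> ?D"
      then obtain S g where p: "p = (S, g)" "S \<subseteq> A" "g \<in> A - S \<rightarrow>\<^sub>E J" by (auto simp: functions_with_fibres_def)
      have "g a \<in> J" if "a \<in> A" "a \<notin> S" for a using p that by auto
      then have "{a \<in> A. ?from p a = j} = S" using p assms(3) by auto
      moreover have "restrict (?from p) (A - S) = g"
        using p by (auto simp: fun_eq_iff PiE_def extensional_def)
      ultimately show "?to (?from p) = p" unfolding p(1) by simp
    qed
    show "?to ` functions_with_fibres A (insert j J) n \<subseteq> ?D"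
    proof
      fix p assume "p \<in> ?to ` functions_with_fibres A (insert j J) n"
      then obtain f where f: "f \<in> functions_with_fibres A (insert j J) n" "p = ?to f" by auto
      have "{a \<in> A - {a \<in> A. f a = j}. restrict f (A - {a \<in> A. f a = j}) a = i} = {a \<in> A. f a = i}" if "i \<in> J" for i
        using that assms(3) by auto
      then show "p \<in> ?D" using f by (auto simp: functions_with_fibres_def PiE_def)
    qed
    show "?from ` ?D \<subseteq> functions_with_fibres A (insert j J) n"
    proof
      fix f assume "f \<in> ?from ` ?D"
      then obtain S g where S: "S \<subseteq> A" "card S = n j" and g: "g \<in> functions_with_fibres (A - S) J n"
        and f: "f = restrict (\<lambda>a. if a \<in> S then j else g a) A" by auto
      have gJ: "g a \<in> J" if "a \<in> A" "a \<notin> S" for a using g that by (auto simp: functions_with_fibres_def)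
      then have 1: "{a \<in> A. f a = j} = S" using S assms(3) by (auto simp: f)
      have 2: "{a \<in> A. f a = i} = {a \<in> A - S. g a = i}" if "i \<in> J" for i
        using that assms(3) S by (auto simp: f)
      have "f \<in> A \<rightarrow>\<^sub>E insert j J" using gJ by (auto simp: f)
      then show "f \<in> functions_with_fibres A (insert j J) n"
        using 1 2 S g by (auto simp: functions_with_fibres_def)
    qed
  qed
  then have "card (functions_with_fibres A (insert j J) n) = card ?D" by (rule bij_betw_same_card)
  also have "\<dots> = (\<Sum>S | S \<subseteq> A \<and> card S = n j. card (functions_with_fibres (A - S) J n))"
    using assms by (intro card_SigmaI) (auto intro: finite_functions_with_fibres)
  finally show ?thesis .
qed

text \<open>The multinomial coefficient in product form: choosing the fibre over \<open>j\<close>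
  contributes a binomial coefficient, and the rest is a function on the complement.\<close>

theorem card_functions_with_fibres:
  assumes "finite J" "finite A" "sum n J = card A"
  shows "card (functions_with_fibres A J n) * (\<Prod>j\<in>J. fact (n j)) = fact (card A)"
  using assms
proof (induction J arbitrary: A rule: finite_induct)
  case empty
  then have "functions_with_fibres A {} n = {\<lambda>x. undefined}" by (auto simp: functions_with_fibres_def)
  then show ?case using empty by simp
next
  case (insert j J)
  have le: "n j \<le> card A" using insert by simp
  have IH: "card (functions_with_fibres (A - S) J n) * (\<Prod>j\<in>J. fact (n j)) = fact (card A - n j)"
    if "S \<subseteq> A" "card S = n j" for S
  proof -
    have "card (A - S) = card A - n j" using that insert.prems finite_subset[OF that(1)] by (simp add: card_Diff_subset)
    then show ?thesis using insert.IH[of "A - S"] insert by simp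
  qed
  have "card (functions_with_fibres A (insert j J) n) * (\<Prod>j\<in>insert j J. fact (n j))
      = fact (n j) * (\<Sum>S | S \<subseteq> A \<and> card S = n j. card (functions_with_fibres (A - S) J n) * (\<Prod>j\<in>J. fact (n j)))"
    using insert by (simp add: card_functions_with_fibres_insert sum_distrib_right sum_distrib_left ac_simps)
  also have "\<dots> = fact (n j) * (\<Sum>S | S \<subseteq> A \<and> card S = n j. fact (card A - n j))"
    using IH by simp
  also have "\<dots> = fact (n j) * ((card A choose n j) * fact (card A - n j))"
    using insert by (simp add: n_subsets)
  also have "\<dots> = fact (card A)" using binomial_fact_lemma[OF le] by (simp add: ac_simps)
  finally show ?case .
qed

definition compositions :: "nat \<Rightarrow> nat \<Rightarrow> nat list set" where
  "compositions k s = {J. length J = k \<and> (\<forall>i\<in>set J. 1 \<le> i) \<and> sum_list J = s}"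

lemma finite_compositions: "finite (compositions k s)"
proof (rule finite_subset)
  show "compositions k s \<subseteq> {I. set I \<subseteq> {..s} \<and> length I = k}"
    by (auto simp: compositions_def dest: member_le_sum_list)
qed (rule finite_lists_length_eq, simp)

lemma of_nat_mult_prod_fact:
  assumes "a * (\<Prod>j\<in>J. fact (n j)) = (fact m :: nat)"
  shows "real a * (\<Prod>j\<in>J. fact (n j)) = fact m"
  using arg_cong[OF assms, of real] by (simp only: of_nat_mult of_nat_prod of_nat_fact)

lemma card_permutations_g_coeff: "real (card (permutations_of_multiset (mset I))) = g_coeff I"
proof -
  have "count (mset I) n = card {l. l < length I \<and> I ! l = n}" for n
    unfolding count_mset count_list_eq_length_filter length_filter_conv_card by (rule arg_cong[where f = card]) auto
  then have "card (permutations_of_multiset (mset I)) * (\<Prod>n\<in>set I. fact (card {l. l < length I \<and> I ! l = n}))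
      = fact (length I)"
    using card_permutations_of_multiset_aux[of "mset I"] by simp
  then have "real (card (permutations_of_multiset (mset I))) * (\<Prod>n\<in>set I. fact (card {l. l < length I \<and> I ! l = n}))
      = fact (length I)"
    by (intro of_nat_mult_prod_fact) simp
  moreover have "(\<Prod>n\<in>set I. fact (card {l. l < length I \<and> I ! l = n}) :: real) \<noteq> 0" by simp
  ultimately show ?thesis unfolding g_coeff_def by (simp only: eq_divide_eq) simp
qed

text \<open>The summand is symmetric in the entries, so compositions are grouped by their sorted
  form. A group consists of all rearrangements of one list, and \<open>g_coeff\<close> is their
  number.\<close>

lemma sum_compositions:
  fixes \<phi> :: "nat \<Rightarrow> real"
  shows "(\<Sum>J\<in>compositions k s. 1 / (\<Prod>n<k. \<phi> (J ! n)))
    = (\<Sum>I\<in>increasing_compositions k s. g_coeff I / (\<Prod>n<k. \<phi> (I ! n)))"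
proof -
  have prod: "(\<Prod>n<k. \<phi> (J ! n)) = prod_mset (image_mset \<phi> (mset J))" if "length J = k" for J
  proof -
    have "(\<Prod>n<k. \<phi> (J ! n)) = prod_list (map \<phi> J)"
      using that by (simp add: prod.list_conv_set_nth atLeast0LessThan)
    also have "\<dots> = prod_mset (mset (map \<phi> J))" by (rule prod_mset_prod_list[symmetric])
    finally show ?thesis by simp
  qed
  have "(\<Sum>J\<in>compositions k s. 1 / (\<Prod>n<k. \<phi> (J ! n)))
      = (\<Sum>I\<in>increasing_compositions k s. \<Sum>J | J \<in> compositions k s \<and> sort J = I. 1 / (\<Prod>n<k. \<phi> (J ! n)))"
  proof (rule sum.group[symmetric])
    show "sort ` compositions k s \<subseteq> increasing_compositions k s"
    proof
      fix I assume "I \<in> sort ` compositions k s"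
      then obtain J where "J \<in> compositions k s" "I = sort J" by auto
      moreover have "sum_list (sort J) = sum_list J" by (metis mset_sort sum_mset_sum_list)
      ultimately show "I \<in> increasing_compositions k s"
        by (auto simp: compositions_def increasing_compositions_def)
    qed
  qed (rule finite_compositions finite_increasing_compositions)+
  also have "\<dots> = (\<Sum>I\<in>increasing_compositions k s. g_coeff I / (\<Prod>n<k. \<phi> (I ! n)))"
  proof (rule sum.cong[OF refl])
    fix I assume I: "I \<in> increasing_compositions k s"
    then have len: "length I = k" and srt: "sorted I" by (auto simp: increasing_compositions_def)
    have "{J. J \<in> compositions k s \<and> sort J = I} = permutations_of_multiset (mset I)"
    proof (intro subset_antisym subsetI)
      fix J assume "J \<in> {J. J \<in> compositions k s \<and> sort J = I}"
      then show "J \<in> permutations_of_multiset (mset I)"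
        by (auto simp: permutations_of_multiset_def)
    next
      fix J assume "J \<in> permutations_of_multiset (mset I)"
      then have eq: "mset J = mset I" by (simp add: permutations_of_multiset_def)
      then have "sort J = I" using srt by (metis properties_for_sort)
      moreover have "length J = length I" "set J = set I" "sum_list J = sum_list I"
        using mset_eq_length[OF eq] mset_eq_setD[OF eq] eq by (auto simp flip: sum_mset_sum_list)
      ultimately show "J \<in> {J. J \<in> compositions k s \<and> sort J = I}"
        using I by (auto simp: compositions_def increasing_compositions_def)
    qed
    then have "(\<Sum>J | J \<in> compositions k s \<and> sort J = I. 1 / (\<Prod>n<k. \<phi> (J ! n)))
        = (\<Sum>J\<in>permutations_of_multiset (mset I). 1 / (\<Prod>n<k. \<phi> (I ! n)))"
    proof (rule sum.cong)
      fix J assume "J \<in> permutations_of_multiset (mset I)"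
      then have "mset J = mset I" by (simp add: permutations_of_multiset_def)
      then show "1 / (\<Prod>n<k. \<phi> (J ! n)) = 1 / (\<Prod>n<k. \<phi> (I ! n))"
        using prod[of J] prod[of I] len mset_eq_length[of J I] by simp
    qed
    also have "\<dots> = g_coeff I / (\<Prod>n<k. \<phi> (I ! n))"
      by (simp add: card_permutations_g_coeff)
    finally show "(\<Sum>J | J \<in> compositions k s \<and> sort J = I. 1 / (\<Prod>n<k. \<phi> (J ! n)))
        = g_coeff I / (\<Prod>n<k. \<phi> (I ! n))" .
  qed
  finally show ?thesis .
qed

section \<open>The dihedral group acting on vertices and edges\<close>

section \<open>Automorphisms of the cycle\<close>

text \<open>Vertices and edges are permuted by separate maps because for \<open>k = 2\<close> both
  edges have the same ends, and the action on vertices does not determine that on edges. Extensional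
  functions make each automorphism count once.\<close>

definition cycle_auts :: "nat \<Rightarrow> ((nat \<Rightarrow> nat) \<times> (nat \<Rightarrow> nat)) set" where
  "cycle_auts k = {(\<alpha>, \<beta>). \<alpha> \<in> extensional {..<k} \<and> \<beta> \<in> extensional {..<k} \<and>
     bij_betw \<alpha> {..<k} {..<k} \<and> bij_betw \<beta> {..<k} {..<k} \<and>
     (\<forall>j<k. {\<beta> j, (\<beta> j + 1) mod k} = \<alpha> ` {j, (j + 1) mod k})}"

text \<open>The ends of an edge form a set, so reversing a loop is not a separate automorphism. This
  order 1 in place of 2 is the source of \<open>1 + of_bool (k = 1)\<close> in the formula.\<close>

lemma card_cycle_auts_1: "card (cycle_auts 1) = 1"
proof -
  have "cycle_auts 1 = {(restrict (\<lambda>_. 0) {..<1}, restrict (\<lambda>_. 0) {..<1})}"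
    by (auto simp: cycle_auts_def bij_betw_def lessThan_Suc extensional_def fun_eq_iff)
  then show ?thesis by simp
qed

lemma Suc_mod_inj: "x < k \<Longrightarrow> y < k \<Longrightarrow> (x + 1) mod k = (y + 1) mod k \<longleftrightarrow> x = (y :: nat)"
  by (auto simp: mod_Suc split: if_splits)

context
  fixes k :: nat
  assumes k: "k \<ge> 2"
begin

context
  fixes \<alpha> \<beta>
  assumes aut: "(\<alpha>, \<beta>) \<in> cycle_auts k"
begin

lemma cycle_aut_less: "j < k \<Longrightarrow> \<alpha> j < k" "j < k \<Longrightarrow> \<beta> j < k"
  using aut by (auto simp: cycle_auts_def bij_betw_def)

lemma cycle_aut_inj: "i < k \<Longrightarrow> j < k \<Longrightarrow> \<alpha> i = \<alpha> j \<longleftrightarrow> i = j" "i < k \<Longrightarrow> j < k \<Longrightarrow> \<beta> i = \<beta> j \<longleftrightarrow> i = j"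
  using aut by (auto simp: cycle_auts_def bij_betw_def inj_on_def)

lemma cycle_aut_edge: "j < k \<Longrightarrow> {\<beta> j, (\<beta> j + 1) mod k} = {\<alpha> j, \<alpha> ((j + 1) mod k)}"
  using aut by (auto simp: cycle_auts_def)

text \<open>Edge \<open>j\<close> joins \<open>j\<close> and \<open>j + 1\<close> modulo
  \<open>k\<close>. The hypothesis says that edge 0 goes to the edge starting at the image of vertex
  0, so orientation is kept there, and this propagates along the cycle.\<close>

lemma cycle_aut_rotation:
  assumes "\<beta> 0 = \<alpha> 0" "j < k"
  shows "\<alpha> j = (\<alpha> 0 + j) mod k \<and> \<beta> j = \<alpha> j"
  using assms(2)
proof (induction j)
  case 0
  then show ?case using assms(1) cycle_aut_less by simp
next
  case (Suc j)
  then have IH: "\<alpha> j = (\<alpha> 0 + j) mod k" "\<beta> j = \<alpha> j" by auto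
  have "\<alpha> (Suc j) \<noteq> \<alpha> j" using cycle_aut_inj(1)[of "Suc j" j] Suc.prems by simp
  then have 1: "\<alpha> (Suc j) = (\<alpha> j + 1) mod k"
    using cycle_aut_edge[of j] Suc IH by (auto simp: doubleton_eq_iff)
  have "\<alpha> (Suc j) = \<beta> (Suc j) \<or> \<alpha> (Suc j) = (\<beta> (Suc j) + 1) mod k"
    using cycle_aut_edge[of "Suc j"] Suc by (auto simp: doubleton_eq_iff)
  \<comment> \<open>Otherwise the edges \<open>j\<close> and \<open>Suc j\<close> would have the
    same image.\<close>
  moreover have "\<alpha> (Suc j) \<noteq> (\<beta> (Suc j) + 1) mod k"
  proof
    assume "\<alpha> (Suc j) = (\<beta> (Suc j) + 1) mod k"
    then have "(\<beta> j + 1) mod k = (\<beta> (Suc j) + 1) mod k" using 1 IH(2) by simp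
    then have "\<beta> j = \<beta> (Suc j)"
      using Suc_mod_inj[OF cycle_aut_less(2) cycle_aut_less(2), of j "Suc j"] Suc.prems by simp
    then show False using cycle_aut_inj(2)[of j "Suc j"] Suc.prems by simp
  qed
  ultimately have "\<beta> (Suc j) = \<alpha> (Suc j)" by simp
  moreover have "\<alpha> (Suc j) = (\<alpha> 0 + Suc j) mod k" unfolding 1 IH(1) by (simp add: mod_Suc_eq)
  ultimately show ?case by simp
qed

text \<open>The orientation reversing case: \<open>(\<alpha> j + j) mod k = \<alpha> 0\<close>
  expresses \<open>\<alpha> j = \<alpha> 0 - j\<close> modulo \<open>k\<close> without subtraction,
  and the image of edge \<open>j\<close> ends at the image of vertex \<open>j\<close> where before
  it started there.\<close>

lemma cycle_aut_reflection:
  assumes "\<beta> 0 \<noteq> \<alpha> 0" "j < k"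
  shows "(\<alpha> j + j) mod k = \<alpha> 0 \<and> (\<beta> j + 1) mod k = \<alpha> j"
  using assms(2)
proof (induction j)
  case 0
  then show ?case using assms(1) cycle_aut_less cycle_aut_edge[of 0] by (auto simp: doubleton_eq_iff)
next
  case (Suc j)
  then have IH: "(\<alpha> j + j) mod k = \<alpha> 0" "(\<beta> j + 1) mod k = \<alpha> j" by auto
  have "\<alpha> (Suc j) \<noteq> \<alpha> j" using cycle_aut_inj(1)[of "Suc j" j] Suc.prems by simp
  then have 1: "\<alpha> (Suc j) = \<beta> j"
    using cycle_aut_edge[of j] Suc IH by (auto simp: doubleton_eq_iff)
  have "\<alpha> (Suc j) = \<beta> (Suc j) \<or> \<alpha> (Suc j) = (\<beta> (Suc j) + 1) mod k"
    using cycle_aut_edge[of "Suc j"] Suc by (auto simp: doubleton_eq_iff)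
  moreover have "\<alpha> (Suc j) \<noteq> \<beta> (Suc j)"
    using 1 cycle_aut_inj(2)[of j "Suc j"] Suc by auto
  ultimately have "(\<beta> (Suc j) + 1) mod k = \<alpha> (Suc j)" by simp
  moreover have "(\<alpha> (Suc j) + Suc j) mod k = \<alpha> 0"
    unfolding 1 IH(1)[symmetric] IH(2)[symmetric] by (simp add: mod_add_left_eq)
  ultimately show ?case by simp
qed

end

text \<open>An automorphism is determined by the image of vertex 0 and one bit for the orientation.
  The bit compares the images of edge 0 and vertex 0, so it is meaningful even for
  \<open>k = 2\<close>, where vertices alone cannot detect it.\<close>

theorem card_cycle_auts: "card (cycle_auts k) = 2 * k"
proof -
  let ?m = "\<lambda>(\<alpha>, \<beta>). (\<alpha> 0, \<beta> 0 = \<alpha> 0) :: nat \<times> bool"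
  have add_inj: "a = b" if "(a + j) mod k = (b + j) mod k" "a < k" "b < k" for a b j
  proof -
    have "bij_betw (\<lambda>i. (i + j) mod k) {..<k} {..<k}" using k by (intro bij_betw_add_mod) simp
    from inj_onD[OF bij_betw_imp_inj_on[OF this] that(1)] show ?thesis using that by simp
  qed
  have "bij_betw ?m (cycle_auts k) ({..<k} \<times> UNIV)"
    unfolding bij_betw_def
  proof
    show "inj_on ?m (cycle_auts k)"
    proof (rule inj_onI)
      fix p q assume p: "p \<in> cycle_auts k" and q: "q \<in> cycle_auts k" and eq: "?m p = ?m q"
      obtain \<alpha> \<beta> where pp: "p = (\<alpha>, \<beta>)" by (cases p)
      obtain \<gamma> \<delta> where qq: "q = (\<gamma>, \<delta>)" by (cases q)
      have p': "(\<alpha>, \<beta>) \<in> cycle_auts k" and q': "(\<gamma>, \<delta>) \<in> cycle_auts k" using p q pp qq by auto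
      have e0: "\<alpha> 0 = \<gamma> 0" "\<beta> 0 = \<alpha> 0 \<longleftrightarrow> \<delta> 0 = \<gamma> 0" using eq pp qq by auto
      have "\<alpha> j = \<gamma> j \<and> \<beta> j = \<delta> j" if j: "j < k" for j
      proof (cases "\<beta> 0 = \<alpha> 0")
        case True
        then show ?thesis using cycle_aut_rotation[OF p' _ j] cycle_aut_rotation[OF q' _ j] e0 by simp
      next
        case False
        then have 1: "(\<alpha> j + j) mod k = \<alpha> 0 \<and> (\<beta> j + 1) mod k = \<alpha> j"
          "(\<gamma> j + j) mod k = \<gamma> 0 \<and> (\<delta> j + 1) mod k = \<gamma> j"
          using cycle_aut_reflection[OF p' _ j] cycle_aut_reflection[OF q' _ j] e0 by auto
        then have "\<alpha> j = \<gamma> j"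
          using add_inj[of "\<alpha> j" j "\<gamma> j"] e0 cycle_aut_less[OF p' j] cycle_aut_less[OF q' j] by simp
        moreover from this have "\<beta> j = \<delta> j"
          using 1 Suc_mod_inj[of "\<beta> j" k "\<delta> j"] cycle_aut_less[OF p' j] cycle_aut_less[OF q' j] by simp
        ultimately show ?thesis by simp
      qed
      moreover have "\<alpha> \<in> extensional {..<k}" "\<beta> \<in> extensional {..<k}" "\<gamma> \<in> extensional {..<k}" "\<delta> \<in> extensional {..<k}"
        using p' q' by (auto simp: cycle_auts_def)
      ultimately have "\<alpha> = \<gamma>" "\<beta> = \<delta>" by (auto intro: extensionalityI)
      then show "p = q" using pp qq by simp
    qed
    show "?m ` cycle_auts k = {..<k} \<times> UNIV"
    proof
      show "?m ` cycle_auts k \<subseteq> {..<k} \<times> UNIV" using cycle_aut_less k by auto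
      show "{..<k} \<times> UNIV \<subseteq> ?m ` cycle_auts k"
      proof
        fix z :: "nat \<times> bool" assume "z \<in> {..<k} \<times> UNIV"
        then obtain m b where z: "z = (m, b)" "m < k" by auto
        have rot: "bij_betw (\<lambda>i. (i + j) mod k) {..<k} {..<k}" for j using k by (intro bij_betw_add_mod) simp
        show "z \<in> ?m ` cycle_auts k"
        proof (cases b)
          case True
          let ?a = "restrict (\<lambda>i. (i + m) mod k) {..<k}"
          have "((i + m) mod k + 1) mod k = ((i + 1) mod k + m) mod k" for i
            by (simp only: mod_add_left_eq) (simp add: ac_simps)
          then have "(?a, ?a) \<in> cycle_auts k"
            using rot[of m] k by (auto simp: cycle_auts_def)
          moreover have "z = ?m (?a, ?a)" using z True k by simp
          ultimately show ?thesis by (rule rev_image_eqI)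
        next
          case False
          let ?r = "\<lambda>i. (k - 1 - i)"
          have r: "bij_betw ?r {..<k} {..<k}"
            by (rule bij_betw_byWitness[where f' = ?r]) (use k in auto)
          \<comment> \<open>Modulo \<open>k\<close> these are \<open>m - i\<close> on vertices and
            \<open>m - 1 - i\<close> on edges: the image of edge \<open>i\<close> joins
            \<open>m - 1 - i\<close> and \<open>m - i\<close>.\<close>
          let ?a = "restrict (\<lambda>i. (?r i + (m + 1)) mod k) {..<k}"
          let ?b = "restrict (\<lambda>i. (?r i + m) mod k) {..<k}"
          have e1: "((?r i + m) mod k + 1) mod k = (?r i + (m + 1)) mod k" for i
            by (simp only: mod_add_left_eq) (simp add: ac_simps)
          have e2: "(?r i + m) mod k = (?r ((i + 1) mod k) + (m + 1)) mod k" if "i < k" for i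
          proof (cases "i + 1 = k")
            case True
            then have "?r ((i + 1) mod k) + (m + 1) = k + m" "?r i = 0" using k by auto
            then have "(?r ((i + 1) mod k) + (m + 1)) mod k = m mod k" "(?r i + m) mod k = m mod k"
              by (simp_all only: mod_add_self1 add_0)
            then show ?thesis by (simp only:)
          next
            case False
            then have "?r ((i + 1) mod k) + (m + 1) = ?r i + m" using that by simp
            then show ?thesis by (simp only:)
          qed
          have "{(?r i + m) mod k, ((?r i + m) mod k + 1) mod k}
              = {(?r i + (m + 1)) mod k, (?r ((i + 1) mod k) + (m + 1)) mod k}" if "i < k" for i
            unfolding e1 unfolding e2[OF that] by (rule insert_commute)
          then have "\<forall>j<k. {?b j, (?b j + 1) mod k} = ?a ` {j, (j + 1) mod k}"
            using k by simp
          moreover have "bij_betw ?a {..<k} {..<k}" "bij_betw ?b {..<k} {..<k}"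
            using bij_betw_trans[OF r rot[of m]] bij_betw_trans[OF r rot[of "m + 1"]]
            unfolding bij_betw_restrict_eq comp_def by simp_all
          ultimately have "(?a, ?b) \<in> cycle_auts k"
            unfolding cycle_auts_def by blast
          moreover have "z = ?m (?a, ?b)"
          proof -
            have "(k - 1 + m) mod k \<noteq> m"
            proof
              assume "(k - 1 + m) mod k = m"
              then have "((k - 1) + m) mod k = (0 + m) mod k" using z by simp
              then show False using add_inj[of "k - 1" m 0] k by simp
            qed
            moreover have "(k - 1 + (m + 1)) mod k = m" using z k by simp
            ultimately show ?thesis using z False k by simp
          qed
          ultimately show ?thesis by (rule rev_image_eqI)
        qed
      qed
    qed
  qed
  then have "card (cycle_auts k) = card ({..<k} \<times> (UNIV :: bool set))" by (rule bij_betw_same_card)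
  then show ?thesis by (simp add: card_cartesian_product)
qed

end

section \<open>Orbit counting and the final formula\<close>

section \<open>Counting the cells\<close>

text \<open>
  \<open>f\<close> maps each leg to its vertex; \<open>g\<close> maps each color to \<open>Inl j\<close> if it belongs to the weight of
  vertex \<open>j\<close> and to \<open>Inr j\<close> if it is the color of edge \<open>j\<close>.
\<close>

definition configs :: "nat \<Rightarrow> nat \<Rightarrow> ((nat \<Rightarrow> nat) \<times> (nat \<Rightarrow> nat + nat)) set" where
  "configs s k = {(f, g). f \<in> {1..s} \<rightarrow>\<^sub>E {..<k} \<and> g \<in> {1..s} \<rightarrow>\<^sub>E ({..<k} <+> {..<k}) \<and>
     (\<forall>j<k. {i \<in> {1..s}. f i = j} \<noteq> {} \<and>
        card {c \<in> {1..s}. g c = Inl j} = card {i \<in> {1..s}. f i = j} - 1 \<and>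
        card {c \<in> {1..s}. g c = Inr j} = 1)}"

definition config_graph :: "nat \<Rightarrow> nat \<Rightarrow> (nat \<Rightarrow> nat) \<times> (nat \<Rightarrow> nat + nat) \<Rightarrow> weighted_graph" where
  "config_graph s k q =
     \<lparr>verts = {..<k}, edges = {..<k}, ends = (\<lambda>j. {j, (j + 1) mod k}), leg = fst q,
      color = (\<lambda>j. THE c. c \<in> {1..s} \<and> snd q c = Inr j),
      weight = (\<lambda>j. {c \<in> {1..s}. snd q c = Inl j})\<rparr>"

lemma sum_card_fibres:
  assumes "finite A" "finite J" "f \<in> A \<rightarrow> J"
  shows "(\<Sum>j\<in>J. card {a \<in> A. f a = j}) = card A"
  using sum.group[of A J f "\<lambda>_. 1 :: nat"] assms by auto

lemma finite_configs: "finite (configs s k)"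
proof (rule finite_subset)
  show "configs s k \<subseteq> ({1..s} \<rightarrow>\<^sub>E {..<k}) \<times> ({1..s} \<rightarrow>\<^sub>E ({..<k} <+> {..<k}))"
    by (auto simp: configs_def)
qed (auto intro!: finite_PiE)

text \<open>Group by the composition \<open>J\<close> of leg numbers. Legs are distributed with
  fibres \<open>J ! j\<close>, colors with fibres \<open>J ! j - 1\<close> for the weights and 1 for
  each edge; these also sum to \<open>s\<close>. Each count is a multinomial coefficient, hence the
  factor \<open>(fact s)\<^sup>2\<close>.\<close>

lemma card_configs:
  "real (card (configs s k)) =
     (fact s)\<^sup>2 * (\<Sum>J\<in>compositions k s. 1 / (\<Prod>n<k. fact (J ! n) * fact (J ! n - 1)))"
proof -
  define F where "F J = functions_with_fibres {1..s} {..<k} (\<lambda>j. J ! j)" for J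
  define H where "H J = functions_with_fibres {1..s} ({..<k} <+> {..<k}) (case_sum (\<lambda>j. J ! j - 1) (\<lambda>j. 1))" for J
  have un: "configs s k = (\<Union>J\<in>compositions k s. F J \<times> H J)"
  proof (intro subset_antisym subsetI)
    fix q assume q: "q \<in> configs s k"
    obtain f g where fg: "q = (f, g)" by (cases q)
    define J where "J = map (\<lambda>j. card {i \<in> {1..s}. f i = j}) [0..<k]"
    have f: "f \<in> {1..s} \<rightarrow>\<^sub>E {..<k}" using q by (auto simp: fg configs_def)
    have "sum_list J = (\<Sum>j<k. card {i \<in> {1..s}. f i = j})"
      by (simp add: J_def sum_list_distinct_conv_sum_set atLeast0LessThan)
    also have "\<dots> = s" using sum_card_fibres[of "{1..s}" "{..<k}" f] f by auto
    finally have "J \<in> compositions k s"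
      using q by (auto simp: J_def compositions_def fg configs_def card_gt_0_iff Suc_le_eq)
    moreover have "q \<in> F J \<times> H J"
      using q by (auto simp: fg configs_def F_def H_def functions_with_fibres_def J_def)
    ultimately show "q \<in> (\<Union>J\<in>compositions k s. F J \<times> H J)" by blast
  next
    fix q assume "q \<in> (\<Union>J\<in>compositions k s. F J \<times> H J)"
    then obtain J f g where J: "J \<in> compositions k s" and q: "q = (f, g)" "f \<in> F J" "g \<in> H J" by auto
    have "1 \<le> J ! j" if "j < k" for j using J that by (auto simp: compositions_def)
    then have "{i \<in> {1..s}. f i = j} \<noteq> {}" if "j < k" for j
    proof -
      have "card {i \<in> {1..s}. f i = j} \<ge> 1"
        using q(2) that \<open>\<And>j. j < k \<Longrightarrow> 1 \<le> J ! j\<close> by (auto simp: F_def functions_with_fibres_def)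
      then show ?thesis by (metis card.empty not_one_le_zero)
    qed
    moreover have "card {c \<in> {1..s}. g c = Inl j} = J ! j - 1" "card {c \<in> {1..s}. g c = Inr j} = 1"
      "card {i \<in> {1..s}. f i = j} = J ! j" if "j < k" for j
      using q that by (auto simp: F_def H_def functions_with_fibres_def InlI InrI)
    ultimately show "q \<in> configs s k"
      using q(2,3) by (auto simp: q(1) configs_def F_def H_def functions_with_fibres_def)
  qed
  have "card (configs s k) = (\<Sum>J\<in>compositions k s. card (F J \<times> H J))"
    unfolding un
  proof (rule card_UN_disjoint)
    show "finite (compositions k s)" by (rule finite_compositions)
    show "\<forall>J\<in>compositions k s. finite (F J \<times> H J)"
      by (auto simp: F_def H_def intro!: finite_functions_with_fibres)
    show "\<forall>I\<in>compositions k s. \<forall>J\<in>compositions k s. I \<noteq> J \<longrightarrow> (F I \<times> H I) \<inter> (F J \<times> H J) = {}"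
    proof (intro ballI impI)
      fix I J assume IJ: "I \<in> compositions k s" "J \<in> compositions k s" "I \<noteq> J"
      have "I = J" if "f \<in> F I" "f \<in> F J" for f
        using that IJ by (intro nth_equalityI) (auto simp: F_def functions_with_fibres_def compositions_def)
      then show "(F I \<times> H I) \<inter> (F J \<times> H J) = {}" using IJ(3) by auto
    qed
  qed
  then have "real (card (configs s k)) = (\<Sum>J\<in>compositions k s. real (card (F J)) * real (card (H J)))"
    by (simp add: card_cartesian_product)
  also have "\<dots> = (\<Sum>J\<in>compositions k s. (fact s)\<^sup>2 * (1 / (\<Prod>n<k. fact (J ! n) * fact (J ! n - 1))))"
  proof (rule sum.cong[OF refl])
    fix J assume J: "J \<in> compositions k s"
    then have sumJ: "(\<Sum>j<k. J ! j) = s" and J1: "\<And>j. j < k \<Longrightarrow> 1 \<le> J ! j"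
      by (auto simp: compositions_def sum_list_sum_nth atLeast0LessThan)
    have "card (F J) * (\<Prod>j<k. fact (J ! j)) = fact (card {1..s})"
      unfolding F_def by (rule card_functions_with_fibres) (auto simp: sumJ)
    then have 1: "real (card (F J)) * (\<Prod>j<k. fact (J ! j)) = fact s"
      by (intro of_nat_mult_prod_fact) simp
    \<comment> \<open>Adding 1 to each of the \<open>k\<close> summands undoes the truncated
      subtraction, as every part is at least 1.\<close>
    have "(\<Sum>j<k. J ! j - 1) + k = (\<Sum>j<k. (J ! j - 1) + 1)" by (simp only: sum.distrib) simp
    also have "\<dots> = (\<Sum>j<k. J ! j)"
    proof (intro sum.cong refl)
      fix j assume "j \<in> {..<k}"
      then show "J ! j - 1 + 1 = J ! j" using J1[of j] by simp
    qed
    also have "\<dots> = s" by (rule sumJ)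
    finally have sumJ': "(\<Sum>j<k. J ! j - 1) + k = s" .
    have "card (H J) * (\<Prod>j\<in>{..<k} <+> {..<k}. fact (case_sum (\<lambda>j. J ! j - 1) (\<lambda>j. 1) j)) = fact (card {1..s})"
      unfolding H_def by (rule card_functions_with_fibres) (use sumJ' in \<open>auto simp: sum.Plus comp_def\<close>)
    then have "card (H J) * (\<Prod>j<k. fact (J ! j - 1)) = fact s"
      by (simp add: prod.Plus comp_def)
    then have 2: "real (card (H J)) * (\<Prod>j<k. fact (J ! j - 1)) = fact s"
      by (intro of_nat_mult_prod_fact) simp
    have nz: "(\<Prod>j<k. fact (J ! j) :: real) \<noteq> 0" "(\<Prod>j<k. fact (J ! j - 1) :: real) \<noteq> 0" by simp_all
    have "real (card (F J)) = fact s / (\<Prod>j<k. fact (J ! j))"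
      "real (card (H J)) = fact s / (\<Prod>j<k. fact (J ! j - 1))"
      using 1 2 nz by (simp_all add: eq_divide_eq)
    then show "real (card (F J)) * real (card (H J)) = (fact s)\<^sup>2 * (1 / (\<Prod>n<k. fact (J ! n) * fact (J ! n - 1)))"
      by (simp add: prod.distrib power2_eq_square)
  qed
  finally show ?thesis by (simp add: sum_distrib_left)
qed

context
  fixes s k :: nat and f :: "nat \<Rightarrow> nat" and g :: "nat \<Rightarrow> nat + nat"
  assumes q: "(f, g) \<in> configs s k" and k: "k \<ge> 1"
begin

lemma config_color:
  assumes "j < k"
  shows "color (config_graph s k (f, g)) j \<in> {1..s}"
    and "c \<in> {1..s} \<Longrightarrow> color (config_graph s k (f, g)) j = c \<longleftrightarrow> g c = Inr j"
proof -
  have "card {c \<in> {1..s}. g c = Inr j} = 1" using q assms by (auto simp: configs_def)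
  then obtain d where "{c \<in> {1..s}. g c = Inr j} = {d}" by (rule card_1_singletonE)
  then have d: "c \<in> {1..s} \<and> g c = Inr j \<longleftrightarrow> c = d" for c by blast
  have "color (config_graph s k (f, g)) j = d"
  proof -
    have "(THE c. c \<in> {1..s} \<and> g c = Inr j) = d" by (rule the_equality) (use d in blast)+
    then show ?thesis by (simp add: config_graph_def)
  qed
  then show "color (config_graph s k (f, g)) j \<in> {1..s}"
    and "c \<in> {1..s} \<Longrightarrow> color (config_graph s k (f, g)) j = c \<longleftrightarrow> g c = Inr j"
    using d by metis+
qed

lemma config_range:
  "i \<in> {1..s} \<Longrightarrow> f i < k"
  "c \<in> {1..s} \<Longrightarrow> (\<exists>j<k. g c = Inl j) \<or> (\<exists>j<k. g c = Inr j)"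
  using q by (auto simp: configs_def PiE_def Pi_def Plus_def)

lemma config_leg: "j < k \<Longrightarrow> \<exists>i\<in>{1..s}. f i = j"
  using q unfolding configs_def by blast

lemma config_graph_colors: "color (config_graph s k (f, g)) ` {..<k} = {c \<in> {1..s}. \<exists>j<k. g c = Inr j}"
proof (intro subset_antisym subsetI)
  fix c assume "c \<in> color (config_graph s k (f, g)) ` {..<k}"
  then obtain j where "j < k" "c = color (config_graph s k (f, g)) j" by auto
  then show "c \<in> {c \<in> {1..s}. \<exists>j<k. g c = Inr j}" using config_color[of j] by blast
next
  fix c assume "c \<in> {c \<in> {1..s}. \<exists>j<k. g c = Inr j}"
  then obtain j where "c \<in> {1..s}" "j < k" "g c = Inr j" by blast
  then show "c \<in> color (config_graph s k (f, g)) ` {..<k}"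
    using config_color(2)[of j c] by (intro image_eqI[of _ _ j]) auto
qed

lemma config_graph_color_inj: "inj_on (color (config_graph s k (f, g))) {..<k}"
proof (rule inj_onI)
  fix i j assume ij: "i \<in> {..<k}" "j \<in> {..<k}"
    "color (config_graph s k (f, g)) i = color (config_graph s k (f, g)) j"
  have "g (color (config_graph s k (f, g)) i) = Inr i" "g (color (config_graph s k (f, g)) i) = Inr j"
    using config_color[of i] config_color[of j] ij by auto
  then show "i = j" by simp
qed

lemma config_le: "k \<le> s"
proof -
  have "color (config_graph s k (f, g)) ` {..<k} \<subseteq> {1..s}" unfolding config_graph_colors by blast
  then show ?thesis using card_inj_on_le[OF config_graph_color_inj, of "{1..s}"] by simp
qed

lemma is_weighted_graph_config_graph: "is_weighted_graph s (config_graph s k (f, g))"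
proof -
  let ?G = "config_graph s k (f, g)"
  have sel: "verts ?G = {..<k}" "edges ?G = {..<k}" "\<And>j. ends ?G j = {j, (j + 1) mod k}" "leg ?G = f"
    "\<And>j. weight ?G j = {c \<in> {1..s}. g c = Inl j}"
    by (auto simp: config_graph_def)
  have legs: "legs_at s ?G j = {i \<in> {1..s}. f i = j}" for j by (simp add: legs_at_def sel)
  have "card {j, (j + 1) mod k} \<in> {1, 2}" for j by (auto simp: card_insert_if)
  then have "is_multigraph s ?G" using k config_range(1) by (auto simp: is_multigraph_def sel)
  moreover have "is_cycle k ?G"
    unfolding is_cycle_def by (intro exI[of _ "\<lambda>j. j"]) (auto simp: sel bij_betw_def)
  ultimately have "one_loop_admissible s ?G"
    using k config_le q by (auto simp: one_loop_admissible_def legs sel configs_def)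
  moreover have "holocoloring s ?G (color ?G)"
    using config_graph_color_inj config_graph_colors by (auto simp: holocoloring_def sel)
  moreover have "weight ?G v \<subseteq> {1..s} \<and> card (weight ?G v) = card (legs_at s ?G v) - 1" if "v \<in> verts ?G" for v
    using q that by (auto simp: sel legs configs_def)
  moreover have "disjoint_family_on (weight ?G) (verts ?G)" by (auto simp: disjoint_family_on_def sel)
  moreover have "weight ?G v \<inter> color ?G ` edges ?G = {}" for v
    unfolding sel config_graph_colors by auto
  moreover have "(\<Union>v\<in>verts ?G. weight ?G v) \<union> color ?G ` edges ?G = {1..s}"
    unfolding sel config_graph_colors using config_range(2) by fastforce
  ultimately show ?thesis unfolding is_weighted_graph_def by blast
qed

end

lemma cell_code_eq_iff_iso:
  assumes "is_weighted_graph s G" "is_weighted_graph s H"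
  shows "cell_code s G = cell_code s H \<longleftrightarrow> (\<exists>u h. weighted_graph_iso s G H u h)"
proof
  assume eq: "cell_code s G = cell_code s H"
  then have col: "color G ` edges G = color H ` edges H" by (simp add: cell_code_def)
  have "conns s G (color G ` edges G) = conns s H (color G ` edges G)"
    using eq by (simp add: cell_code_def col)
  then show "\<exists>u h. weighted_graph_iso s G H u h" by (rule weighted_graph_iso_exists[OF assms col])
next
  assume "\<exists>u h. weighted_graph_iso s G H u h"
  then obtain u h where "weighted_graph_iso s G H u h" by blast
  from weighted_graph_iso_invariants[OF assms(1) this] show "cell_code s G = cell_code s H"
    by (simp add: cell_code_def)
qed

text \<open>Colors and weights together say that \<open>g\<close> is carried along by
  \<open>map_sum u h\<close>; isomorphism of configuration graphs thus becomes an action of the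
  cycle automorphisms.\<close>

lemma weighted_graph_iso_config_graph_iff:
  assumes q: "(f, g) \<in> configs s k" and q': "(f', g') \<in> configs s k" and k: "k \<ge> 1"
  shows "weighted_graph_iso s (config_graph s k (f, g)) (config_graph s k (f', g')) u h \<longleftrightarrow>
    bij_betw u {..<k} {..<k} \<and> bij_betw h {..<k} {..<k} \<and>
    (\<forall>j<k. {h j, (h j + 1) mod k} = u ` {j, (j + 1) mod k}) \<and>
    (\<forall>i\<in>{1..s}. f' i = u (f i)) \<and> (\<forall>c\<in>{1..s}. g' c = map_sum u h (g c))"
    (is "?iso \<longleftrightarrow> ?u \<and> ?h \<and> ?e \<and> ?f \<and> ?g")
proof -
  let ?G = "config_graph s k (f, g)" and ?H = "config_graph s k (f', g')"
  have sel: "verts ?G = {..<k}" "edges ?G = {..<k}" "ends ?G = (\<lambda>j. {j, (j + 1) mod k})" "leg ?G = f"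
    "weight ?G = (\<lambda>j. {c \<in> {1..s}. g c = Inl j})"
    "verts ?H = {..<k}" "edges ?H = {..<k}" "ends ?H = (\<lambda>j. {j, (j + 1) mod k})" "leg ?H = f'"
    "weight ?H = (\<lambda>j. {c \<in> {1..s}. g' c = Inl j})"
    by (auto simp: config_graph_def)
  have "(\<forall>e\<in>{..<k}. color ?H (h e) = color ?G e) \<and> (\<forall>v\<in>{..<k}. weight ?H (u v) = weight ?G v) \<longleftrightarrow> ?g"
    if u: ?u and h: ?h
  proof
    assume *: "(\<forall>e\<in>{..<k}. color ?H (h e) = color ?G e) \<and> (\<forall>v\<in>{..<k}. weight ?H (u v) = weight ?G v)"
    show ?g
    proof
      fix c assume c: "c \<in> {1..s}"
      consider j where "j < k" "g c = Inl j" | j where "j < k" "g c = Inr j"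
        using config_range(2)[OF q k c] by blast
      then show "g' c = map_sum u h (g c)"
      proof cases
        case 1
        then have "c \<in> weight ?H (u j)" using * c by (auto simp: sel)
        then show ?thesis using 1 by (simp add: sel)
      next
        case 2
        then have "color ?H (h j) = c" using * config_color(2)[OF q k 2(1) c] by simp
        moreover have "h j < k" using h 2(1) by (auto simp: bij_betw_def)
        ultimately show ?thesis using config_color(2)[OF q' k _ c, of "h j"] 2 by simp
      qed
    qed
  next
    assume *: ?g
    show "(\<forall>e\<in>{..<k}. color ?H (h e) = color ?G e) \<and> (\<forall>v\<in>{..<k}. weight ?H (u v) = weight ?G v)"
    proof (intro conjI ballI)
      fix e assume "e \<in> {..<k}"
      then have e: "e < k" "h e < k" using h by (auto simp: bij_betw_def)
      have c: "color ?G e \<in> {1..s}" by (rule config_color(1)[OF q k e(1)])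
      then have "g (color ?G e) = Inr e" using config_color(2)[OF q k e(1) c] by simp
      then show "color ?H (h e) = color ?G e"
        using config_color(2)[OF q' k e(2) c] * c by simp
    next
      fix v assume v: "v \<in> {..<k}"
      have "g' c = Inl (u v) \<longleftrightarrow> g c = Inl v" if c: "c \<in> {1..s}" for c
      proof -
        have "u j = u v \<longleftrightarrow> j = v" if "j < k" for j
          using u v that by (auto simp: bij_betw_def inj_on_def)
        then show ?thesis using * c config_range(2)[OF q k c] by auto
      qed
      then show "weight ?H (u v) = weight ?G v" unfolding sel by blast
    qed
  qed
  moreover have "?iso \<longleftrightarrow> ?u \<and> ?h \<and> ?e \<and> ?f \<and>
      ((\<forall>e\<in>{..<k}. color ?H (h e) = color ?G e) \<and> (\<forall>v\<in>{..<k}. weight ?H (u v) = weight ?G v))"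
    unfolding weighted_graph_iso_def unfolding sel by blast
  ultimately show ?thesis by blast
qed

definition aut_action ::
  "nat \<Rightarrow> (nat \<Rightarrow> nat) \<times> (nat \<Rightarrow> nat + nat) \<Rightarrow> (nat \<Rightarrow> nat) \<times> (nat \<Rightarrow> nat) \<Rightarrow> (nat \<Rightarrow> nat) \<times> (nat \<Rightarrow> nat + nat)" where
  "aut_action s q a = (restrict (\<lambda>i. fst a (fst q i)) {1..s}, restrict (\<lambda>c. map_sum (fst a) (snd a) (snd q c)) {1..s})"

lemma aut_action_configs:
  assumes q: "(f, g) \<in> configs s k" and k: "k \<ge> 1" and a: "(\<alpha>, \<beta>) \<in> cycle_auts k"
  shows "aut_action s (f, g) (\<alpha>, \<beta>) \<in> configs s k"
proof -
  define f' where "f' = restrict (\<lambda>i. \<alpha> (f i)) {1..s}"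
  define g' where "g' = restrict (\<lambda>c. map_sum \<alpha> \<beta> (g c)) {1..s}"
  have \<alpha>: "bij_betw \<alpha> {..<k} {..<k}" and \<beta>: "bij_betw \<beta> {..<k} {..<k}"
    using a by (auto simp: cycle_auts_def)
  have lt: "\<alpha> j < k" "\<beta> j < k" if "j < k" for j
    using \<alpha> \<beta> that by (auto simp: bij_betw_def)
  have inj: "\<alpha> i = \<alpha> j \<longleftrightarrow> i = j" "\<beta> i = \<beta> j \<longleftrightarrow> i = j" if "i < k" "j < k" for i j
    using \<alpha> \<beta> that by (auto simp: bij_betw_def inj_on_def)
  have r: "f i < k" if "i \<in> {1..s}" for i using config_range(1)[OF q k that] .
  have rg: "(\<exists>j<k. g c = Inl j) \<or> (\<exists>j<k. g c = Inr j)" if "c \<in> {1..s}" for c using config_range(2)[OF q k that] .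
  have "f' \<in> {1..s} \<rightarrow>\<^sub>E {..<k}" using r lt by (auto simp: f'_def)
  moreover have "g' c \<in> {..<k} <+> {..<k}" if "c \<in> {1..s}" for c
    using rg[OF that] lt that by (auto simp: g'_def)
  then have "g' \<in> {1..s} \<rightarrow>\<^sub>E ({..<k} <+> {..<k})" by (auto simp: g'_def)
  moreover have "{i \<in> {1..s}. f' i = j} \<noteq> {} \<and>
        card {c \<in> {1..s}. g' c = Inl j} = card {i \<in> {1..s}. f' i = j} - 1 \<and>
        card {c \<in> {1..s}. g' c = Inr j} = 1" if j: "j < k" for j
  proof -
    have "j \<in> \<alpha> ` {..<k}" "j \<in> \<beta> ` {..<k}" using \<alpha> \<beta> j by (simp_all add: bij_betw_def)
    then obtain a b where a: "a < k" "\<alpha> a = j" and b: "b < k" "\<beta> b = j" by auto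
    have "{i \<in> {1..s}. f' i = j} = {i \<in> {1..s}. f i = a}"
      using inj(1)[OF r a(1)] by (auto simp: f'_def a(2)[symmetric])
    moreover have "{c \<in> {1..s}. g' c = Inl j} = {c \<in> {1..s}. g c = Inl a}"
    proof -
      have "g' c = Inl j \<longleftrightarrow> g c = Inl a" if "c \<in> {1..s}" for c
        using rg[OF that] inj(1)[OF _ a(1)] that by (auto simp: g'_def a(2)[symmetric])
      then show ?thesis by blast
    qed
    moreover have "{c \<in> {1..s}. g' c = Inr j} = {c \<in> {1..s}. g c = Inr b}"
    proof -
      have "g' c = Inr j \<longleftrightarrow> g c = Inr b" if "c \<in> {1..s}" for c
        using rg[OF that] inj(2)[OF _ b(1)] that by (auto simp: g'_def b(2)[symmetric])
      then show ?thesis by blast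
    qed
    moreover have "{i \<in> {1..s}. f i = a} \<noteq> {} \<and>
        card {c \<in> {1..s}. g c = Inl a} = card {i \<in> {1..s}. f i = a} - 1"
      "card {c \<in> {1..s}. g c = Inr b} = 1"
      using q a(1) b(1) unfolding configs_def by blast+
    ultimately show ?thesis by simp
  qed
  ultimately have "(f', g') \<in> configs s k" unfolding configs_def by blast
  then show ?thesis by (simp add: aut_action_def f'_def g'_def)
qed

text \<open>The action is free: each vertex holds a leg and each edge a color, so its effect on
  \<open>f\<close> and \<open>g\<close> determines the automorphism. An orbit consists of the
  configurations with the same code, because equal codes mean isomorphic graphs.\<close>

lemma bij_betw_aut_action:
  assumes q: "q \<in> configs s k" and k: "k \<ge> 1"
  shows "bij_betw (aut_action s q) (cycle_auts k)
    {q' \<in> configs s k. cell_code s (config_graph s k q') = cell_code s (config_graph s k q)}"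
proof -
  obtain f g where fg: "q = (f, g)" by (cases q)
  note q = q[unfolded fg]
  have code: "cell_code s (config_graph s k (f', g')) = cell_code s (config_graph s k (f, g)) \<longleftrightarrow>
      (\<exists>u h. weighted_graph_iso s (config_graph s k (f, g)) (config_graph s k (f', g')) u h)"
    if "(f', g') \<in> configs s k" for f' g'
    using cell_code_eq_iff_iso[OF is_weighted_graph_config_graph[OF q k] is_weighted_graph_config_graph[OF that k]]
    by metis
  show ?thesis
    unfolding bij_betw_def fg
  proof
    show "inj_on (aut_action s (f, g)) (cycle_auts k)"
    proof (rule inj_onI)
      fix a b assume a: "a \<in> cycle_auts k" and b: "b \<in> cycle_auts k"
        and eq: "aut_action s (f, g) a = aut_action s (f, g) b"
      have e1: "fst a (f i) = fst b (f i)" if "i \<in> {1..s}" for i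
        using eq that by (auto simp: aut_action_def fun_eq_iff restrict_def dest: spec[of _ i])
      have e2: "map_sum (fst a) (snd a) (g c) = map_sum (fst b) (snd b) (g c)" if "c \<in> {1..s}" for c
      proof -
        have "snd (aut_action s (f, g) a) c = snd (aut_action s (f, g) b) c" using eq by simp
        then show ?thesis using that by (simp add: aut_action_def)
      qed
      have "fst a j = fst b j" if "j < k" for j using config_leg[OF q k that] e1 by blast
      moreover have "snd a j = snd b j" if "j < k" for j
      proof -
        have c: "color (config_graph s k (f, g)) j \<in> {1..s}" by (rule config_color(1)[OF q k that])
        then have "g (color (config_graph s k (f, g)) j) = Inr j"
          using config_color(2)[OF q k that c] by simp
        then show ?thesis using e2[OF c] by simp
      qed
      moreover have "fst a \<in> extensional {..<k}" "snd a \<in> extensional {..<k}"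
        "fst b \<in> extensional {..<k}" "snd b \<in> extensional {..<k}"
        using a b by (auto simp: cycle_auts_def)
      ultimately have "fst a = fst b" "snd a = snd b" by (auto intro: extensionalityI)
      then show "a = b" by (simp add: prod_eq_iff)
    qed
    show "aut_action s (f, g) ` cycle_auts k =
        {q' \<in> configs s k. cell_code s (config_graph s k q') = cell_code s (config_graph s k (f, g))}"
    proof (intro subset_antisym subsetI)
      fix q' assume "q' \<in> aut_action s (f, g) ` cycle_auts k"
      then obtain \<alpha> \<beta> where a: "(\<alpha>, \<beta>) \<in> cycle_auts k" and q': "q' = aut_action s (f, g) (\<alpha>, \<beta>)" by auto
      obtain f' g' where fg': "q' = (f', g')" by (cases q')
      have c: "(f', g') \<in> configs s k" using aut_action_configs[OF q k a] q' fg' by simp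
      have e: "f' = restrict (\<lambda>i. \<alpha> (f i)) {1..s}" "g' = restrict (\<lambda>c. map_sum \<alpha> \<beta> (g c)) {1..s}"
        using q' fg' by (auto simp: aut_action_def)
      have "weighted_graph_iso s (config_graph s k (f, g)) (config_graph s k (f', g')) \<alpha> \<beta>"
        unfolding weighted_graph_iso_config_graph_iff[OF q c k]
        using a by (simp add: e cycle_auts_def)
      then show "q' \<in> {q' \<in> configs s k. cell_code s (config_graph s k q') = cell_code s (config_graph s k (f, g))}"
        using c code[OF c] fg' by blast
    next
      fix q' assume q': "q' \<in> {q' \<in> configs s k. cell_code s (config_graph s k q') = cell_code s (config_graph s k (f, g))}"
      obtain f' g' where fg': "q' = (f', g')" by (cases q')
      have c: "(f', g') \<in> configs s k" using q' fg' by simp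
      obtain u h where "weighted_graph_iso s (config_graph s k (f, g)) (config_graph s k (f', g')) u h"
        using q' fg' code[OF c] by blast
      note iso = this[unfolded weighted_graph_iso_config_graph_iff[OF q c k]]
      \<comment> \<open>Isomorphisms are arbitrary outside \<open>{..<k}\<close>; restricting them
        gives an element of \<open>cycle_auts k\<close>.\<close>
      let ?a = "(restrict u {..<k}, restrict h {..<k})"
      have mod: "(j + 1) mod k < k" for j using k by simp
      have "?a \<in> cycle_auts k"
        using iso mod by (simp add: cycle_auts_def)
      moreover have "aut_action s (f, g) ?a = (f', g')"
      proof -
        have "f' \<in> extensional {1..s}" "g' \<in> extensional {1..s}"
          using c unfolding configs_def PiE_def by blast+
        moreover have "restrict u {..<k} (f i) = f' i" if "i \<in> {1..s}" for i
          using iso that config_range(1)[OF q k that] by simp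
        moreover have "map_sum (restrict u {..<k}) (restrict h {..<k}) (g c) = g' c" if "c \<in> {1..s}" for c
        proof -
          have "g' c = map_sum u h (g c)" using iso that by blast
          then show ?thesis using config_range(2)[OF q k that] by auto
        qed
        ultimately show ?thesis
          unfolding aut_action_def fst_conv snd_conv
          by (intro arg_cong2[where f = Pair] extensionalityI[where A = "{1..s}"]) (auto simp del: atLeastAtMost_iff)
      qed
      ultimately show "q' \<in> aut_action s (f, g) ` cycle_auts k" using fg' by (metis image_eqI)
    qed
  qed
qed

text \<open>Numbering the vertices and edges of \<open>G\<close> along the cycle turns it into a
  configuration.\<close>

lemma weighted_graph_code_config:
  assumes G: "is_weighted_graph s G" and k: "card (color G ` edges G) = k"
  shows "\<exists>q\<in>configs s k. cell_code s (config_graph s k q) = cell_code s G"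
proof -
  obtain n where n: "n \<in> {1..s}" "is_cycle n G" using weighted_graph_cycle[OF G] by blast
  obtain x y where x: "bij_betw x {..<n} (verts G)" and y: "bij_betw y {..<n} (edges G)"
    and en: "\<And>j. j < n \<Longrightarrow> ends G (y j) = {x j, x ((j + 1) mod n)}"
    using n(2) unfolding is_cycle_def by blast
  have "card (edges G) = k" using k card_image[OF weighted_graph_color(1)[OF G]] by simp
  then have nk: "n = k" using bij_betw_same_card[OF y] by simp
  note x = x[unfolded nk] and y = y[unfolded nk] and en = en[unfolded nk]
  have k1: "k \<ge> 1" using n nk by simp
  have xV: "x j \<in> verts G" and yE: "y j \<in> edges G" if "j < k" for j
    using x y that by (auto simp: bij_betw_def)
  have xinj: "x i = x j \<longleftrightarrow> i = j" and yinj: "y i = y j \<longleftrightarrow> i = j" if "i < k" "j < k" for i j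
    using x y that by (auto simp: bij_betw_def inj_on_def)
  have xsurj: "\<exists>j<k. x j = v" if "v \<in> verts G" for v
    using x that unfolding bij_betw_def by (metis imageE lessThan_iff)
  have ysurj: "\<exists>j<k. y j = e" if "e \<in> edges G" for e
    using y that unfolding bij_betw_def by (metis imageE lessThan_iff)
  have "\<forall>i\<in>{1..s}. \<exists>j. j < k \<and> leg G i = x j"
    using xsurj weighted_graph_leg[OF G] by metis
  then obtain f0 where f0: "\<And>i. i \<in> {1..s} \<Longrightarrow> f0 i < k \<and> leg G i = x (f0 i)" by metis
  have "\<exists>t. (\<exists>j<k. t = Inl j \<and> c \<in> weight G (x j)) \<or> (\<exists>j<k. t = Inr j \<and> color G (y j) = c)"
    if "c \<in> {1..s}" for c
  proof -
    have "c \<in> (\<Union>v\<in>verts G. weight G v) \<union> color G ` edges G" using that weighted_graph_weight(4)[OF G] by simp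
    then consider v where "v \<in> verts G" "c \<in> weight G v" | e where "e \<in> edges G" "c = color G e" by blast
    then show ?thesis
    proof cases
      case 1
      then show ?thesis using xsurj[OF 1(1)] by blast
    next
      case 2
      then show ?thesis using ysurj[OF 2(1)] by blast
    qed
  qed
  then obtain g0 :: "nat \<Rightarrow> nat + nat" where g0: "\<And>c. c \<in> {1..s} \<Longrightarrow>
      (\<exists>j<k. g0 c = Inl j \<and> c \<in> weight G (x j)) \<or> (\<exists>j<k. g0 c = Inr j \<and> color G (y j) = c)"
    by metis
  define f where "f = restrict f0 {1..s}"
  define g where "g = restrict g0 {1..s}"
  have f: "f i < k" "leg G i = x (f i)" if "i \<in> {1..s}" for i using f0[OF that] that by (auto simp: f_def)
  have gx: "(\<exists>j<k. g c = Inl j \<and> c \<in> weight G (x j)) \<or> (\<exists>j<k. g c = Inr j \<and> color G (y j) = c)"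
    if "c \<in> {1..s}" for c using g0[OF that] that by (simp add: g_def del: atLeastAtMost_iff)
  have wc: "color G (y i) \<notin> weight G (x j)" if "i < k" "j < k" for i j
    using weighted_graph_weight(3)[OF G xV[OF that(2)]] yE[OF that(1)] by blast
  have gl: "g c = Inl j \<longleftrightarrow> c \<in> weight G (x j)" if "c \<in> {1..s}" "j < k" for c j
  proof -
    have "i = j" if "i < k" "c \<in> weight G (x i)" "c \<in> weight G (x j)" for i
      using weighted_graph_weight(5)[OF G xV[OF that(1)] xV[OF \<open>j < k\<close>]] that xinj[OF that(1) \<open>j < k\<close>] by blast
    note uniq = this
    from gx[OF that(1)] show ?thesis
    proof (elim disjE exE conjE)
      fix i assume "i < k" "g c = Inl i" "c \<in> weight G (x i)"
      then show ?thesis using uniq[of i] by auto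
    next
      fix i assume "i < k" "g c = Inr i" "color G (y i) = c"
      then show ?thesis using wc[OF _ that(2), of i] by auto
    qed
  qed
  have gr: "g c = Inr j \<longleftrightarrow> color G (y j) = c" if "c \<in> {1..s}" "j < k" for c j
  proof -
    have "i = j" if "i < k" "color G (y i) = color G (y j)" for i
      using inj_onD[OF weighted_graph_color(1)[OF G] that(2) yE[OF that(1)] yE[OF \<open>j < k\<close>]]
        yinj[OF that(1) \<open>j < k\<close>] by blast
    note uniq = this
    from gx[OF that(1)] show ?thesis
    proof (elim disjE exE conjE)
      fix i assume "i < k" "g c = Inl i" "c \<in> weight G (x i)"
      then show ?thesis using wc[OF that(2), of i] by auto
    next
      fix i assume i: "i < k" "g c = Inr i" "color G (y i) = c"
      show ?thesis
      proof
        assume "g c = Inr j"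
        then show "color G (y j) = c" using i by simp
      next
        assume "color G (y j) = c"
        then have "i = j" using uniq[OF i(1)] i(3) by simp
        then show "g c = Inr j" using i(2) by simp
      qed
    qed
  qed
  have legs: "{i \<in> {1..s}. f i = j} = legs_at s G (x j)" if "j < k" for j
  proof -
    have "f i = j \<longleftrightarrow> leg G i = x j" if "i \<in> {1..s}" for i
      using f(2)[OF that] xinj[OF f(1)[OF that] \<open>j < k\<close>] by simp
    then show ?thesis unfolding legs_at_def by blast
  qed
  have wts: "{c \<in> {1..s}. g c = Inl j} = weight G (x j)" if "j < k" for j
    using gl[OF _ that] weighted_graph_weight(1)[OF G xV[OF that]] by blast
  have cols: "{c \<in> {1..s}. g c = Inr j} = {color G (y j)}" if "j < k" for j
    using gr[OF _ that] weighted_graph_color(2)[OF G] yE[OF that] by blast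
  have q: "(f, g) \<in> configs s k"
  proof -
    have "f \<in> {1..s} \<rightarrow>\<^sub>E {..<k}" using f by (auto simp: f_def)
    moreover have "g c \<in> {..<k} <+> {..<k}" if "c \<in> {1..s}" for c using gx[OF that] by auto
    then have "g \<in> {1..s} \<rightarrow>\<^sub>E ({..<k} <+> {..<k})" by (auto simp: g_def)
    moreover have "{i \<in> {1..s}. f i = j} \<noteq> {} \<and>
        card {c \<in> {1..s}. g c = Inl j} = card {i \<in> {1..s}. f i = j} - 1 \<and>
        card {c \<in> {1..s}. g c = Inr j} = 1" if "j < k" for j
    proof -
      have "legs_at s G (x j) \<noteq> {}"
        using weighted_graph_legs_nonempty[OF G xV[OF that]] by (auto simp: legs_at_def)
      then show ?thesis
        unfolding legs[OF that] wts[OF that] cols[OF that]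
        using weighted_graph_weight(2)[OF G xV[OF that]] by simp
    qed
    ultimately show ?thesis unfolding configs_def by blast
  qed
  have "weighted_graph_iso s (config_graph s k (f, g)) G x y"
    unfolding weighted_graph_iso_def
  proof (intro conjI ballI)
    show "color G (y e) = color (config_graph s k (f, g)) e" if "e \<in> edges (config_graph s k (f, g))" for e
    proof -
      have e: "e < k" using that by (simp add: config_graph_def)
      have "color G (y e) \<in> {1..s}" using weighted_graph_color(2)[OF G] yE[OF e] by blast
      then show ?thesis using config_color(2)[OF q k1 e, of "color G (y e)"] gr[of "color G (y e)" e] e by simp
    qed
    show "weight G (x v) = weight (config_graph s k (f, g)) v" if "v \<in> verts (config_graph s k (f, g))" for v
      using that wts[of v] by (simp add: config_graph_def)
  qed (use x y en f in \<open>auto simp: config_graph_def\<close>)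
  then show ?thesis
    using q cell_code_eq_iff_iso[OF is_weighted_graph_config_graph[OF q k1] G] by blast
qed

lemma cells_eq_image_configs:
  assumes k: "k \<ge> 1"
  shows "{i \<in> cell_codes s. card (fst i) = k} = (\<lambda>q. cell_code s (config_graph s k q)) ` configs s k"
proof (intro subset_antisym subsetI)
  fix i assume "i \<in> {i \<in> cell_codes s. card (fst i) = k}"
  then obtain G where G: "is_weighted_graph s G" "i = cell_code s G" "card (color G ` edges G) = k"
    by (auto simp: cell_codes_def cell_code_def)
  then show "i \<in> (\<lambda>q. cell_code s (config_graph s k q)) ` configs s k"
    using weighted_graph_code_config[OF G(1,3)] by (metis image_eqI)
next
  fix i assume "i \<in> (\<lambda>q. cell_code s (config_graph s k q)) ` configs s k"
  then obtain f g where q: "(f, g) \<in> configs s k" "i = cell_code s (config_graph s k (f, g))" by auto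
  have "edges (config_graph s k (f, g)) = {..<k}" by (simp add: config_graph_def)
  then have "card (fst i) = k"
    using card_image[OF config_graph_color_inj[OF q(1) k]] by (simp add: q(2) cell_code_def)
  then show "i \<in> {i \<in> cell_codes s. card (fst i) = k}"
    using is_weighted_graph_config_graph[OF q(1) k] q(2) by (auto simp: cell_codes_def)
qed

text \<open>The fibres of the code map on configurations are orbits of a free action, hence all have
  the size of the group.\<close>

theorem card_cells:
  assumes k: "k \<ge> 1"
  shows "card {i \<in> cell_codes s. card (fst i) = k} * card (cycle_auts k) = card (configs s k)"
proof -
  let ?c = "\<lambda>q. cell_code s (config_graph s k q)"
  have "card (configs s k) = (\<Sum>i\<in>?c ` configs s k. card {q \<in> configs s k. ?c q = i})"
    using sum_card_fibres[of "configs s k" "?c ` configs s k" ?c] finite_configs by simp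
  also have "\<dots> = (\<Sum>i\<in>?c ` configs s k. card (cycle_auts k))"
  proof (rule sum.cong[OF refl])
    fix i assume "i \<in> ?c ` configs s k"
    then obtain q where "q \<in> configs s k" "i = ?c q" by auto
    then show "card {q \<in> configs s k. ?c q = i} = card (cycle_auts k)"
      using bij_betw_same_card[OF bij_betw_aut_action[OF _ k]] by simp
  qed
  finally show ?thesis by (simp add: cells_eq_image_configs[OF k])
qed

theorem mainTheorem7:
  fixes s :: nat
  assumes "s \<ge> 1"
  shows "has_finite_betti_numbers (MRG1 s) \<and>
    real_of_int (euler_characteristic (MRG1 s)) =
      (fact s)\<^sup>2 *
      (\<Sum>k = 1..s. (- 1) ^ (k - 1) * (1 + of_bool (k = 1)) / (2 * real k) *
        (\<Sum>I\<in>increasing_compositions k s.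
          g_coeff I / (\<Prod>n<k. fact (I ! n) * fact (I ! n - 1))))"
proof
  show "has_finite_betti_numbers (MRG1 s)" by (rule euler_characteristic_MRG1)
  \<comment> \<open>A weighted graph has at least one edge, and at most \<open>s\<close> because its
    edges have distinct colors.\<close>
  have range: "(\<lambda>i. card (fst i)) ` cell_codes s \<subseteq> {1..s}"
  proof
    fix k assume "k \<in> (\<lambda>i. card (fst i)) ` cell_codes s"
    then obtain G where G: "is_weighted_graph s G" "k = card (color G ` edges G)"
      by (auto simp: cell_codes_def cell_code_def)
    have "finite (color G ` edges G)" "color G ` edges G \<noteq> {}"
      using weighted_graph_finite(2)[OF G(1)] weighted_graph_edges_nonempty[OF G(1)] by auto
    then have "k \<noteq> 0" using G(2) by simp
    moreover have "k \<le> card {1..s}" unfolding G(2) by (rule card_mono) (use weighted_graph_color(2)[OF G(1)] in auto)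
    ultimately show "k \<in> {1..s}" by simp
  qed
  have "euler_characteristic (MRG1 s) = (\<Sum>i\<in>cell_codes s. (- 1) ^ (card (fst i) - 1))"
    by (rule euler_characteristic_MRG1)
  also have "\<dots> = (\<Sum>k = 1..s. \<Sum>i | i \<in> cell_codes s \<and> card (fst i) = k. (- 1) ^ (card (fst i) - 1))"
    by (rule sum.group[symmetric]) (use finite_cell_codes range in auto)
  also have "\<dots> = (\<Sum>k = 1..s. (- 1) ^ (k - 1) * int (card {i \<in> cell_codes s. card (fst i) = k}))"
    by (intro sum.cong refl) simp
  finally have "real_of_int (euler_characteristic (MRG1 s))
      = (\<Sum>k = 1..s. (- 1) ^ (k - 1) * real (card {i \<in> cell_codes s. card (fst i) = k}))"
    by simp
  also have "\<dots> = (\<Sum>k = 1..s. (fact s)\<^sup>2 * ((- 1) ^ (k - 1) * (1 + of_bool (k = 1)) / (2 * real k) *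
        (\<Sum>I\<in>increasing_compositions k s. g_coeff I / (\<Prod>n<k. fact (I ! n) * fact (I ! n - 1)))))"
  proof (rule sum.cong[OF refl])
    fix k assume "k \<in> {1..s}"
    then have k: "k \<ge> 1" by simp
    let ?S = "\<Sum>I\<in>increasing_compositions k s. g_coeff I / (\<Prod>n<k. fact (I ! n) * fact (I ! n - 1))"
    let ?N = "card {i \<in> cell_codes s. card (fst i) = k}"
    have "real (?N * card (cycle_auts k)) = (fact s)\<^sup>2 * ?S"
      unfolding card_cells[OF k] card_configs
      using sum_compositions[of "\<lambda>n. fact n * fact (n - 1)" k s] by simp
    \<comment> \<open>The coefficient is the reciprocal of the order of the automorphism group: 1
      for \<open>k = 1\<close>, and \<open>1 / (2 * k)\<close> otherwise.\<close>
    moreover have "(1 + of_bool (k = 1)) / (2 * real k) * real (card (cycle_auts k)) = 1"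
      using card_cycle_auts_1 card_cycle_auts[of k] k by (cases "k = 1") auto
    moreover have "n = x * (c * y)" if "n * a = x * y" "c * a = 1" for n a x y c :: real
    proof -
      have "x * (c * y) = c * (n * a)" unfolding that(1) by simp
      also have "\<dots> = n * (c * a)" by simp
      finally show ?thesis using that(2) by simp
    qed
    ultimately have "real ?N = (fact s)\<^sup>2 * ((1 + of_bool (k = 1)) / (2 * real k) * ?S)"
      unfolding of_nat_mult by blast
    then show "(- 1) ^ (k - 1) * real ?N = (fact s)\<^sup>2 * ((- 1) ^ (k - 1) * (1 + of_bool (k = 1)) / (2 * real k) * ?S)"
      by simp
  qed
  also have "\<dots> = (fact s)\<^sup>2 *
      (\<Sum>k = 1..s. (- 1) ^ (k - 1) * (1 + of_bool (k = 1)) / (2 * real k) *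
        (\<Sum>I\<in>increasing_compositions k s.
          g_coeff I / (\<Prod>n<k. fact (I ! n) * fact (I ! n - 1))))"
    by (rule sum_distrib_left[symmetric])
  finally show "real_of_int (euler_characteristic (MRG1 s)) = \<dots>" .
qed

end
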